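(* (i) For every $k\ge1$, every $\varphi\in\mathcal H^{k-1}_c$ and every real $\alpha$, $$\partial S_k(\varphi)=(-1)^{k-1}P\,\partial S_k(P\varphi),\qquad \partial S_k(\varphi)=R_\alpha\,\partial S_k(R_\alpha\varphi).$$ In particular, $X_{S_k}(R_\alpha\varphi)=R_\alpha X_{S_k}(\varphi)$ and $X_{S_k}(P\varphi)=(-1)^kP X_{S_k}(\varphi)$. (ii) If $\varphi\in\mathcal H^{2m-1}_c$, $m\ge1$, satisfies $P\varphi=R_\alpha\varphi$ for some real $\alpha$, then $$-iJ\,\partial S_{2m}(\varphi)=\partial_x\,P\,\partial S_{2m-1}(\varphi).$$
   Context: Let $\mathbb T=\mathbb R/\mathbb Z$ and $\mathcal H^m_c=H^m(\mathbb T,\mathbb C)\times H^m(\mathbb T,\mathbb C)$ with elements $\varphi=(\varphi_1,\varphi_2)$. The gradient $\partial F=(\partial_{\varphi_1}F,\partial_{\varphi_2}F)$ is defined by $dF(\varphi)h=\int_{\mathbb T}(\partial_{\varphi_1}F\,h_1+\partial_{\varphi_2}F\,h_2)\,dx$. $$P=\begin{pmatrix}0&1\\1&0\end{pmatrix},\quad R_\alpha=\begin{pmatrix}e^{i\alpha}&0\\0&e^{-i\alpha}\end{pmatrix},\quad J=\begin{pmatrix}0&1\\-1&0\end{pmatrix},\quad X_F=-iJ\,\partial F.$$ NLS hierarchy: for smooth $\varphi$ put $r_1=\varphi_2$, $r_{n+1}=-i\partial_x r_n+\varphi_1\sum_{j=1}^{n-1}r_jr_{n-j}$ for $n\ge1$,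 and $S_n(\varphi)=\int_{\mathbb T}\varphi_1 r_n\,dx$. Thus $S_1=\int\varphi_1\varphi_2$, $S_2=\frac i2\int(\varphi_2\partial_x\varphi_1-\varphi_1\partial_x\varphi_2)$, $S_3=\int(\partial_x\varphi_1\partial_x\varphi_2+\varphi_1^2\varphi_2^2)$, $S_4=i\int(\varphi_1\partial_{xxx}\varphi_2-3\varphi_1^2\varphi_2\partial_x\varphi_2)$, and so on. $S_k$ is analytic on $\mathcal H^{k-1}_c$. *)

theory Defs
  imports "HOL-Analysis.Analysis"
begin

text \<open>
  Functions on the circle are 1-periodic functions on the real line, and elements of
  Lebesgue and Sobolev spaces are (Borel) representatives: equality in these spaces is
  equality almost everywhere, and is written as such. Pairs of scalar functions are
  functions with values in \<^typ>\<open>complex^2\<close>.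
\<close>

definition L2_circle :: "(real \<Rightarrow> complex) set" where
  "L2_circle = {f. (\<forall>x. f (x + 1) = f x) \<and> f \<in> borel_measurable borel \<and>
     set_integrable lborel {0..1} (\<lambda>x. (cmod (f x))\<^sup>2)}"

definition circle_integral :: "(real \<Rightarrow> complex) \<Rightarrow> complex" where
  "circle_integral f = (LINT x:{0..1}|lborel. f x)"

definition smooth_circle :: "(real \<Rightarrow> complex) set" where
  "smooth_circle = {\<psi>. (\<forall>x. \<psi> (x + 1) = \<psi> x) \<and>
     (\<exists>D :: nat \<Rightarrow> real \<Rightarrow> complex. D 0 = \<psi> \<and>
        (\<forall>n x. (D n has_vector_derivative D (Suc n) x) (at x)))}"

definition has_weak_deriv :: "(real \<Rightarrow> complex) \<Rightarrow> (real \<Rightarrow> complex) \<Rightarrow> bool" where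
  "has_weak_deriv f g \<longleftrightarrow> f \<in> L2_circle \<and> g \<in> L2_circle \<and>
     (\<forall>\<psi>\<in>smooth_circle.
        circle_integral (\<lambda>x. f x * vector_derivative \<psi> (at x)) =
        - circle_integral (\<lambda>x. g x * \<psi> x))"

text \<open>Determined up to null sets whenever a weak derivative in the above sense exists.\<close>

definition weak_deriv :: "(real \<Rightarrow> complex) \<Rightarrow> real \<Rightarrow> complex" where
  "weak_deriv f = (SOME g. has_weak_deriv f g)"

primrec sobolev :: "nat \<Rightarrow> (real \<Rightarrow> complex) set" where
  "sobolev 0 = L2_circle"
| "sobolev (Suc m) = {f. \<exists>g\<in>sobolev m. has_weak_deriv f g}"

definition sobolev_pair :: "nat \<Rightarrow> (real \<Rightarrow> complex^2) set" where
  "sobolev_pair m = {\<phi>. \<forall>i. (\<lambda>x. \<phi> x $ i) \<in> sobolev m}"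

definition weak_deriv_pair :: "(real \<Rightarrow> complex^2) \<Rightarrow> real \<Rightarrow> complex^2" where
  "weak_deriv_pair \<phi> x = (\<chi> i. weak_deriv (\<lambda>y. \<phi> y $ i) x)"

definition sobolev_norm :: "nat \<Rightarrow> (real \<Rightarrow> complex^2) \<Rightarrow> real" where
  "sobolev_norm m \<phi> = sqrt (\<Sum>i\<in>UNIV. \<Sum>j\<le>m.
     (LINT x:{0..1}|lborel. (cmod ((weak_deriv ^^ j) (\<lambda>y. \<phi> y $ i) x))\<^sup>2))"

text \<open>
  The functional \<open>F\<close> is Frechet differentiable at \<open>\<phi>\<close> with respect to the Sobolev norm of
  order \<open>m\<close>, and its differential is represented by the square integrable \<open>g\<close> through the
  bilinear (not sesquilinear) pairing. The differential is then automatically bounded and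
  complex linear, and it determines \<open>g\<close> up to null sets.
\<close>

definition has_gradient ::
  "nat \<Rightarrow> ((real \<Rightarrow> complex^2) \<Rightarrow> complex) \<Rightarrow> (real \<Rightarrow> complex^2) \<Rightarrow> (real \<Rightarrow> complex^2) \<Rightarrow> bool"
where
  "has_gradient m F \<phi> g \<longleftrightarrow> g \<in> sobolev_pair 0 \<and>
     (\<forall>\<epsilon>>0. \<exists>\<delta>>0. \<forall>h\<in>sobolev_pair m. sobolev_norm m h < \<delta> \<longrightarrow>
        cmod (F (\<lambda>x. \<phi> x + h x) - F \<phi> - circle_integral (\<lambda>x. g x $ 1 * h x $ 1 + g x $ 2 * h x $ 2))
          \<le> \<epsilon> * sobolev_norm m h)"

definition gradient ::
  "nat \<Rightarrow> ((real \<Rightarrow> complex^2) \<Rightarrow> complex) \<Rightarrow> (real \<Rightarrow> complex^2) \<Rightarrow> real \<Rightarrow> complex^2" where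
  "gradient m F \<phi> = (SOME g. has_gradient m F \<phi> g)"

definition P_mat :: "complex^2^2" where
  "P_mat = vector [vector [0, 1], vector [1, 0]]"

definition R_mat :: "real \<Rightarrow> complex^2^2" where
  "R_mat \<alpha> = vector [vector [exp (\<i> * of_real \<alpha>), 0], vector [0, exp (- \<i> * of_real \<alpha>)]]"

definition J_mat :: "complex^2^2" where
  "J_mat = vector [vector [0, 1], vector [-1, 0]]"

definition ham_field ::
  "nat \<Rightarrow> ((real \<Rightarrow> complex^2) \<Rightarrow> complex) \<Rightarrow> (real \<Rightarrow> complex^2) \<Rightarrow> real \<Rightarrow> complex^2" where
  "ham_field m F \<phi> x = (- \<i>) *s (J_mat *v gradient m F \<phi> x)"

text \<open>
  The recursion is written with weak derivatives, so that it makes sense directly (and not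
  only by continuous extension from smooth functions) for \<open>\<phi>\<close> in \<open>sobolev_pair (k - 1)\<close> and
  indices from 1 to \<open>k\<close>. The value at index 0 is a dummy.
\<close>

fun nls_r :: "(real \<Rightarrow> complex^2) \<Rightarrow> nat \<Rightarrow> real \<Rightarrow> complex" where
  "nls_r \<phi> 0 = (\<lambda>x. 0)"
| "nls_r \<phi> (Suc 0) = (\<lambda>x. \<phi> x $ 2)"
| "nls_r \<phi> (Suc (Suc n)) = (\<lambda>x. - \<i> * weak_deriv (nls_r \<phi> (Suc n)) x +
     \<phi> x $ 1 * (\<Sum>j = 1..n. nls_r \<phi> j x * nls_r \<phi> (Suc n - j) x))"

definition nls_S :: "nat \<Rightarrow> (real \<Rightarrow> complex^2) \<Rightarrow> complex" where
  "nls_S k \<phi> = circle_integral (\<lambda>x. \<phi> x $ 1 * nls_r \<phi> k x)"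

text \<open>The gradient and Hamiltonian vector field of \<open>nls_S k\<close> on its domain of order \<open>k - 1\<close>.\<close>

abbreviation grad_S :: "nat \<Rightarrow> (real \<Rightarrow> complex^2) \<Rightarrow> real \<Rightarrow> complex^2" where
  "grad_S k \<equiv> gradient (k - 1) (nls_S k)"

abbreviation X_S :: "nat \<Rightarrow> (real \<Rightarrow> complex^2) \<Rightarrow> real \<Rightarrow> complex^2" where
  "X_S k \<equiv> ham_field (k - 1) (nls_S k)"

end

theory Submission imports Defs begin

text \<open>
  With \<open>r = \<Sum>\<^sub>n r\<^sub>n z\<^sup>n\<close> the recursion of the hierarchy is the Riccati equation
  \<open>r = z (\<phi>\<^sub>2 - i r' + \<phi>\<^sub>1 r\<^sup>2)\<close>, and the Hamiltonians are the coefficients of the integral of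
  \<open>\<phi>\<^sub>1 r\<close>. Solving the adjoint \<open>w = z (\<phi>\<^sub>1 + i w' + 2 \<phi>\<^sub>1 r w)\<close> of the linearized equation
  shows that the gradient of \<open>S\<^sub>k\<close> is the pair of coefficients \<open>(p\<^sub>k, w\<^sub>k)\<close>, where
  \<open>p = r + r\<^sup>2 w\<close>. Together with \<open>a = r w\<close> these series satisfy the closed system
  \<open>p = z (\<phi>\<^sub>2 (1 + 2 a) - i p')\<close>, \<open>w = z (\<phi>\<^sub>1 (1 + 2 a) + i w')\<close>, \<open>a + a\<^sup>2 = w p\<close>,
  in which every coefficient is determined by the earlier ones (\<open>nls_system_unique\<close>).

  The system, unlike the Riccati equation, treats both components of \<open>\<phi>\<close> alike: interchanging
  them corresponds to the substitution of \<open>-z\<close> for \<open>z\<close> with \<open>p\<close> and \<open>w\<close> interchanged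
  (\<open>nls_system_swap\<close>), and a constant phase in \<open>\<phi>\<close> only changes the phases of \<open>p\<close> and \<open>w\<close>
  (\<open>nls_system_rotate\<close>). By uniqueness this is the behaviour of the gradients under \<open>P\<close> and
  \<open>R\<^sub>\<alpha>\<close>. If
  \<open>P \<phi> = R\<^sub>\<alpha> \<phi>\<close>, both operations lead to the same solution, so \<open>a(-z) = a(z)\<close> and the odd
  coefficients of \<open>a\<close> vanish (\<open>nls_a_odd\<close>). Then the coefficients of order \<open>2m\<close> of the first two
  equations read \<open>p\<^sub>2\<^sub>m = - i p'\<^sub>2\<^sub>m\<^sub>-\<^sub>1\<close> and \<open>w\<^sub>2\<^sub>m = i w'\<^sub>2\<^sub>m\<^sub>-\<^sub>1\<close>, which is the
  relation between the vector fields of \<open>S\<^sub>2\<^sub>m\<close> and \<open>S\<^sub>2\<^sub>m\<^sub>-\<^sub>1\<close>.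

  That \<open>(p\<^sub>k, w\<^sub>k)\<close> is the Frechet gradient follows from an exact expansion
  (\<open>nls_S_expansion\<close>): if \<open>d\<close> is the increment of \<open>r\<close> under \<open>\<phi> \<mapsto> \<phi> + h\<close>, the remainder after
  the linear term consists of integrals that contain two factors from \<open>h\<close> and \<open>d\<close>, and \<open>d\<close> is
  of first order in \<open>h\<close> (\<open>vanishing_order_nls_d\<close>). The analysis behind it is that of Sobolev
  spaces on the circle. A function has the weak derivative \<open>g\<close> exactly if it is almost everywhere
  a constant plus a primitive of \<open>g\<close>, where \<open>g\<close> has mean zero (\<open>has_weak_deriv_iff\<close>). From this
  follow the Leibniz rule, the supremum bound and the estimates for products
  (\<open>sobolev_mult\<close>). The fundamental lemma of the calculus of variations makes weak derivatives
  and gradients unique up to null sets.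
\<close>

section \<open>The circle as a measure space\<close>

abbreviation circ :: "real measure" where
  "circ \<equiv> restrict_space lborel {0..1}"

lemma space_circ [simp]: "space circ = {0..1}"
  by (simp add: space_restrict_space)

lemma emeasure_circ_space [simp]: "emeasure circ {0..1} = 1"
  by (simp add: emeasure_restrict_space)

lemma measure_circ_space [simp]: "measure circ {0..1} = 1"
  by (simp add: measure_def)

interpretation circ: finite_measure circ
  by standard (simp add: emeasure_restrict_space)

lemma circle_integral_eq: "circle_integral f = (LINT x|circ. f x)"
  unfolding circle_integral_def set_lebesgue_integral_def by (subst integral_restrict_space) auto

lemma set_integrable_iff_circ:
  fixes f :: "real \<Rightarrow> 'b::{banach, second_countable_topology}"
  shows "set_integrable lborel {0..1} f \<longleftrightarrow> integrable circ f"
  unfolding set_integrable_def by (rule integrable_restrict_space[symmetric]) simp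

lemma measurable_circ: "f \<in> borel_measurable borel \<Longrightarrow> f \<in> borel_measurable circ"
  by (simp add: measurable_restrict_space1)

lemma AE_circ_iff: "(AE x in circ. P x) \<longleftrightarrow> (AE x in lborel. 0 \<le> x \<and> x \<le> 1 \<longrightarrow> P x)"
  by (subst AE_restrict_space_iff) auto

lemma AE_circ_I: "(AE x in lborel. P x) \<Longrightarrow> AE x in circ. P x"
  unfolding AE_circ_iff by auto

lemma periodic_int:
  assumes "\<And>x. f (x + 1) = f (x::real)"
  shows "f (x + real_of_int n) = f x"
proof -
  have nat: "f (x + real k) = f x" for k x
  proof (induction k)
    case (Suc k)
    have "f (x + real (Suc k)) = f ((x + real k) + 1)" by (simp add: ac_simps)
    then show ?case using assms Suc by simp
  qed simp
  show ?thesis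
  proof (cases "n \<ge> 0")
    case True then show ?thesis using nat[of x "nat n"] by simp
  next
    case False then show ?thesis using nat[of "x + real_of_int n" "nat (- n)"] by simp
  qed
qed

text \<open>
  A null set of exceptions in the period \<open>[0, 1]\<close> has countably many translates that cover the line,
  which passes from statements on the circle to the almost everywhere statements on the line.
\<close>

lemma AE_periodic:
  assumes per: "\<And>x. P (x + 1) = P (x::real)" and ae: "AE x in circ. P x"
  shows "AE x in lborel. P x"
proof -
  have shift: "AE x in lborel. x \<in> {real_of_int n .. real_of_int n + 1} \<longrightarrow> P x" for n :: int
  proof -
    have "AE x in distr lborel borel (\<lambda>x. - real_of_int n + x). x \<in> {0..1} \<longrightarrow> P x"
      using ae unfolding lborel_distr_plus AE_circ_iff by simp
    then have "AE x in lborel. - real_of_int n + x \<in> {0..1} \<longrightarrow> P (- real_of_int n + x)"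
      by (rule AE_distrD[rotated]) simp
    then show ?thesis
    proof eventually_elim
      case (elim x)
      then show ?case
        using periodic_int[of P "x" "- n"] per by (auto simp: algebra_simps)
    qed
  qed
  have "AE x in lborel. \<forall>n::int. x \<in> {real_of_int n .. real_of_int n + 1} \<longrightarrow> P x"
    unfolding AE_all_countable using shift by blast
  then show ?thesis
  proof eventually_elim
    case (elim x)
    from elim[rule_format, of "\<lfloor>x\<rfloor>"] show ?case by (simp add: le_less_Suc_eq)
  qed
qed

section \<open>Square integrable functions\<close>

lemma L2_circle_iff:
  "f \<in> L2_circle \<longleftrightarrow> (\<forall>x. f (x + 1) = f x) \<and> f \<in> borel_measurable borel \<and>
     integrable circ (\<lambda>x. (cmod (f x))\<^sup>2)"
  by (simp add: L2_circle_def set_integrable_iff_circ)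

lemma L2_periodic: "f \<in> L2_circle \<Longrightarrow> f (x + 1) = f x"
  and L2_measurable: "f \<in> L2_circle \<Longrightarrow> f \<in> borel_measurable borel"
  and L2_square_integrable: "f \<in> L2_circle \<Longrightarrow> integrable circ (\<lambda>x. (cmod (f x))\<^sup>2)"
  by (auto simp: L2_circle_iff)

lemma L2_AE: "f \<in> L2_circle \<Longrightarrow> g \<in> L2_circle \<Longrightarrow> AE x in circ. f x = g x \<Longrightarrow> AE x in lborel. f x = g x"
  by (rule AE_periodic) (simp_all add: L2_periodic)

lemma L2_integrable_mult:
  assumes "f \<in> L2_circle" "g \<in> L2_circle"
  shows "integrable circ (\<lambda>x. f x * g x)"
proof (rule Bochner_Integration.integrable_bound)
  show "integrable circ (\<lambda>x. (cmod (f x))\<^sup>2 + (cmod (g x))\<^sup>2)"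
    using assms by (simp add: L2_circle_iff)
  show "(\<lambda>x. f x * g x) \<in> borel_measurable circ"
    using assms by (intro measurable_circ) (auto simp: L2_circle_iff)
  have "cmod (f x) * cmod (g x) \<le> (cmod (f x))\<^sup>2 + (cmod (g x))\<^sup>2" for x
    using sum_squares_bound[of "cmod (f x)" "cmod (g x)"]
      mult_nonneg_nonneg[of "cmod (f x)" "cmod (g x)"] norm_ge_zero[of "f x"] norm_ge_zero[of "g x"]
    by linarith
  then show "AE x in circ. norm (f x * g x) \<le> norm ((cmod (f x))\<^sup>2 + (cmod (g x))\<^sup>2)"
    by (simp add: norm_mult)
qed

lemma L2_const [simp]: "(\<lambda>x. c) \<in> L2_circle"
  by (simp add: L2_circle_iff)

lemma L2_integrable: "f \<in> L2_circle \<Longrightarrow> integrable circ f"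
  using L2_integrable_mult[of f "\<lambda>x. 1"] by simp

lemma L2_scale: "f \<in> L2_circle \<Longrightarrow> (\<lambda>x. c * f x) \<in> L2_circle"
  by (auto simp: L2_circle_iff norm_mult power_mult_distrib)

lemma L2_add:
  assumes "f \<in> L2_circle" "g \<in> L2_circle"
  shows "(\<lambda>x. f x + g x) \<in> L2_circle"
proof -
  have "integrable circ (\<lambda>x. (cmod (f x + g x))\<^sup>2)"
  proof (rule Bochner_Integration.integrable_bound)
    show "integrable circ (\<lambda>x. 2 * (cmod (f x))\<^sup>2 + 2 * (cmod (g x))\<^sup>2)"
      using assms by (simp add: L2_circle_iff)
    show "(\<lambda>x. (cmod (f x + g x))\<^sup>2) \<in> borel_measurable circ"
      using assms by (intro measurable_circ) (auto simp: L2_circle_iff)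
    have "(cmod (f x + g x))\<^sup>2 \<le> 2 * (cmod (f x))\<^sup>2 + 2 * (cmod (g x))\<^sup>2" for x
    proof -
      have "(cmod (f x + g x))\<^sup>2 \<le> (cmod (f x) + cmod (g x))\<^sup>2"
        by (intro power_mono norm_triangle_ineq) simp
      then show ?thesis
        using sum_squares_bound[of "cmod (f x)" "cmod (g x)"] by (simp add: power2_sum)
    qed
    then show "AE x in circ. norm ((cmod (f x + g x))\<^sup>2) \<le> norm (2 * (cmod (f x))\<^sup>2 + 2 * (cmod (g x))\<^sup>2)"
      by simp
  qed
  then show ?thesis using assms by (auto simp: L2_circle_iff)
qed

definition L2_norm :: "(real \<Rightarrow> complex) \<Rightarrow> real" where
  "L2_norm f = sqrt (LINT x|circ. (cmod (f x))\<^sup>2)"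

lemma L2_norm_nonneg [simp]: "0 \<le> L2_norm f"
  by (simp add: L2_norm_def)

lemma L2_norm_square: "(L2_norm f)\<^sup>2 = (LINT x|circ. (cmod (f x))\<^sup>2)"
  by (simp add: L2_norm_def)

lemma L2_norm_cong_AE:
  assumes "f \<in> borel_measurable borel" "g \<in> borel_measurable borel" "AE x in circ. f x = g x"
  shows "L2_norm f = L2_norm g"
  unfolding L2_norm_def using assms
  by (intro arg_cong[of _ _ sqrt] integral_cong_AE) (auto intro!: measurable_circ)

lemma L2_norm_scale: "L2_norm (\<lambda>x. c * f x) = cmod c * L2_norm f"
  by (simp add: L2_norm_def norm_mult power_mult_distrib real_sqrt_mult)

text \<open>
  The quadratic polynomial \<open>\<integral> (t \<bar>f\<bar> + \<bar>g\<bar>)\<^sup>2\<close> in \<open>t\<close> is nonnegative, hence has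
  nonpositive discriminant.
\<close>

lemma L2_norm_Cauchy_Schwarz_cmod:
  assumes f: "f \<in> L2_circle" and g: "g \<in> L2_circle"
  shows "(LINT x|circ. cmod (f x) * cmod (g x)) \<le> L2_norm f * L2_norm g"
proof -
  let ?I = "LINT x|circ. cmod (f x) * cmod (g x)"
  have int: "integrable circ (\<lambda>x. cmod (f x) * cmod (g x))"
    using integrable_norm[OF L2_integrable_mult[OF f g]] by (simp add: norm_mult)
  have quad: "0 \<le> (L2_norm f)\<^sup>2 * t\<^sup>2 + 2 * t * ?I + (L2_norm g)\<^sup>2" for t
  proof -
    have "0 \<le> (LINT x|circ. (t * cmod (f x) + cmod (g x))\<^sup>2)"
      by simp
    also have "\<dots> = (LINT x|circ. t\<^sup>2 * (cmod (f x))\<^sup>2 + 2 * t * (cmod (f x) * cmod (g x)) + (cmod (g x))\<^sup>2)"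
      by (simp add: power2_sum power_mult_distrib algebra_simps)
    also have "\<dots> = t\<^sup>2 * (L2_norm f)\<^sup>2 + 2 * t * ?I + (L2_norm g)\<^sup>2"
      using f g int by (simp add: L2_norm_square L2_square_integrable)
    finally show ?thesis by (simp add: mult.commute)
  qed
  show ?thesis
  proof (cases "L2_norm f = 0")
    case True
    have "?I \<le> 0"
    proof (rule ccontr)
      assume "\<not> ?I \<le> 0"
      with quad[of "- ((L2_norm g)\<^sup>2 + 1) / (2 * ?I)"] True show False
        by (simp add: field_simps)
    qed
    with True show ?thesis by simp
  next
    case False
    then have pos: "(L2_norm f)\<^sup>2 > 0" by simp
    have "0 \<le> (L2_norm f)\<^sup>2 * (- ?I / (L2_norm f)\<^sup>2)\<^sup>2 + 2 * (- ?I / (L2_norm f)\<^sup>2) * ?I + (L2_norm g)\<^sup>2"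
      by (rule quad)
    also have "\<dots> = (L2_norm g)\<^sup>2 - ?I\<^sup>2 / (L2_norm f)\<^sup>2"
      using False by (simp add: field_simps power2_eq_square)
    finally have "?I\<^sup>2 \<le> (L2_norm f * L2_norm g)\<^sup>2"
      using pos by (simp add: field_simps power_mult_distrib)
    then show ?thesis
      by (rule power2_le_imp_le) simp
  qed
qed

lemma L2_norm_Cauchy_Schwarz:
  assumes f: "f \<in> L2_circle" and g: "g \<in> L2_circle"
  shows "cmod (LINT x|circ. f x * g x) \<le> L2_norm f * L2_norm g"
  using L2_norm_Cauchy_Schwarz_cmod[OF assms] integral_norm_bound[of circ "\<lambda>x. f x * g x"]
  by (simp add: norm_mult)

lemma L1_le_L2_norm:
  assumes f: "f \<in> L2_circle"
  shows "(LINT x|circ. cmod (f x)) \<le> L2_norm f"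
  using L2_norm_Cauchy_Schwarz_cmod[OF f L2_const[of 1]] by (simp add: L2_norm_def)

lemma L2_norm_triangle:
  assumes f: "f \<in> L2_circle" and g: "g \<in> L2_circle"
  shows "L2_norm (\<lambda>x. f x + g x) \<le> L2_norm f + L2_norm g"
proof -
  have int: "integrable circ (\<lambda>x. cmod (f x) * cmod (g x))"
    using integrable_norm[OF L2_integrable_mult[OF f g]] by (simp add: norm_mult)
  have "(L2_norm (\<lambda>x. f x + g x))\<^sup>2 = (LINT x|circ. (cmod (f x + g x))\<^sup>2)"
    by (rule L2_norm_square)
  also have "\<dots> \<le> (LINT x|circ. (cmod (f x))\<^sup>2 + 2 * (cmod (f x) * cmod (g x)) + (cmod (g x))\<^sup>2)"
  proof (rule integral_mono)
    show "integrable circ (\<lambda>x. (cmod (f x + g x))\<^sup>2)"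
      using L2_add[OF f g] by (rule L2_square_integrable)
    show "integrable circ (\<lambda>x. (cmod (f x))\<^sup>2 + 2 * (cmod (f x) * cmod (g x)) + (cmod (g x))\<^sup>2)"
      using f g int by (simp add: L2_square_integrable)
    show "(cmod (f x + g x))\<^sup>2 \<le> (cmod (f x))\<^sup>2 + 2 * (cmod (f x) * cmod (g x)) + (cmod (g x))\<^sup>2" for x
      using power_mono[OF norm_triangle_ineq[of "f x" "g x"], of 2] by (simp add: power2_sum)
  qed
  also have "\<dots> = (L2_norm f)\<^sup>2 + 2 * (LINT x|circ. cmod (f x) * cmod (g x)) + (L2_norm g)\<^sup>2"
    using f g int by (simp add: L2_norm_square L2_square_integrable)
  also have "\<dots> \<le> (L2_norm f + L2_norm g)\<^sup>2"
    using L2_norm_Cauchy_Schwarz_cmod[OF f g] by (simp add: power2_sum)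
  finally show ?thesis by (rule power2_le_imp_le) simp
qed

section \<open>Smooth test functions\<close>

text \<open>
  A class of periodic functions that contains a derivative of each of its members consists of smooth
  functions. This avoids formulas for higher derivatives: membership of one derivative is enough.
\<close>

lemma smooth_circle_coinduct:
  assumes \<psi>: "\<psi> \<in> A"
    and per: "\<And>f x. f \<in> A \<Longrightarrow> f (x + 1) = f x"
    and der: "\<And>f. f \<in> A \<Longrightarrow> \<exists>g\<in>A. \<forall>x. (f has_vector_derivative g x) (at x)"
  shows "\<psi> \<in> smooth_circle"
proof -
  from der obtain d where d: "\<And>f. f \<in> A \<Longrightarrow> d f \<in> A \<and> (\<forall>x. (f has_vector_derivative d f x) (at x))"
    by metis
  have in_A: "(d ^^ n) \<psi> \<in> A" for n
    by (induction n) (use \<psi> d in auto)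
  have "((d ^^ n) \<psi> has_vector_derivative (d ^^ Suc n) \<psi> x) (at x)" for n x
    using d[OF in_A[of n]] by simp
  then show ?thesis
    unfolding smooth_circle_def using per[OF \<psi>]
    by (auto intro!: exI[of _ "\<lambda>n. (d ^^ n) \<psi>"])
qed

text \<open>
  If \<open>s' = c \<cdot> sin (\<pi> (2x - b)) \<cdot> s (1 - s)\<close> for a constant \<open>c\<close>, this algebra is closed under
  differentiation.
\<close>

inductive_set step_algebra :: "real \<Rightarrow> (real \<Rightarrow> real) \<Rightarrow> (real \<Rightarrow> complex) set" for b s where
  const: "(\<lambda>x. c) \<in> step_algebra b s"
| cosine: "(\<lambda>x. of_real (cos (pi * (2 * x - b)))) \<in> step_algebra b s"
| sine: "(\<lambda>x. of_real (sin (pi * (2 * x - b)))) \<in> step_algebra b s"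
| step: "(\<lambda>x. of_real (s x)) \<in> step_algebra b s"
| add: "f \<in> step_algebra b s \<Longrightarrow> g \<in> step_algebra b s \<Longrightarrow> (\<lambda>x. f x + g x) \<in> step_algebra b s"
| mult: "f \<in> step_algebra b s \<Longrightarrow> g \<in> step_algebra b s \<Longrightarrow> (\<lambda>x. f x * g x) \<in> step_algebra b s"

text \<open>
  The logistic function of \<open>n v\<close>, where \<open>v(x) = sin (\<pi> x) sin (\<pi> (b - x))\<close> has period 1 and is
  positive on \<open>(0, b)\<close> and negative on \<open>(b, 1)\<close>. Its limit for large \<open>n\<close> is the indicator of
  \<open>[0, b]\<close> almost everywhere on the period.
\<close>

definition smooth_step :: "real \<Rightarrow> nat \<Rightarrow> real \<Rightarrow> real" where
  "smooth_step b n x = 1 / (1 + exp (- real n * (sin (pi * x) * sin (pi * (b - x)))))"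

lemma step_profile: "sin (pi * x) * sin (pi * (b - x)) = (cos (pi * (2 * x - b)) - cos (pi * b)) / 2"
proof -
  have "cos (pi * (2 * x - b)) = cos (pi * x - pi * (b - x))" by (simp add: algebra_simps)
  moreover have "cos (pi * b) = cos (pi * x + pi * (b - x))" by (simp add: algebra_simps)
  ultimately show ?thesis by (simp add: cos_add cos_diff)
qed

lemma smooth_step_deriv:
  "(smooth_step b n has_real_derivative
     - (real n * pi) * sin (pi * (2 * x - b)) * smooth_step b n x * (1 - smooth_step b n x)) (at x)"
proof -
  define e where "e = exp (- real n * ((cos (pi * (2 * x - b)) - cos (pi * b)) / 2))"
  have e: "e > 0" by (simp add: e_def)
  have *: "smooth_step b n = (\<lambda>x. 1 / (1 + exp (- real n * ((cos (pi * (2 * x - b)) - cos (pi * b)) / 2))))"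
    by (simp add: smooth_step_def fun_eq_iff step_profile)
  have "1 + e \<noteq> 0" using e by simp
  have nz: "1 + exp t \<noteq> (0::real)" for t by (smt (verit) exp_gt_zero)
  have e2: "e = exp (- (real n * (cos (pi * (2 * x - b)) - cos (pi * b)) / 2))"
    by (simp add: e_def)
  have "(smooth_step b n has_real_derivative
     - (e * (real n * (pi * sin (pi * (2 * x - b))))) / (1 + e)^2) (at x)"
    unfolding * using e
    by (auto intro!: derivative_eq_intros simp: nz e2 power2_eq_square mult.commute)
  moreover have "- (e * (real n * (pi * sin (pi * (2 * x - b))))) / (1 + e)^2 =
      - (real n * pi) * sin (pi * (2 * x - b)) * (1 / (1 + e)) * (1 - 1 / (1 + e))"
    using \<open>1 + e \<noteq> 0\<close> by (simp add: divide_simps power2_eq_square)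
  moreover have "smooth_step b n x = 1 / (1 + e)"
    by (simp add: * e_def)
  ultimately show ?thesis by simp
qed

lemma of_real_has_vector_derivative:
  "(f has_real_derivative D) (at x) \<Longrightarrow> ((\<lambda>x. complex_of_real (f x)) has_vector_derivative of_real D) (at x)"
  by (rule has_vector_derivative_of_real) (simp add: has_real_derivative_iff_has_vector_derivative)

lemma smooth_step_smooth: "(\<lambda>x. complex_of_real (smooth_step b n x)) \<in> smooth_circle"
proof (rule smooth_circle_coinduct)
  let ?s = "smooth_step b n"
  show "(\<lambda>x. complex_of_real (?s x)) \<in> step_algebra b ?s"
    by (rule step_algebra.step)
  have shift: "pi * (2 * (x + 1) - b) = pi * (2 * x - b) + 2 * pi" for x
    by (simp add: algebra_simps)
  have s_per: "?s (x + 1) = ?s x" for x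
    unfolding smooth_step_def step_profile shift by simp
  show "f (x + 1) = f x" if "f \<in> step_algebra b ?s" for f x
    using that by induction (simp_all only: shift s_per sin_periodic cos_periodic)
  show "\<exists>g\<in>step_algebra b ?s. \<forall>x. (f has_vector_derivative g x) (at x)" if "f \<in> step_algebra b ?s" for f
    using that
  proof induction
    case (const c)
    show ?case
      by (rule bexI[of _ "\<lambda>x. 0"]) (auto intro: step_algebra.const)
  next
    case cosine
    have "((\<lambda>x. complex_of_real (cos (pi * (2 * x - b)))) has_vector_derivative
        of_real (- (2 * pi)) * of_real (sin (pi * (2 * x - b)))) (at x)" for x
      by (rule has_vector_derivative_eq_rhs, rule of_real_has_vector_derivative)
         (auto intro!: derivative_eq_intros)
    then show ?case
      by (intro bexI[of _ "\<lambda>x. of_real (- (2 * pi)) * of_real (sin (pi * (2 * x - b)))"] allI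
          step_algebra.mult step_algebra.const step_algebra.sine)
  next
    case sine
    have "((\<lambda>x. complex_of_real (sin (pi * (2 * x - b)))) has_vector_derivative
        of_real (2 * pi) * of_real (cos (pi * (2 * x - b)))) (at x)" for x
      by (rule has_vector_derivative_eq_rhs, rule of_real_has_vector_derivative)
         (auto intro!: derivative_eq_intros)
    then show ?case
      by (intro bexI[of _ "\<lambda>x. of_real (2 * pi) * of_real (cos (pi * (2 * x - b)))"] allI
          step_algebra.mult step_algebra.const step_algebra.cosine)
  next
    case step
    have "((\<lambda>x. complex_of_real (?s x)) has_vector_derivative
        of_real (- (real n * pi)) * (of_real (sin (pi * (2 * x - b))) * (of_real (?s x) *
          (1 + (- 1) * of_real (?s x))))) (at x)" for x
      by (rule has_vector_derivative_eq_rhs, rule of_real_has_vector_derivative, rule smooth_step_deriv)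
         (simp add: algebra_simps)
    then show ?case
      by (intro bexI[of _ "\<lambda>x. of_real (- (real n * pi)) * (of_real (sin (pi * (2 * x - b))) *
          (of_real (?s x) * (1 + (- 1) * of_real (?s x))))"] allI
          step_algebra.mult step_algebra.add step_algebra.const step_algebra.sine step_algebra.step)
  next
    case (add f g)
    then obtain f' g' where "f' \<in> step_algebra b ?s" "g' \<in> step_algebra b ?s"
      "\<And>x. (f has_vector_derivative f' x) (at x)" "\<And>x. (g has_vector_derivative g' x) (at x)"
      by blast
    then show ?case
      by (intro bexI[of _ "\<lambda>x. f' x + g' x"] allI has_vector_derivative_add step_algebra.add)
  next
    case (mult f g)
    then obtain f' g' where "f' \<in> step_algebra b ?s" "g' \<in> step_algebra b ?s"
      "\<And>x. (f has_vector_derivative f' x) (at x)" "\<And>x. (g has_vector_derivative g' x) (at x)"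
      by blast
    with mult show ?case
      by (intro bexI[of _ "\<lambda>x. f x * g' x + f' x * g x"] allI has_vector_derivative_mult
          step_algebra.add step_algebra.mult)
  qed
qed

lemma smooth_step_bounds: "0 \<le> smooth_step b n x" "smooth_step b n x \<le> 1"
  by (auto simp: smooth_step_def add_pos_pos intro!: divide_nonneg_pos)

lemma smooth_step_tendsto:
  assumes b: "0 \<le> b" "b \<le> 1" and x: "0 < x" "x < 1" "x \<noteq> b"
  shows "(\<lambda>n. smooth_step b n x) \<longlonglongrightarrow> (if x \<le> b then 1 else 0)"
proof (cases "x \<le> b")
  case True
  define v where "v = sin (pi * x) * sin (pi * (b - x))"
  have "v > 0" unfolding v_def using assms True
    by (intro mult_pos_pos sin_gt_zero) (auto simp: mult_less_cancel_left1)
  then have "filterlim (\<lambda>n. real n * v) at_top sequentially"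
    by (rule filterlim_at_top_mult_tendsto_pos[OF tendsto_const _ filterlim_real_sequentially])
  then have "(\<lambda>n. exp (- (real n * v))) \<longlonglongrightarrow> 0"
    by (intro filterlim_compose[OF exp_at_bot]) (simp add: filterlim_uminus_at_top)
  then have "(\<lambda>n. 1 / (1 + exp (- (real n * v)))) \<longlonglongrightarrow> 1 / (1 + 0)"
    by (intro tendsto_intros) simp_all
  then show ?thesis using True by (simp add: smooth_step_def v_def)
next
  case False
  define v where "v = sin (pi * x) * sin (pi * (x - b))"
  have "v > 0" unfolding v_def using assms False
    by (intro mult_pos_pos sin_gt_zero) (auto simp: mult_less_cancel_left1)
  moreover have "sin (pi * (b - x)) = - sin (pi * (x - b))"
    by (metis minus_diff_eq mult_minus_right sin_minus)
  ultimately have "sin (pi * x) * sin (pi * (b - x)) = - v" by (simp add: v_def)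
  moreover have "(\<lambda>n. 1 / (1 + exp (real n * v))) \<longlonglongrightarrow> 0"
    by (rule real_tendsto_divide_at_top[OF tendsto_const])
       (intro filterlim_tendsto_add_at_top[OF tendsto_const] filterlim_compose[OF exp_at_top]
        filterlim_at_top_mult_tendsto_pos[OF tendsto_const \<open>v > 0\<close>] filterlim_real_sequentially)
  ultimately show ?thesis using False by (simp add: smooth_step_def)
qed

section \<open>The fundamental lemma of the calculus of variations\<close>

lemma AE_circ_not_in_finite: "finite F \<Longrightarrow> AE x in circ. x \<notin> F"
  by (rule AE_circ_I) (auto intro!: AE_not_in finite_imp_null_set_lborel)

lemma smooth_circle_measurable: 
  assumes "\<psi> \<in> smooth_circle" shows "\<psi> \<in> borel_measurable borel"
proof -
  obtain D where D: "D 0 = \<psi>" "\<And>n x. (D n has_vector_derivative D (Suc n) x) (at x)"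
    using assms unfolding smooth_circle_def by blast
  have "continuous (at x) \<psi>" for x
    using has_vector_derivative_continuous[OF D(2)[of 0]] D(1) by simp
  then have "continuous_on UNIV \<psi>" by (simp add: continuous_at_imp_continuous_on)
  then show ?thesis by (rule borel_measurable_continuous_onI)
qed

lemma integral_initial_segment_eq_0:
  assumes g: "integrable circ g"
    and orth: "\<And>\<psi>. \<psi> \<in> smooth_circle \<Longrightarrow> (LINT x|circ. g x * \<psi> x) = 0"
    and b: "0 \<le> b" "b \<le> 1"
  shows "(LINT x|circ. (if x \<le> b then g x else 0)) = 0"
proof -
  have "(\<lambda>n. LINT x|circ. g x * of_real (smooth_step b n x)) \<longlonglongrightarrow> (LINT x|circ. (if x \<le> b then g x else 0))"
  proof (rule integral_dominated_convergence)
    show "integrable circ (\<lambda>x. cmod (g x))" using g by simp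
    have [measurable]: "g \<in> borel_measurable circ" using g by simp
    have [measurable]: "(\<lambda>x. x) \<in> borel_measurable circ" by (intro measurable_circ) simp
    show "(\<lambda>x. if x \<le> b then g x else 0) \<in> borel_measurable circ" by measurable
    have [measurable]: "(\<lambda>x. complex_of_real (smooth_step b n x)) \<in> borel_measurable circ" for n
      using smooth_circle_measurable[OF smooth_step_smooth] by (rule measurable_circ)
    show "(\<lambda>x. g x * of_real (smooth_step b n x)) \<in> borel_measurable circ" for n by measurable
    show "AE x in circ. norm (g x * of_real (smooth_step b n x)) \<le> cmod (g x)" for n
      using smooth_step_bounds by (auto simp: norm_mult intro!: mult_left_le)
    have "AE x in circ. x \<notin> {0, 1, b}" by (rule AE_circ_not_in_finite) simp
    with AE_space show "AE x in circ. (\<lambda>n. g x * of_real (smooth_step b n x)) \<longlonglongrightarrow> (if x \<le> b then g x else 0)"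
    proof eventually_elim
      case (elim x)
      then have "(\<lambda>n. smooth_step b n x) \<longlonglongrightarrow> (if x \<le> b then 1 else 0)"
        using b by (intro smooth_step_tendsto) auto
      then have "(\<lambda>n. g x * of_real (smooth_step b n x)) \<longlonglongrightarrow> g x * of_real (if x \<le> b then 1 else 0)"
        by (intro tendsto_intros)
      then show ?case by (simp split: if_splits)
    qed
  qed
  moreover have "(LINT x|circ. g x * of_real (smooth_step b n x)) = 0" for n
    by (rule orth[OF smooth_step_smooth])
  ultimately show ?thesis by (simp add: LIMSEQ_const_iff)
qed

text \<open>
  Smooth steps converge boundedly to indicators of initial segments, so the integral of \<open>g\<close> over
  each of these vanishes. They generate the Borel sets, and a function whose integrals over all Borel
  sets vanish is zero almost everywhere.
\<close>

lemma fundamental_lemma: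
  assumes g: "integrable circ g"
    and orth: "\<And>\<psi>. \<psi> \<in> smooth_circle \<Longrightarrow> (LINT x|circ. g x * \<psi> x) = 0"
  shows "AE x in circ. g x = 0"
proof -
  define G where "G = (\<lambda>x. indicator {0..1} x *\<^sub>R g x)"
  have G: "integrable lborel G"
    using g unfolding G_def by (subst (asm) integrable_restrict_space) auto
  have G_A: "set_integrable lborel A G" if "A \<in> sets borel" for A
    using G that unfolding set_integrable_def by (intro integrable_mult_indicator) auto
  have seg: "(LINT x:{..b}|lborel. G x) = 0" for b
  proof (cases "b < 0")
    case True
    then show ?thesis
      unfolding set_lebesgue_integral_def G_def
      by (intro integral_eq_zero_AE) (auto split: split_indicator)
  next
    case False
    have "(LINT x:{..b}|lborel. G x) = (LINT x|circ. (if x \<le> min b 1 then g x else 0))"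
      unfolding set_lebesgue_integral_def G_def
      by (subst integral_restrict_space) (auto intro!: Bochner_Integration.integral_cong split: split_indicator)
    then show ?thesis
      using integral_initial_segment_eq_0[OF g orth, of "min b 1"] False by simp
  qed
  have all: "(LINT x|lborel. G x) = 0"
  proof -
    have "(LINT x|lborel. G x) = (LINT x:{..1}|lborel. G x)"
      unfolding set_lebesgue_integral_def G_def
      by (intro Bochner_Integration.integral_cong) (auto split: split_indicator)
    then show ?thesis using seg by simp
  qed
  have "AE x in lborel. G x = 0"
  proof (rule sigma_finite_measure.density_zero[OF lborel.sigma_finite_measure_axioms G])
    fix A :: "real set" assume "A \<in> sets lborel"
    then have A: "A \<in> sigma_sets UNIV (range atMost)"
      by (simp add: borel_eq_atMost sets_measure_of)
    have eq: "sigma_sets UNIV (range atMost) = sets (borel :: real measure)"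
      by (simp add: borel_eq_atMost sets_measure_of)
    have stable: "Int_stable (range (atMost :: real \<Rightarrow> real set))"
      by (auto simp: Int_stable_def)
    have sub: "range atMost \<subseteq> Pow (UNIV :: real set)" by simp
    from stable sub A
    show "(LINT x:A|lborel. G x) = 0"
    proof (induction rule: sigma_sets_induct_disjoint)
      case (basic A) then show ?case using seg by auto
    next
      case empty show ?case by (simp add: set_lebesgue_integral_def)
    next
      case (compl A)
      then have "A \<in> sets borel" using eq by simp
      then have "(LINT x:A \<union> (UNIV - A)|lborel. G x) = (LINT x:A|lborel. G x) + (LINT x:UNIV - A|lborel. G x)"
        by (intro set_integral_Un G_A) auto
      then show ?case using compl all by (simp add: set_lebesgue_integral_def)
    next
      case (union A)
      then have "A i \<in> sets borel" for i using eq by auto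
      then have "(LINT x:(\<Union>i. A i)|lborel. G x) = (\<Sum>i. LINT x:A i|lborel. G x)"
        using union(1) by (intro lebesgue_integral_countable_add G_A) (auto simp: disjoint_family_on_def)
      then show ?case using union by simp
    qed
  qed
  then show ?thesis
    unfolding AE_circ_iff G_def by eventually_elim auto
qed

section \<open>Primitives of integrable functions\<close>

definition primitive :: "(real \<Rightarrow> complex) \<Rightarrow> real \<Rightarrow> complex" where
  "primitive g x = (LINT s|circ. (if s \<le> x then g s else 0))"

lemma primitive_strict: "primitive g x = (LINT s|circ. (if s < x then g s else 0))"
  if g: "g \<in> borel_measurable circ"
proof -
  note [measurable] = g
  have [measurable]: "(\<lambda>x. x) \<in> borel_measurable circ" by (intro measurable_circ) simp
  have "AE s in circ. s \<notin> {x}" by (rule AE_circ_not_in_finite) simp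
  then have "AE s in circ. (if s \<le> x then g s else 0) = (if s < x then g s else 0)"
    by eventually_elim auto
  then show ?thesis unfolding primitive_def
    by (intro integral_cong_AE) measurable
qed

lemma integrable_if:
  fixes g :: "real \<Rightarrow> complex"
  assumes g: "integrable circ g" and [measurable]: "Measurable.pred circ P"
  shows "integrable circ (\<lambda>s. if P s then g s else 0)"
proof (rule Bochner_Integration.integrable_bound[OF g])
  have [measurable]: "g \<in> borel_measurable circ" using g by simp
  show "(\<lambda>s. if P s then g s else 0) \<in> borel_measurable circ" by measurable
qed auto

lemma primitive_bound:
  assumes g: "integrable circ g"
  shows "cmod (primitive g x) \<le> (LINT s|circ. cmod (g s))"
proof -
  have [measurable]: "(\<lambda>x. x) \<in> borel_measurable circ" by (intro measurable_circ) simp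
  have "cmod (primitive g x) \<le> (LINT s|circ. cmod (if s \<le> x then g s else 0))"
    unfolding primitive_def by (rule integral_norm_bound)
  also have "\<dots> \<le> (LINT s|circ. cmod (g s))"
    by (intro integral_mono integrable_norm integrable_if g) auto
  finally show ?thesis .
qed

lemma primitive_measurable:
  assumes g: "integrable circ g"
  shows "primitive g \<in> borel_measurable circ"
proof -
  have [measurable]: "g \<in> borel_measurable circ" using g by simp
  have [measurable]: "(\<lambda>x. x) \<in> borel_measurable circ" by (intro measurable_circ) simp
  have "(\<lambda>x. LINT s|circ. (if s \<le> x then g s else 0)) \<in> borel_measurable circ"
    by (rule circ.borel_measurable_lebesgue_integral) measurable
  then show ?thesis by (simp add: primitive_def[abs_def])
qed

lemma primitive_1: "primitive g 1 = (LINT s|circ. g s)"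
  unfolding primitive_def by (intro Bochner_Integration.integral_cong) auto

lemma integrable_mult_bounded:
  fixes f g :: "real \<Rightarrow> complex"
  assumes g: "integrable circ g" and f: "f \<in> borel_measurable circ" and B: "\<And>x. x \<in> {0..1} \<Longrightarrow> cmod (f x) \<le> B"
  shows "integrable circ (\<lambda>x. g x * f x)"
proof (rule Bochner_Integration.integrable_bound)
  show "integrable circ (\<lambda>x. of_real B * g x)" using g by simp
  show "(\<lambda>x. g x * f x) \<in> borel_measurable circ" using g f by simp
  have "cmod (g x) * cmod (f x) \<le> cmod (g x) * \<bar>B\<bar>" if "x \<in> {0..1}" for x
    using B[OF that] by (intro mult_left_mono) auto
  then show "AE x in circ. norm (g x * f x) \<le> norm (of_real B * g x)"
    by (intro AE_I2) (simp add: norm_mult mult.commute)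
qed

lemma primitive_scale: "primitive (\<lambda>s. c * g s) x = c * primitive g x"
proof -
  have "primitive (\<lambda>s. c * g s) x = (LINT s|circ. c * (if s \<le> x then g s else 0))"
    unfolding primitive_def by (intro Bochner_Integration.integral_cong) auto
  then show ?thesis by (simp add: primitive_def)
qed

text \<open>
  Both sides are the integral of \<open>g1 s * g2 t\<close> over the square \<open>s, t \<le> x\<close>. On the right it is
  split into the triangles \<open>t \<le> s\<close> and \<open>s < t\<close>, to which Fubini is applied in different orders;
  hence the use of the strict form of the primitive in one of them.
\<close>

lemma primitive_mult:
  assumes g1: "integrable circ g1" and g2: "integrable circ g2"
  shows "primitive g1 x * primitive g2 x =
    primitive (\<lambda>s. g1 s * primitive g2 s + primitive g1 s * g2 s) x"
proof -
  interpret P: pair_sigma_finite circ circ ..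
  have [measurable]: "g1 \<in> borel_measurable circ" "g2 \<in> borel_measurable circ" using g1 g2 by auto
  have [measurable]: "(\<lambda>x. x) \<in> borel_measurable circ" by (intro measurable_circ) simp
  define u where "u = (\<lambda>s. if s \<le> x then g1 s else 0)"
  define v where "v = (\<lambda>s. if s \<le> x then g2 s else 0)"
  have u: "integrable circ u" and v: "integrable circ v"
    unfolding u_def v_def using g1 g2 by (auto intro!: integrable_if)
  have [measurable]: "u \<in> borel_measurable circ" "v \<in> borel_measurable circ" using u v by auto
  have prod: "integrable (circ \<Otimes>\<^sub>M circ) (\<lambda>(s, t). u s * v t)"
  proof (rule P.Fubini_integrable)
    show "integrable circ (\<lambda>s. LINT t|circ. norm (case (s, t) of (s, t) \<Rightarrow> u s * v t))"
      using u by (simp add: norm_mult)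
    show "AE s in circ. integrable circ (\<lambda>t. case (s, t) of (s, t) \<Rightarrow> u s * v t)"
      using v by simp
  qed measurable
  have lower: "integrable (circ \<Otimes>\<^sub>M circ) (\<lambda>(s, t). if t \<le> s then u s * v t else 0)"
    by (rule Bochner_Integration.integrable_bound[OF prod]) (auto split: prod.split)
  have upper: "integrable (circ \<Otimes>\<^sub>M circ) (\<lambda>(s, t). if s < t then u s * v t else 0)"
    by (rule Bochner_Integration.integrable_bound[OF prod]) (auto split: prod.split)
  have pu: "primitive u s = primitive g1 s" and pv: "primitive v s = primitive g2 s" if "s \<le> x" for s
    unfolding primitive_def u_def v_def using that
    by (auto intro!: Bochner_Integration.integral_cong)
  have m1: "integrable circ (\<lambda>s. u s * primitive v s)"
    by (rule integrable_mult_bounded[OF u primitive_measurable[OF v] primitive_bound[OF v]])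
  have m2: "integrable circ (\<lambda>s. v s * primitive u s)"
    by (rule integrable_mult_bounded[OF v primitive_measurable[OF u] primitive_bound[OF u]])
  have "primitive g1 x * primitive g2 x = (LINT s|circ. u s) * (LINT t|circ. v t)"
    by (simp add: primitive_def u_def v_def)
  also have "\<dots> = (LINT s|circ. LINT t|circ. u s * v t)"
    by simp
  also have "\<dots> = (LINT z|(circ \<Otimes>\<^sub>M circ). (case z of (s, t) \<Rightarrow> u s * v t))"
    using P.integral_fst'[OF prod] by simp
  also have "\<dots> = (LINT z|(circ \<Otimes>\<^sub>M circ). (case z of (s, t) \<Rightarrow> if t \<le> s then u s * v t else 0) +
      (case z of (s, t) \<Rightarrow> if s < t then u s * v t else 0))"
    by (intro Bochner_Integration.integral_cong) auto
  also have "\<dots> = (LINT z|(circ \<Otimes>\<^sub>M circ). (case z of (s, t) \<Rightarrow> if t \<le> s then u s * v t else 0)) +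
      (LINT z|(circ \<Otimes>\<^sub>M circ). (case z of (s, t) \<Rightarrow> if s < t then u s * v t else 0))"
    by (rule Bochner_Integration.integral_add[OF lower upper])
  also have "(LINT z|(circ \<Otimes>\<^sub>M circ). (case z of (s, t) \<Rightarrow> if t \<le> s then u s * v t else 0)) =
      (LINT s|circ. LINT t|circ. (if t \<le> s then u s * v t else 0))"
    using P.integral_fst'[OF lower] by simp
  also have "\<dots> = (LINT s|circ. u s * primitive v s)"
    unfolding primitive_scale[symmetric] by (simp add: primitive_def)
  also have "(LINT z|(circ \<Otimes>\<^sub>M circ). (case z of (s, t) \<Rightarrow> if s < t then u s * v t else 0)) =
      (LINT t|circ. LINT s|circ. (if s < t then u s * v t else 0))"
    using P.integral_snd[of "\<lambda>s t. if s < t then u s * v t else 0"] upper by simp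
  also have "\<dots> = (LINT t|circ. v t * primitive u t)"
    unfolding primitive_scale[symmetric] by (subst primitive_strict) (simp_all add: mult.commute cong: if_cong)
  also have "(LINT s|circ. u s * primitive v s) + (LINT t|circ. v t * primitive u t) =
     (LINT s|circ. u s * primitive v s + v s * primitive u s)"
    using m1 m2 by simp
  also have "\<dots> = primitive (\<lambda>s. g1 s * primitive g2 s + primitive g1 s * g2 s) x"
    unfolding primitive_def[of "\<lambda>s. g1 s * primitive g2 s + primitive g1 s * g2 s"]
    by (intro Bochner_Integration.integral_cong) (auto simp: pu pv, simp_all add: u_def v_def)
  finally show ?thesis .
qed

lemma primitive_add:
  assumes "integrable circ f" "integrable circ g"
  shows "primitive (\<lambda>s. f s + g s) x = primitive f x + primitive g x"
proof -
  have [measurable]: "(\<lambda>x. x) \<in> borel_measurable circ" by (intro measurable_circ) simp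
  have "primitive (\<lambda>s. f s + g s) x = (LINT s|circ. (if s \<le> x then f s else 0) + (if s \<le> x then g s else 0))"
    unfolding primitive_def by (intro Bochner_Integration.integral_cong) auto
  also have "\<dots> = primitive f x + primitive g x"
    unfolding primitive_def by (intro Bochner_Integration.integral_add integrable_if assms) measurable
  finally show ?thesis .
qed

lemma primitive_cong_AE:
  assumes "f \<in> borel_measurable circ" "g \<in> borel_measurable circ" "AE x in circ. f x = g x"
  shows "primitive f x = primitive g x"
proof -
  note [measurable] = assms(1,2)
  have [measurable]: "(\<lambda>x. x) \<in> borel_measurable circ" by (intro measurable_circ) simp
  show ?thesis unfolding primitive_def
    using assms(3) by (intro integral_cong_AE) (measurable, auto)
qed

lemma primitive_product_rule:
  assumes g1: "integrable circ g1" and g2: "integrable circ g2"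
  shows "(a + primitive g1 x) * (b + primitive g2 x) =
    a * b + primitive (\<lambda>s. g1 s * (b + primitive g2 s) + (a + primitive g1 s) * g2 s) x"
proof -
  have i1: "integrable circ (\<lambda>s. g1 s * primitive g2 s)"
    by (rule integrable_mult_bounded[OF g1 primitive_measurable[OF g2] primitive_bound[OF g2]])
  have i2: "integrable circ (\<lambda>s. primitive g1 s * g2 s)"
    using integrable_mult_bounded[OF g2 primitive_measurable[OF g1] primitive_bound[OF g1]]
    by (simp add: mult.commute)
  have "primitive (\<lambda>s. g1 s * (b + primitive g2 s) + (a + primitive g1 s) * g2 s) x =
     primitive (\<lambda>s. (b * g1 s + a * g2 s) + (g1 s * primitive g2 s + primitive g1 s * g2 s)) x"
    by (simp add: algebra_simps)
  also have "\<dots> = b * primitive g1 x + a * primitive g2 x + primitive g1 x * primitive g2 x"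
    using g1 g2 i1 i2 by (simp add: primitive_add primitive_scale primitive_mult)
  finally show ?thesis by (simp add: algebra_simps)
qed

section \<open>Weak derivatives and primitives\<close>

lemma smooth_derivative:
  assumes "\<psi> \<in> smooth_circle"
  obtains \<psi>' where "\<psi>' \<in> smooth_circle" "\<And>x. (\<psi> has_vector_derivative \<psi>' x) (at x)"
    "(\<lambda>x. vector_derivative \<psi> (at x)) = \<psi>'"
proof -
  obtain D where D: "D 0 = \<psi>" "\<And>n x. (D n has_vector_derivative D (Suc n) x) (at x)"
    and per: "\<And>x. \<psi> (x + 1) = \<psi> x"
    using assms unfolding smooth_circle_def by blast
  have 1: "(\<psi> has_vector_derivative D 1 x) (at x)" for x using D(2)[of 0] D(1) by simp
  have "D 1 (x + 1) = D 1 x" for x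
  proof (rule vector_derivative_unique_at)
    show "(\<psi> has_vector_derivative D 1 x) (at x)" by (rule 1)
    have "(\<psi> \<circ> (\<lambda>x. x + 1) has_vector_derivative 1 *\<^sub>R D 1 (x + 1)) (at x)"
      by (rule vector_diff_chain_at) (auto intro!: derivative_eq_intros 1[unfolded One_nat_def])
    then show "(\<psi> has_vector_derivative D 1 (x + 1)) (at x)"
      using per by (simp add: o_def)
  qed
  then have "D 1 \<in> smooth_circle"
    unfolding smooth_circle_def using D(2) by (auto intro!: exI[of _ "\<lambda>n. D (Suc n)"])
  then show ?thesis using that[OF _ 1] vector_derivative_at[OF 1] by auto
qed

lemma smooth_continuous: "\<psi> \<in> smooth_circle \<Longrightarrow> continuous_on A \<psi>"
  by (rule smooth_derivative, assumption)
    (metis continuous_at_imp_continuous_on has_vector_derivative_continuous)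

lemma continuous_integrable:
  fixes \<psi> :: "real \<Rightarrow> complex"
  assumes "continuous_on {0..1} \<psi>"
  shows "integrable circ \<psi>"
  using borel_integrable_atLeastAtMost'[OF assms] by (simp add: set_integrable_iff_circ)

lemma smooth_integrable: "\<psi> \<in> smooth_circle \<Longrightarrow> integrable circ \<psi>"
  by (intro continuous_integrable smooth_continuous)

lemma smooth_L2:
  assumes "\<psi> \<in> smooth_circle"
  shows "\<psi> \<in> L2_circle"
  unfolding L2_circle_iff set_integrable_iff_circ[symmetric]
  using assms smooth_circle_measurable[OF assms]
  by (auto simp: smooth_circle_def intro!: borel_integrable_atLeastAtMost' continuous_intros smooth_continuous[OF assms])

lemma smooth_const: "(\<lambda>x. c) \<in> smooth_circle"
  by (rule smooth_circle_coinduct[of _ "range (\<lambda>c x. c)"]) (auto intro!: exI[of _ 0])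

lemma smooth_diff_const:
  assumes "\<eta> \<in> smooth_circle"
  shows "(\<lambda>x. \<eta> x - c) \<in> smooth_circle"
proof -
  obtain D where D: "D 0 = \<eta>" "\<And>n x. (D n has_vector_derivative D (Suc n) x) (at x)"
    and per: "\<And>x. \<eta> (x + 1) = \<eta> x"
    using assms unfolding smooth_circle_def by blast
  define D' where "D' n = (if n = 0 then (\<lambda>x. \<eta> x - c) else D n)" for n :: nat
  have "(D' n has_vector_derivative D' (Suc n) x) (at x)" for n x
    using D(2)[of n x] D(1) by (auto simp: D'_def has_vector_derivative_diff_const)
  then show ?thesis unfolding smooth_circle_def using per
    by (auto intro!: exI[of _ D'] simp: D'_def)
qed

lemma primitive_derivative:
  assumes "continuous_on {0..1} \<psi>'" "x \<in> {0..1}"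
    and "\<And>x. x \<in> {0..1} \<Longrightarrow> (\<psi> has_vector_derivative \<psi>' x) (at x within {0..1})"
  shows "primitive \<psi>' x = \<psi> x - \<psi> 0"
proof -
  have "primitive \<psi>' x = (LINT s|lborel. indicator {0..x} s *\<^sub>R \<psi>' s)"
    unfolding primitive_def using assms(2)
    by (subst integral_restrict_space) (auto intro!: Bochner_Integration.integral_cong split: split_indicator)
  also have "\<dots> = \<psi> x - \<psi> 0"
    using assms
    by (intro integral_FTC_Icc) (auto intro!: continuous_on_subset[OF assms(1)] has_vector_derivative_within_subset[OF assms(3)])
  finally show ?thesis .
qed

lemma has_weak_deriv_iff_circ:
  "has_weak_deriv f g \<longleftrightarrow> f \<in> L2_circle \<and> g \<in> L2_circle \<and>
     (\<forall>\<psi>\<in>smooth_circle. (LINT x|circ. f x * vector_derivative \<psi> (at x)) = - (LINT x|circ. g x * \<psi> x))"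
  by (simp add: has_weak_deriv_def circle_integral_eq)

text \<open>
  The mean is the only obstruction to a periodic antiderivative: the increment of an antiderivative
  over a period is constant and equal to the mean.
\<close>

lemma smooth_mean_zero_antiderivative:
  assumes \<eta>: "\<eta> \<in> smooth_circle" and mean: "(LINT x|circ. \<eta> x) = 0"
  obtains \<psi> where "\<psi> \<in> smooth_circle" "\<And>x. (\<psi> has_vector_derivative \<eta> x) (at x)"
proof -
  obtain D where D: "D 0 = \<eta>" "\<And>n x. (D n has_vector_derivative D (Suc n) x) (at x)"
    and per: "\<And>x. \<eta> (x + 1) = \<eta> x"
    using \<eta> unfolding smooth_circle_def by blast
  define \<psi> where "\<psi> x = (LBINT y=0..x. \<eta> y)" for x :: real
  have der: "(\<psi> has_vector_derivative \<eta> x) (at x)" for x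
  proof -
    have "(\<psi> has_vector_derivative \<eta> x) (at x within {- \<bar>x\<bar> - 1..\<bar>x\<bar> + 1})"
      unfolding \<psi>_def zero_ereal_def
      by (rule interval_integral_FTC2) (auto intro: smooth_continuous[OF \<eta>])
    moreover have "at x within {- \<bar>x\<bar> - 1..\<bar>x\<bar> + 1} = at x"
      by (rule at_within_interior) auto
    ultimately show ?thesis by simp
  qed
  have "\<psi> (x + 1) - \<psi> x = \<psi> (0 + 1) - \<psi> 0" for x
  proof -
    have "((\<lambda>x. \<psi> (x + 1) - \<psi> x) has_vector_derivative 0) (at x)" for x
    proof -
      have "(\<psi> \<circ> (\<lambda>x. x + 1) has_vector_derivative 1 *\<^sub>R \<eta> (x + 1)) (at x)"
        by (rule vector_diff_chain_at) (auto intro!: derivative_eq_intros der)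
      from has_vector_derivative_diff[OF this der] show ?thesis by (simp add: o_def per)
    qed
    then obtain c where "\<And>x. \<psi> (x + 1) - \<psi> x = c"
      using has_vector_derivative_zero_constant[of UNIV "\<lambda>x. \<psi> (x + 1) - \<psi> x"] by auto
    then have "\<psi> (x + 1) - \<psi> x = c" "\<psi> (0 + 1) - \<psi> 0 = c" by blast+
    then show ?thesis by (simp only:)
  qed
  moreover have "\<psi> 1 - \<psi> 0 = primitive \<eta> 1"
    by (rule primitive_derivative[symmetric]) (auto intro: smooth_continuous[OF \<eta>] has_vector_derivative_at_within der)
  ultimately have "\<psi> (x + 1) = \<psi> x" for x
    using mean by (simp add: primitive_1)
  moreover have "((case n of 0 \<Rightarrow> \<psi> | Suc n \<Rightarrow> D n) has_vector_derivative (case Suc n of 0 \<Rightarrow> \<psi> | Suc n \<Rightarrow> D n) x) (at x)" for n x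
    using der D by (cases n) auto
  ultimately have "\<psi> \<in> smooth_circle"
    unfolding smooth_circle_def by (auto intro!: exI[of _ "\<lambda>n. case n of 0 \<Rightarrow> \<psi> | Suc n \<Rightarrow> D n"])
  with der show ?thesis using that by blast
qed

text \<open>
  The bridge between the definition by test functions and pointwise calculus. A constant plus a
  primitive satisfies the product rule with smooth functions, which gives one direction. Conversely
  let \<open>H\<close> be \<open>f\<close> minus the primitive of \<open>g\<close>. Then \<open>H\<close> is orthogonal to all derivatives of
  smooth functions, that is, to all smooth functions of mean zero, and so it is constant by the
  fundamental lemma. The mean of \<open>g\<close> vanishes because the constant 1 is a test function.
\<close>

lemma has_weak_deriv_iff:
  "has_weak_deriv f g \<longleftrightarrow> f \<in> L2_circle \<and> g \<in> L2_circle \<and> (LINT x|circ. g x) = 0 \<and>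
     (\<exists>c. AE x in circ. f x = c + primitive g x)"
proof (intro iffI)
  assume "f \<in> L2_circle \<and> g \<in> L2_circle \<and> (LINT x|circ. g x) = 0 \<and>
     (\<exists>c. AE x in circ. f x = c + primitive g x)"
  then obtain c where f: "f \<in> L2_circle" and g: "g \<in> L2_circle" and mean: "(LINT x|circ. g x) = 0"
    and c: "AE x in circ. f x = c + primitive g x" by blast
  note ig = L2_integrable[OF g]
  have "(LINT x|circ. f x * vector_derivative \<psi> (at x)) = - (LINT x|circ. g x * \<psi> x)"
    if \<psi>: "\<psi> \<in> smooth_circle" for \<psi>
  proof -
    obtain \<psi>' where \<psi>': "\<psi>' \<in> smooth_circle" and der: "\<And>x. (\<psi> has_vector_derivative \<psi>' x) (at x)"
      and eq: "(\<lambda>x. vector_derivative \<psi> (at x)) = \<psi>'"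
      using smooth_derivative[OF \<psi>] by blast
    note [measurable] = measurable_circ[OF L2_measurable[OF f]] measurable_circ[OF L2_measurable[OF g]]
      measurable_circ[OF smooth_circle_measurable[OF \<psi>]] measurable_circ[OF smooth_circle_measurable[OF \<psi>']]
      primitive_measurable[OF ig] primitive_measurable[OF smooth_integrable[OF \<psi>']]
    have p: "\<psi> x = \<psi> 0 + primitive \<psi>' x" if "x \<in> {0..1}" for x
      using primitive_derivative[of \<psi>' x \<psi>] that
      by (simp add: smooth_continuous[OF \<psi>'] has_vector_derivative_at_within der)
    have "\<psi> 1 = \<psi> (0 + 1)" by simp
    also have "\<dots> = \<psi> 0" using \<psi> unfolding smooth_circle_def by blast
    finally have per: "\<psi> 1 = \<psi> 0" .
    have "c * \<psi> 0 = (c + primitive g 1) * (\<psi> 0 + primitive \<psi>' 1)"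
      using p[of 1] per by (simp add: mean primitive_1)
    also have "\<dots> = c * \<psi> 0 + (LINT s|circ. g s * (\<psi> 0 + primitive \<psi>' s) + (c + primitive g s) * \<psi>' s)"
      unfolding primitive_product_rule[OF ig smooth_integrable[OF \<psi>']]
      by (simp only: primitive_1)
    also have "(LINT s|circ. g s * (\<psi> 0 + primitive \<psi>' s) + (c + primitive g s) * \<psi>' s) =
        (LINT s|circ. g s * \<psi> s + f s * \<psi>' s)"
    proof (rule integral_cong_AE)
      from c AE_space show "AE s in circ. g s * (\<psi> 0 + primitive \<psi>' s) + (c + primitive g s) * \<psi>' s =
          g s * \<psi> s + f s * \<psi>' s"
      proof eventually_elim
        case (elim s)
        then show ?case using p[of s] by simp
      qed
    qed measurable
    also have "\<dots> = (LINT s|circ. g s * \<psi> s) + (LINT s|circ. f s * \<psi>' s)"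
      by (intro Bochner_Integration.integral_add L2_integrable_mult f g smooth_L2[OF \<psi>] smooth_L2[OF \<psi>'])
    finally show ?thesis by (simp add: fun_cong[OF eq] eq_neg_iff_add_eq_0 add.commute)
  qed
  with f g show "has_weak_deriv f g" by (simp add: has_weak_deriv_iff_circ)
next
  assume "has_weak_deriv f g"
  then have f: "f \<in> L2_circle" and g: "g \<in> L2_circle"
    and weak: "\<And>\<psi>. \<psi> \<in> smooth_circle \<Longrightarrow>
      (LINT x|circ. f x * vector_derivative \<psi> (at x)) = - (LINT x|circ. g x * \<psi> x)"
    by (auto simp: has_weak_deriv_iff_circ)
  note ig = L2_integrable[OF g]
  have mean: "(LINT x|circ. g x) = 0"
    using weak[OF smooth_const[of 1]] by simp
  define H where "H x = f x - primitive g x" for x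
  have ip: "integrable circ (primitive g)"
    using integrable_mult_bounded[OF _ primitive_measurable[OF ig] primitive_bound[OF ig], of "\<lambda>x. 1"] by simp
  have iH: "integrable circ H"
    unfolding H_def using L2_integrable[OF f] ip by simp
  define c where "c = (LINT x|circ. H x)"
  have "AE x in circ. H x - c = 0"
  proof (rule fundamental_lemma)
    show "integrable circ (\<lambda>x. H x - c)" using iH by simp
    fix \<eta> assume \<eta>: "\<eta> \<in> smooth_circle"
    define m where "m = (LINT x|circ. \<eta> x)"
    note i\<eta> = smooth_integrable[OF \<eta>]
    \<comment> \<open>A general test function is reduced to one of mean zero, which is a derivative.\<close>
    have sm: "(\<lambda>x. \<eta> x - m) \<in> smooth_circle" by (rule smooth_diff_const[OF \<eta>])
    obtain \<psi> where \<psi>: "\<psi> \<in> smooth_circle" and der: "\<And>x. (\<psi> has_vector_derivative \<eta> x - m) (at x)"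
      using smooth_mean_zero_antiderivative[OF sm] i\<eta> by (auto simp: m_def)
    have eq: "(\<lambda>x. vector_derivative \<psi> (at x)) = (\<lambda>x. \<eta> x - m)"
      using vector_derivative_at[OF der] by blast
    note smi = smooth_integrable[OF sm]
    have p: "\<psi> x = \<psi> 0 + primitive (\<lambda>x. \<eta> x - m) x" if "x \<in> {0..1}" for x
      using primitive_derivative[of "\<lambda>x. \<eta> x - m" x \<psi>] that
      by (simp add: smooth_continuous[OF sm] has_vector_derivative_at_within der)
    have ifs: "integrable circ (\<lambda>x. f x * (\<eta> x - m))"
      by (rule L2_integrable_mult[OF f smooth_L2[OF sm]])
    have ips: "integrable circ (\<lambda>x. primitive g x * (\<eta> x - m))"
      using integrable_mult_bounded[OF smi primitive_measurable[OF ig] primitive_bound[OF ig]]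
      by (simp add: mult.commute)
    have igs: "integrable circ (\<lambda>x. g x * \<psi> x)"
      by (rule L2_integrable_mult[OF g smooth_L2[OF \<psi>]])
    have "primitive g 1 * (\<psi> 0 + primitive (\<lambda>x. \<eta> x - m) 1) =
      (LINT s|circ. g s * (\<psi> 0 + primitive (\<lambda>x. \<eta> x - m) s) + primitive g s * (\<eta> s - m))"
      using primitive_product_rule[OF ig smi, of 0 1 "\<psi> 0"] by (simp add: primitive_1)
    also have "\<dots> = (LINT s|circ. g s * \<psi> s + primitive g s * (\<eta> s - m))"
      by (intro Bochner_Integration.integral_cong) (auto simp: p[symmetric])
    finally have "(LINT s|circ. primitive g s * (\<eta> s - m)) = - (LINT s|circ. g s * \<psi> s)"
      using mean igs ips by (simp add: primitive_1 eq_neg_iff_add_eq_0 add.commute)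
    then have zero: "(LINT s|circ. H s * (\<eta> s - m)) = 0"
      using weak[OF \<psi>] ifs ips by (simp add: fun_cong[OF eq] H_def left_diff_distrib)
    have iHs: "integrable circ (\<lambda>s. H s * (\<eta> s - m))"
      using ifs ips by (simp add: H_def left_diff_distrib)
    have "(LINT s|circ. (H s - c) * \<eta> s) = (LINT s|circ. H s * (\<eta> s - m) + (m * H s - c * \<eta> s))"
      by (simp add: algebra_simps)
    also have "\<dots> = 0"
      using iHs iH i\<eta> zero by (simp add: m_def c_def)
    finally show "(LINT s|circ. (H s - c) * \<eta> s) = 0" .
  qed
  then have "AE x in circ. f x = c + primitive g x"
    by eventually_elim (simp add: H_def algebra_simps)
  with f g mean show "f \<in> L2_circle \<and> g \<in> L2_circle \<and> (LINT x|circ. g x) = 0 \<and>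
     (\<exists>c. AE x in circ. f x = c + primitive g x)" by blast
qed

abbreviation ae_eq :: "(real \<Rightarrow> complex) \<Rightarrow> (real \<Rightarrow> complex) \<Rightarrow> bool" (infix "\<doteq>" 50) where
  "f \<doteq> g \<equiv> AE x in lborel. f x = g x"

lemma ae_sym: "f \<doteq> g \<Longrightarrow> g \<doteq> f"
  by (erule eventually_mono) simp

section \<open>Calculus of weak derivatives\<close>

lemma has_weak_deriv_L2: "has_weak_deriv f g \<Longrightarrow> f \<in> L2_circle" "has_weak_deriv f g \<Longrightarrow> g \<in> L2_circle"
  by (auto simp: has_weak_deriv_def)

lemma has_weak_deriv_unique:
  assumes "has_weak_deriv f g" "has_weak_deriv f h"
  shows "g \<doteq> h"
proof (rule L2_AE)
  show g: "g \<in> L2_circle" and h: "h \<in> L2_circle" using assms by (auto dest: has_weak_deriv_L2)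
  have "AE x in circ. g x - h x = 0"
  proof (rule fundamental_lemma)
    show "integrable circ (\<lambda>x. g x - h x)" using g h by (simp add: L2_integrable)
    fix \<psi> assume \<psi>: "\<psi> \<in> smooth_circle"
    have "(LINT x|circ. g x * \<psi> x) = (LINT x|circ. h x * \<psi> x)"
      using assms \<psi> by (auto simp: has_weak_deriv_iff_circ)
    then show "(LINT x|circ. (g x - h x) * \<psi> x) = 0"
      using L2_integrable_mult[OF g smooth_L2[OF \<psi>]] L2_integrable_mult[OF h smooth_L2[OF \<psi>]]
      by (simp add: left_diff_distrib)
  qed
  then show "AE x in circ. g x = h x" by eventually_elim simp
qed

lemma has_weak_deriv_cong_left:
  assumes fg: "has_weak_deriv f g" and f': "f' \<in> L2_circle" "f \<doteq> f'"
  shows "has_weak_deriv f' g"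
proof -
  from fg obtain c where "f \<in> L2_circle" "g \<in> L2_circle" "(LINT x|circ. g x) = 0"
    and c: "AE x in circ. f x = c + primitive g x" by (auto simp: has_weak_deriv_iff)
  moreover have "AE x in circ. f' x = c + primitive g x"
    using c AE_circ_I[OF f'(2)] by eventually_elim simp
  ultimately show ?thesis using f' by (auto simp: has_weak_deriv_iff)
qed

text \<open>
  The choice in \<open>weak_deriv\<close> depends only on the class of the function, so this is an equality of
  functions and not only almost everywhere.
\<close>

lemma weak_deriv_cong:
  assumes "f \<in> L2_circle" "f' \<in> L2_circle" "f \<doteq> f'"
  shows "weak_deriv f = weak_deriv f'"
proof -
  have "has_weak_deriv f = has_weak_deriv f'"
    using has_weak_deriv_cong_left[OF _ assms(2,3)] has_weak_deriv_cong_left[OF _ assms(1) ae_sym[OF assms(3)]]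
    by blast
  then show ?thesis by (simp add: weak_deriv_def)
qed

lemma weak_deriv_eq: "has_weak_deriv f g \<Longrightarrow> weak_deriv f \<doteq> g"
  unfolding weak_deriv_def by (rule has_weak_deriv_unique[OF someI[of "has_weak_deriv f"]])

lemma has_weak_deriv_add:
  assumes "has_weak_deriv f f'" "has_weak_deriv g g'"
  shows "has_weak_deriv (\<lambda>x. f x + g x) (\<lambda>x. f' x + g' x)"
proof -
  from assms(1) obtain a where f: "f \<in> L2_circle" "f' \<in> L2_circle" "(LINT x|circ. f' x) = 0"
    and a: "AE x in circ. f x = a + primitive f' x" by (auto simp: has_weak_deriv_iff)
  from assms(2) obtain b where g: "g \<in> L2_circle" "g' \<in> L2_circle" "(LINT x|circ. g' x) = 0"
    and b: "AE x in circ. g x = b + primitive g' x" by (auto simp: has_weak_deriv_iff)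
  have "AE x in circ. f x + g x = (a + b) + primitive (\<lambda>x. f' x + g' x) x"
    using a b by eventually_elim (simp add: primitive_add L2_integrable f g)
  then show ?thesis using f g by (auto simp: has_weak_deriv_iff L2_add L2_integrable)
qed

lemma has_weak_deriv_scale:
  assumes "has_weak_deriv f f'"
  shows "has_weak_deriv (\<lambda>x. c * f x) (\<lambda>x. c * f' x)"
proof -
  from assms(1) obtain a where f: "f \<in> L2_circle" "f' \<in> L2_circle" "(LINT x|circ. f' x) = 0"
    and a: "AE x in circ. f x = a + primitive f' x" by (auto simp: has_weak_deriv_iff)
  have "AE x in circ. c * f x = c * a + primitive (\<lambda>x. c * f' x) x"
    using a by eventually_elim (simp add: primitive_scale algebra_simps)
  then show ?thesis using f by (auto simp: has_weak_deriv_iff L2_scale L2_integrable)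
qed

lemma primitive_diff_bound:
  assumes g: "integrable circ g"
  shows "cmod (primitive g x - primitive g y) \<le> (LINT s|circ. cmod (g s))"
proof -
  have [measurable]: "(\<lambda>x. x) \<in> borel_measurable circ" by (intro measurable_circ) simp
  have i: "integrable circ (\<lambda>s. if s \<le> x then g s else 0)" for x
    by (intro integrable_if g) measurable
  have "primitive g x - primitive g y =
      (LINT s|circ. (if s \<le> x then g s else 0) - (if s \<le> y then g s else 0))"
    unfolding primitive_def using i by simp
  also have "cmod \<dots> \<le> (LINT s|circ. cmod ((if s \<le> x then g s else 0) - (if s \<le> y then g s else 0)))"
    by (rule integral_norm_bound)
  also have "\<dots> \<le> (LINT s|circ. cmod (g s))"
    using i g by (intro integral_mono integrable_norm Bochner_Integration.integrable_diff) auto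
  finally show ?thesis .
qed

text \<open>
  Up to null sets \<open>f(x)\<close> differs from \<open>f(y)\<close> by at most the \<open>L\<^sup>1\<close> norm of the derivative.
  Average over \<open>y\<close> and use that the circle has measure 1.
\<close>

lemma weak_deriv_sup_bound:
  assumes "has_weak_deriv f g"
  shows "AE x in circ. cmod (f x) \<le> L2_norm f + L2_norm g"
proof -
  from assms obtain c where f: "f \<in> L2_circle" "g \<in> L2_circle"
    and c: "AE x in circ. f x = c + primitive g x" by (auto simp: has_weak_deriv_iff)
  note ig = L2_integrable[OF f(2)] and if' = L2_integrable[OF f(1)]
  show ?thesis
    using c
  proof eventually_elim
    case (elim x)
    have "cmod (f x) = (LINT y|circ. cmod (f x))"
      by simp
    also have "\<dots> \<le> (LINT y|circ. cmod (f y) + (LINT s|circ. cmod (g s)))"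
    proof (rule integral_mono_AE)
      show "AE y in circ. cmod (f x) \<le> cmod (f y) + (LINT s|circ. cmod (g s))"
        using c
      proof eventually_elim
        case (elim y)
        have "f x = f y + (primitive g x - primitive g y)"
          using elim \<open>f x = c + primitive g x\<close> by simp
        then have "cmod (f x) \<le> cmod (f y) + cmod (primitive g x - primitive g y)"
          by (metis norm_triangle_ineq)
        with primitive_diff_bound[OF ig, of x y] show ?case by simp
      qed
    qed (use if' in auto)
    also have "\<dots> = (LINT y|circ. cmod (f y)) + (LINT s|circ. cmod (g s))"
      using if' by simp
    also have "\<dots> \<le> L2_norm f + L2_norm g"
      using f by (intro add_mono L1_le_L2_norm)
    finally show ?case .
  qed
qed

lemma L2_mult_bounded:
  assumes f: "f \<in> L2_circle" and B: "AE x in circ. cmod (f x) \<le> B" and g: "g \<in> L2_circle"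
  shows "(\<lambda>x. f x * g x) \<in> L2_circle" "L2_norm (\<lambda>x. f x * g x) \<le> \<bar>B\<bar> * L2_norm g"
proof -
  have meas: "(\<lambda>x. f x * g x) \<in> borel_measurable borel"
    using L2_measurable[OF f] L2_measurable[OF g] by (rule borel_measurable_times)
  have bnd: "AE x in circ. (cmod (f x * g x))\<^sup>2 \<le> B\<^sup>2 * (cmod (g x))\<^sup>2"
    using B
  proof eventually_elim
    case (elim x)
    then have "(cmod (f x))\<^sup>2 \<le> B\<^sup>2" by (intro power_mono) auto
    then show ?case by (simp add: norm_mult power_mult_distrib mult_right_mono)
  qed
  have int: "integrable circ (\<lambda>x. (cmod (f x * g x))\<^sup>2)"
  proof (rule Bochner_Integration.integrable_bound)
    show "integrable circ (\<lambda>x. B\<^sup>2 * (cmod (g x))\<^sup>2)" using g by (simp add: L2_square_integrable)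
    show "(\<lambda>x. (cmod (f x * g x))\<^sup>2) \<in> borel_measurable circ"
      using measurable_circ[OF meas] by simp
    show "AE x in circ. norm ((cmod (f x * g x))\<^sup>2) \<le> norm (B\<^sup>2 * (cmod (g x))\<^sup>2)"
      using bnd by eventually_elim simp
  qed
  then show "(\<lambda>x. f x * g x) \<in> L2_circle"
    using meas f g by (simp add: L2_circle_iff)
  have "(L2_norm (\<lambda>x. f x * g x))\<^sup>2 \<le> (LINT x|circ. B\<^sup>2 * (cmod (g x))\<^sup>2)"
    unfolding L2_norm_square using int bnd g by (intro integral_mono_AE) (auto simp: L2_square_integrable)
  also have "\<dots> = (\<bar>B\<bar> * L2_norm g)\<^sup>2"
    by (simp add: L2_norm_square power_mult_distrib)
  finally show "L2_norm (\<lambda>x. f x * g x) \<le> \<bar>B\<bar> * L2_norm g"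
    by (rule power2_le_imp_le) simp
qed

text \<open>
  The Leibniz rule, from the product rule for primitives. The mean of the derivative vanishes because
  the product of the primitives returns to its initial value after a period.
\<close>

lemma has_weak_deriv_mult:
  assumes "has_weak_deriv f f'" "has_weak_deriv g g'"
  shows "has_weak_deriv (\<lambda>x. f x * g x) (\<lambda>x. f' x * g x + f x * g' x)"
proof -
  from assms(1) obtain a where f: "f \<in> L2_circle" "f' \<in> L2_circle" "(LINT x|circ. f' x) = 0"
    and a: "AE x in circ. f x = a + primitive f' x" by (auto simp: has_weak_deriv_iff)
  from assms(2) obtain b where g: "g \<in> L2_circle" "g' \<in> L2_circle" "(LINT x|circ. g' x) = 0"
    and b: "AE x in circ. g x = b + primitive g' x" by (auto simp: has_weak_deriv_iff)
  note if' = L2_integrable[OF f(2)] and ig' = L2_integrable[OF g(2)]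
  have fg: "(\<lambda>x. f x * g x) \<in> L2_circle" "(\<lambda>x. f x * g' x) \<in> L2_circle"
    using L2_mult_bounded(1)[OF f(1) weak_deriv_sup_bound[OF assms(1)]] g by auto
  have f'g: "(\<lambda>x. f' x * g x) \<in> L2_circle"
    using L2_mult_bounded(1)[OF g(1) weak_deriv_sup_bound[OF assms(2)] f(2)] by (simp add: mult.commute)
  let ?h = "\<lambda>x. f' x * g x + f x * g' x"
  have h: "?h \<in> L2_circle" by (rule L2_add[OF f'g fg(2)])
  have m: "?h \<in> borel_measurable circ" by (intro measurable_circ L2_measurable h)
  have m2: "(\<lambda>s. f' s * (b + primitive g' s) + (a + primitive f' s) * g' s) \<in> borel_measurable circ"
    using primitive_measurable[OF ig'] primitive_measurable[OF if']
      measurable_circ[OF L2_measurable[OF f(2)]] measurable_circ[OF L2_measurable[OF g(2)]] by simp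
  have ae: "AE s in circ. ?h s = f' s * (b + primitive g' s) + (a + primitive f' s) * g' s"
    using a b by eventually_elim simp
  have prod: "(a + primitive f' x) * (b + primitive g' x) = a * b + primitive ?h x" for x
    unfolding primitive_product_rule[OF if' ig'] using primitive_cong_AE[OF m m2 ae] by simp
  have "AE x in circ. f x * g x = a * b + primitive ?h x"
    using a b by eventually_elim (simp add: prod)
  moreover have "(LINT x|circ. ?h x) = 0"
    using prod[of 1] f g by (simp add: primitive_1)
  ultimately show ?thesis using fg h by (auto simp: has_weak_deriv_iff)
qed

section \<open>Sobolev spaces\<close>

lemma sobolev_L2: "f \<in> sobolev m \<Longrightarrow> f \<in> L2_circle"
  by (cases m) (auto dest: has_weak_deriv_L2)

lemma sobolev_cong: "f \<in> sobolev m \<Longrightarrow> g \<in> L2_circle \<Longrightarrow> f \<doteq> g \<Longrightarrow> g \<in> sobolev m"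
  by (cases m) (auto dest: has_weak_deriv_cong_left[where f' = g])

lemma sobolev_Suc_weak_deriv:
  assumes "f \<in> sobolev (Suc m)"
  shows "has_weak_deriv f (weak_deriv f)" "weak_deriv f \<in> sobolev m"
proof -
  from assms obtain g where g: "g \<in> sobolev m" "has_weak_deriv f g" by auto
  show *: "has_weak_deriv f (weak_deriv f)" unfolding weak_deriv_def by (rule someI[of "has_weak_deriv f", OF g(2)])
  show "weak_deriv f \<in> sobolev m"
    using sobolev_cong[OF g(1) has_weak_deriv_L2(2)[OF *] has_weak_deriv_unique[OF g(2) *]] .
qed

lemma sobolev_SucI: "has_weak_deriv f g \<Longrightarrow> g \<in> sobolev m \<Longrightarrow> f \<in> sobolev (Suc m)"
  by auto

lemma sobolev_Suc_subset: "f \<in> sobolev (Suc m) \<Longrightarrow> f \<in> sobolev m"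
proof (induction m arbitrary: f)
  case 0 then show ?case by (auto dest: has_weak_deriv_L2)
next
  case (Suc m)
  show ?case
    by (rule sobolev_SucI[OF sobolev_Suc_weak_deriv(1)[OF Suc.prems] Suc.IH[OF sobolev_Suc_weak_deriv(2)[OF Suc.prems]]])
qed

lemma sobolev_mono: "m \<le> n \<Longrightarrow> f \<in> sobolev n \<Longrightarrow> f \<in> sobolev m"
  by (induction rule: inc_induct) (assumption, rule sobolev_Suc_subset)

lemma smooth_has_weak_deriv:
  assumes f: "f \<in> smooth_circle" and f': "f' \<in> smooth_circle" and der: "\<And>x. (f has_vector_derivative f' x) (at x)"
  shows "has_weak_deriv f f'"
proof -
  have p: "f x = f 0 + primitive f' x" if "x \<in> {0..1}" for x
    using primitive_derivative[of f' x f] that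
    by (simp add: smooth_continuous[OF f'] has_vector_derivative_at_within der)
  have "f (0 + 1) = f 0" using f unfolding smooth_circle_def by blast
  then have "(LINT x|circ. f' x) = 0" using p[of 1] by (simp add: primitive_1)
  moreover have "AE x in circ. f x = f 0 + primitive f' x"
    by (rule AE_I2, rule p) simp
  ultimately show ?thesis using smooth_L2 f f' by (auto simp: has_weak_deriv_iff)
qed

lemma smooth_sobolev: "f \<in> smooth_circle \<Longrightarrow> f \<in> sobolev m"
proof (induction m arbitrary: f)
  case 0 then show ?case by (simp add: smooth_L2)
next
  case (Suc m)
  obtain f' where f': "f' \<in> smooth_circle" "\<And>x. (f has_vector_derivative f' x) (at x)"
    using smooth_derivative[OF Suc.prems] by blast
  show ?case by (rule sobolev_SucI[OF smooth_has_weak_deriv[OF Suc.prems f'] Suc.IH[OF f'(1)]])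
qed

lemma sobolev_zero: "(\<lambda>x. 0) \<in> sobolev m"
  by (intro smooth_sobolev smooth_const)

lemma sobolev_add: "f \<in> sobolev m \<Longrightarrow> g \<in> sobolev m \<Longrightarrow> (\<lambda>x. f x + g x) \<in> sobolev m"
proof (induction m arbitrary: f g)
  case 0 then show ?case by (simp add: L2_add)
next
  case (Suc m)
  note f = sobolev_Suc_weak_deriv[OF Suc.prems(1)] and g = sobolev_Suc_weak_deriv[OF Suc.prems(2)]
  show ?case
    by (rule sobolev_SucI[OF has_weak_deriv_add[OF f(1) g(1)] Suc.IH[OF f(2) g(2)]])
qed

lemma sobolev_scale: "f \<in> sobolev m \<Longrightarrow> (\<lambda>x. c * f x) \<in> sobolev m"
proof (induction m arbitrary: f)
  case 0 then show ?case by (simp add: L2_scale)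
next
  case (Suc m)
  note f = sobolev_Suc_weak_deriv[OF Suc.prems]
  show ?case
    by (rule sobolev_SucI[OF has_weak_deriv_scale[OF f(1)] Suc.IH[OF f(2)]])
qed

text \<open>
  This is equivalent to the Hilbert norm of the Sobolev space and fits inductions on the order.
\<close>

primrec snorm :: "nat \<Rightarrow> (real \<Rightarrow> complex) \<Rightarrow> real" where
  "snorm 0 f = L2_norm f"
| "snorm (Suc m) f = L2_norm f + snorm m (weak_deriv f)"

lemma snorm_nonneg [simp]: "0 \<le> snorm m f"
  by (induction m arbitrary: f) auto

lemma snorm_mono_Suc: "snorm m f \<le> snorm (Suc m) f"
proof (induction m arbitrary: f)
  case (Suc m)
  have "snorm (Suc m) f = L2_norm f + snorm m (weak_deriv f)" by simp
  also have "\<dots> \<le> L2_norm f + snorm (Suc m) (weak_deriv f)" by (rule add_left_mono[OF Suc.IH])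
  finally show ?case by simp
qed simp

lemma snorm_mono: "m \<le> n \<Longrightarrow> snorm m f \<le> snorm n f"
  using lift_Suc_mono_le[of "\<lambda>m. snorm m f" m n] snorm_mono_Suc by blast

lemma L2_norm_cong: "f \<in> L2_circle \<Longrightarrow> g \<in> L2_circle \<Longrightarrow> f \<doteq> g \<Longrightarrow> L2_norm f = L2_norm g"
  by (intro L2_norm_cong_AE L2_measurable AE_circ_I)

lemma snorm_cong:
  assumes "f \<in> L2_circle" "g \<in> L2_circle" "f \<doteq> g"
  shows "snorm m f = snorm m g"
  by (cases m) (simp_all add: L2_norm_cong[OF assms] weak_deriv_cong[OF assms])

lemma snorm_add: "f \<in> sobolev m \<Longrightarrow> g \<in> sobolev m \<Longrightarrow> snorm m (\<lambda>x. f x + g x) \<le> snorm m f + snorm m g"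
proof (induction m arbitrary: f g)
  case 0 then show ?case by (simp add: L2_norm_triangle)
next
  case (Suc m)
  note f = sobolev_Suc_weak_deriv[OF Suc.prems(1)] and g = sobolev_Suc_weak_deriv[OF Suc.prems(2)]
  have fg: "has_weak_deriv (\<lambda>x. f x + g x) (\<lambda>x. weak_deriv f x + weak_deriv g x)"
    by (rule has_weak_deriv_add[OF f(1) g(1)])
  have "snorm m (weak_deriv (\<lambda>x. f x + g x)) = snorm m (\<lambda>x. weak_deriv f x + weak_deriv g x)"
    by (rule snorm_cong[OF has_weak_deriv_L2(2)[OF sobolev_Suc_weak_deriv(1)[OF sobolev_add[OF Suc.prems]]]
          has_weak_deriv_L2(2)[OF fg] weak_deriv_eq[OF fg]])
  also have "\<dots> \<le> snorm m (weak_deriv f) + snorm m (weak_deriv g)"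
    by (rule Suc.IH[OF f(2) g(2)])
  finally show ?case
    using L2_norm_triangle[OF has_weak_deriv_L2(1)[OF f(1)] has_weak_deriv_L2(1)[OF g(1)]] by simp
qed

lemma snorm_scale: "f \<in> sobolev m \<Longrightarrow> snorm m (\<lambda>x. c * f x) = cmod c * snorm m f"
proof (induction m arbitrary: f)
  case 0 then show ?case by (simp add: L2_norm_scale)
next
  case (Suc m)
  note f = sobolev_Suc_weak_deriv[OF Suc.prems]
  note cf = has_weak_deriv_scale[OF f(1), of c]
  have "snorm m (weak_deriv (\<lambda>x. c * f x)) = snorm m (\<lambda>x. c * weak_deriv f x)"
    by (rule snorm_cong[OF has_weak_deriv_L2(2)[OF sobolev_Suc_weak_deriv(1)[OF sobolev_scale[OF Suc.prems]]]
          has_weak_deriv_L2(2)[OF cf] weak_deriv_eq[OF cf]])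
  then show ?case using Suc.IH[OF f(2)] by (simp add: L2_norm_scale algebra_simps)
qed

text \<open>
  One factor is allowed one derivative more than the product. This asymmetric form survives the
  induction, since in \<open>f' g + f g'\<close> each summand is again of this kind, and it starts at order 0 with
  the supremum bound.
\<close>

lemma sobolev_mult:
  assumes "f \<in> sobolev (Suc m)" "g \<in> sobolev m"
  shows "(\<lambda>x. f x * g x) \<in> sobolev m \<and> snorm m (\<lambda>x. f x * g x) \<le> 3 ^ m * (snorm (Suc m) f * snorm m g)"
  using assms
proof (induction m arbitrary: f g)
  case 0
  note f = sobolev_Suc_weak_deriv[OF 0(1)]
  show ?case
    using L2_mult_bounded[OF has_weak_deriv_L2(1)[OF f(1)] weak_deriv_sup_bound[OF f(1)], of g] 0(2)
    by simp
next
  case (Suc m)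
  note f = sobolev_Suc_weak_deriv[OF Suc.prems(1)] and g = sobolev_Suc_weak_deriv[OF Suc.prems(2)]
  note fg = has_weak_deriv_mult[OF f(1) g(1)]
  let ?u = "\<lambda>x. weak_deriv f x * g x" and ?v = "\<lambda>x. f x * weak_deriv g x"
  have u: "?u \<in> sobolev m" "snorm m ?u \<le> 3 ^ m * (snorm (Suc m) (weak_deriv f) * snorm m g)"
    using Suc.IH[OF f(2) sobolev_Suc_subset[OF Suc.prems(2)]] by auto
  have v: "?v \<in> sobolev m" "snorm m ?v \<le> 3 ^ m * (snorm (Suc m) f * snorm m (weak_deriv g))"
    using Suc.IH[OF sobolev_Suc_subset[OF Suc.prems(1)] g(2)] by auto
  have mem: "(\<lambda>x. f x * g x) \<in> sobolev (Suc m)"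
    by (rule sobolev_SucI[OF fg sobolev_add[OF u(1) v(1)]])
  have "L2_norm (\<lambda>x. f x * g x) \<le> (L2_norm f + L2_norm (weak_deriv f)) * L2_norm g"
    using L2_mult_bounded(2)[OF has_weak_deriv_L2(1)[OF f(1)] weak_deriv_sup_bound[OF f(1)] has_weak_deriv_L2(1)[OF g(1)]]
    by simp
  also have "\<dots> \<le> snorm (Suc (Suc m)) f * snorm (Suc m) g"
    using snorm_mono[of 0 "Suc m" "weak_deriv f"] by (intro mult_mono) auto
  finally have 1: "L2_norm (\<lambda>x. f x * g x) \<le> snorm (Suc (Suc m)) f * snorm (Suc m) g" .
  have 2: "snorm m ?u \<le> 3 ^ m * (snorm (Suc (Suc m)) f * snorm (Suc m) g)"
    using u(2) by (rule order_trans) (intro mult_left_mono mult_mono snorm_mono_Suc, auto)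
  have 3: "snorm m ?v \<le> 3 ^ m * (snorm (Suc (Suc m)) f * snorm (Suc m) g)"
    using v(2) by (rule order_trans) (intro mult_left_mono mult_mono snorm_mono_Suc, auto)
  have "snorm (Suc m) (\<lambda>x. f x * g x) = L2_norm (\<lambda>x. f x * g x) + snorm m (\<lambda>x. ?u x + ?v x)"
    using snorm_cong[OF _ has_weak_deriv_L2(2)[OF fg] weak_deriv_eq[OF fg], of m]
      has_weak_deriv_L2(2)[OF sobolev_Suc_weak_deriv(1)[OF mem]] by simp
  also have "\<dots> \<le> L2_norm (\<lambda>x. f x * g x) + (snorm m ?u + snorm m ?v)"
    by (intro add_left_mono snorm_add u v)
  also have "\<dots> \<le> (1 + 2 * 3 ^ m) * (snorm (Suc (Suc m)) f * snorm (Suc m) g)"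
    using 1 2 3 by (simp add: algebra_simps)
  also have "\<dots> \<le> 3 ^ Suc m * (snorm (Suc (Suc m)) f * snorm (Suc m) g)"
  proof (rule mult_right_mono)
    have "(1::real) \<le> 3 ^ m" by simp
    then show "(1::real) + 2 * 3 ^ m \<le> 3 ^ Suc m" by simp
  qed simp
  finally show ?case using mem by blast
qed

section \<open>Sobolev norms of pairs\<close>

lemma sobolev_norm_alt:
  "sobolev_norm m h = sqrt (\<Sum>i\<in>UNIV. \<Sum>j\<le>m. (L2_norm ((weak_deriv ^^ j) (\<lambda>y. h y $ i)))\<^sup>2)"
proof -
  have "(LINT x:{0..1}|lborel. f x) = (LINT x|circ. f x)" for f :: "real \<Rightarrow> real"
    unfolding set_lebesgue_integral_def by (subst integral_restrict_space) auto
  then show ?thesis by (simp add: sobolev_norm_def L2_norm_square)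
qed

lemma snorm_sum: "snorm m f = (\<Sum>j\<le>m. L2_norm ((weak_deriv ^^ j) f))"
  by (induction m arbitrary: f) (simp_all add: sum.atMost_Suc_shift funpow_swap1 del: sum.atMost_Suc)

lemma sobolev_norm_nonneg [simp]: "0 \<le> sobolev_norm m h"
  unfolding sobolev_norm_alt by (intro real_sqrt_ge_zero sum_nonneg) auto

lemma snorm_le_sobolev_norm: "snorm m (\<lambda>x. h x $ i) \<le> real (Suc m) * sobolev_norm m h"
proof -
  have "L2_norm ((weak_deriv ^^ j) (\<lambda>y. h y $ i)) \<le> sobolev_norm m h" if "j \<le> m" for j
  proof -
    have "(L2_norm ((weak_deriv ^^ j) (\<lambda>y. h y $ i)))\<^sup>2 \<le> (\<Sum>j\<le>m. (L2_norm ((weak_deriv ^^ j) (\<lambda>y. h y $ i)))\<^sup>2)"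
      using that by (intro member_le_sum) auto
    also have "\<dots> \<le> (\<Sum>i\<in>UNIV. \<Sum>j\<le>m. (L2_norm ((weak_deriv ^^ j) (\<lambda>y. h y $ i)))\<^sup>2)"
      by (rule member_le_sum[of i UNIV "\<lambda>i. \<Sum>j\<le>m. (L2_norm ((weak_deriv ^^ j) (\<lambda>y. h y $ i)))\<^sup>2"])
        (auto intro: sum_nonneg)
    finally show ?thesis unfolding sobolev_norm_alt by (rule real_le_rsqrt)
  qed
  then have "snorm m (\<lambda>x. h x $ i) \<le> (\<Sum>j\<le>m. sobolev_norm m h)"
    unfolding snorm_sum by (intro sum_mono) auto
  then show ?thesis by simp
qed

lemma sobolev_norm_le_snorm: "sobolev_norm m h \<le> (\<Sum>i\<in>UNIV. snorm m (\<lambda>x. h x $ i))"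
proof -
  have "sobolev_norm m h = L2_set (\<lambda>(i, j). L2_norm ((weak_deriv ^^ j) (\<lambda>y. h y $ i))) (UNIV \<times> {..m})"
    unfolding sobolev_norm_alt L2_set_def by (simp add: sum.cartesian_product case_prod_beta)
  also have "\<dots> \<le> (\<Sum>(i, j)\<in>UNIV \<times> {..m}. L2_norm ((weak_deriv ^^ j) (\<lambda>y. h y $ i)))"
    by (rule L2_set_le_sum) auto
  also have "\<dots> = (\<Sum>i\<in>UNIV. snorm m (\<lambda>x. h x $ i))"
    by (simp add: snorm_sum sum.cartesian_product)
  finally show ?thesis .
qed

lemma snorm_zero: "snorm m (\<lambda>x. 0) = 0"
  using snorm_scale[OF sobolev_zero, of m 0] by simp

lemma sobolev_pair_iff: "h \<in> sobolev_pair m \<longleftrightarrow> (\<lambda>x. h x $ 1) \<in> sobolev m \<and> (\<lambda>x. h x $ 2) \<in> sobolev m"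
  by (simp add: sobolev_pair_def forall_2)

lemma sobolev_pair_add: "f \<in> sobolev_pair m \<Longrightarrow> h \<in> sobolev_pair m \<Longrightarrow> (\<lambda>x. f x + h x) \<in> sobolev_pair m"
  by (simp add: sobolev_pair_iff sobolev_add)

section \<open>Gradients\<close>

text \<open>
  Along the line \<open>t \<psi>\<close> with a smooth \<open>\<psi>\<close> in one component, the two linear parts differ by at most
  \<open>\<epsilon> t\<close> times a constant for every \<open>\<epsilon>\<close>. So both represent the same functional on smooth functions,
  and the fundamental lemma applies.
\<close>

lemma has_gradient_unique:
  assumes g: "has_gradient m F \<phi> g" and g': "has_gradient m F \<phi> g'"
  shows "(\<lambda>x. g x $ i) \<doteq> (\<lambda>x. g' x $ i)"
proof (rule L2_AE)
  show mem: "(\<lambda>x. g x $ i) \<in> L2_circle" "(\<lambda>x. g' x $ i) \<in> L2_circle"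
    using g g' by (auto simp: has_gradient_def sobolev_pair_def)
  have "AE x in circ. g x $ i - g' x $ i = 0"
  proof (rule fundamental_lemma)
    show "integrable circ (\<lambda>x. g x $ i - g' x $ i)"
      using mem by (simp add: L2_integrable)
    fix \<psi> assume \<psi>: "\<psi> \<in> smooth_circle"
    have \<psi>m: "\<psi> \<in> sobolev m" using \<psi> by (rule smooth_sobolev)
    define h :: "real \<Rightarrow> real \<Rightarrow> complex^2" where "h t x = axis i (of_real t * \<psi> x)" for t x
    have comp: "h t x $ j = (if j = i then of_real t * \<psi> x else 0)" for t x j
      by (simp add: h_def axis_def)
    have "(\<lambda>x. h t x $ j) \<in> sobolev m" for t j
      unfolding comp using sobolev_scale[OF \<psi>m, of "of_real t"] sobolev_zero[of m] by (cases "j = i") simp_all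
    then have hm: "h t \<in> sobolev_pair m" for t
      by (simp add: sobolev_pair_def)
    define N where "N = snorm m \<psi>"
    have hn: "sobolev_norm m (h t) \<le> t * N" if "t > 0" for t
    proof -
      have "sobolev_norm m (h t) \<le> (\<Sum>j\<in>UNIV. snorm m (\<lambda>x. h t x $ j))"
        by (rule sobolev_norm_le_snorm)
      also have "\<dots> = (\<Sum>j\<in>UNIV. if j = i then t * N else 0)"
        unfolding comp N_def using that
        by (intro sum.cong) (auto simp: snorm_zero snorm_scale[OF \<psi>m])
      finally show ?thesis by simp
    qed
    define L where "L = (LINT x|circ. g x $ i * \<psi> x)"
    define L' where "L' = (LINT x|circ. g' x $ i * \<psi> x)"
    have pairing: "circle_integral (\<lambda>x. u x $ 1 * h t x $ 1 + u x $ 2 * h t x $ 2) =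
        of_real t * (LINT x|circ. u x $ i * \<psi> x)" for u t
    proof -
      have "u x $ 1 * h t x $ 1 + u x $ 2 * h t x $ 2 = of_real t * (u x $ i * \<psi> x)" for x
        using exhaust_2[of i] by (auto simp: comp)
      then show ?thesis by (simp add: circle_integral_eq)
    qed
    have small: "cmod (L - L') \<le> 2 * \<epsilon> * N" if \<epsilon>: "\<epsilon> > 0" for \<epsilon>
    proof -
      obtain \<delta> where \<delta>: "\<delta> > 0" "\<And>h. h \<in> sobolev_pair m \<Longrightarrow> sobolev_norm m h < \<delta> \<Longrightarrow>
        cmod (F (\<lambda>x. \<phi> x + h x) - F \<phi> - circle_integral (\<lambda>x. g x $ 1 * h x $ 1 + g x $ 2 * h x $ 2))
          \<le> \<epsilon> * sobolev_norm m h"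
        using g \<epsilon> unfolding has_gradient_def by blast
      obtain \<delta>' where \<delta>': "\<delta>' > 0" "\<And>h. h \<in> sobolev_pair m \<Longrightarrow> sobolev_norm m h < \<delta>' \<Longrightarrow>
        cmod (F (\<lambda>x. \<phi> x + h x) - F \<phi> - circle_integral (\<lambda>x. g' x $ 1 * h x $ 1 + g' x $ 2 * h x $ 2))
          \<le> \<epsilon> * sobolev_norm m h"
        using g' \<epsilon> unfolding has_gradient_def by blast
      \<comment> \<open>Any positive \<open>t\<close> small enough for both \<open>\<delta>\<close> and \<open>\<delta>'\<close> would do; \<open>N + 1\<close> is positive even if \<open>N = 0\<close>.\<close>
      define t where "t = min \<delta> \<delta>' / (2 * (N + 1))"
      have N: "N \<ge> 0" by (simp add: N_def)
      have t: "t > 0" using \<delta> \<delta>' N by (simp add: t_def)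
      have "t * N < min \<delta> \<delta>'"
      proof -
        have "t * N \<le> t * (N + 1)" using t by simp
        also have "\<dots> = min \<delta> \<delta>' / 2" using N by (simp add: t_def field_simps)
        also have "\<dots> < min \<delta> \<delta>'" using \<delta>(1) \<delta>'(1) by (simp add: min_def)
        finally show ?thesis .
      qed
      then have nrm: "sobolev_norm m (h t) < \<delta>" "sobolev_norm m (h t) < \<delta>'"
        using hn[OF t] by auto
      let ?d = "F (\<lambda>x. \<phi> x + h t x) - F \<phi>"
      have 1: "cmod (?d - of_real t * L) \<le> \<epsilon> * sobolev_norm m (h t)"
        using \<delta>(2)[OF hm nrm(1)] by (simp add: pairing L_def)
      have 2: "cmod (?d - of_real t * L') \<le> \<epsilon> * sobolev_norm m (h t)"
        using \<delta>'(2)[OF hm nrm(2)] by (simp add: pairing L'_def)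
      have "t * cmod (L - L') = cmod (of_real t * L - of_real t * L')"
        using t by (simp add: norm_mult flip: right_diff_distrib)
      also have "\<dots> = cmod ((?d - of_real t * L') - (?d - of_real t * L))" by (simp add: algebra_simps)
      also have "\<dots> \<le> \<epsilon> * sobolev_norm m (h t) + \<epsilon> * sobolev_norm m (h t)"
        using norm_triangle_ineq4[of "?d - of_real t * L'" "?d - of_real t * L"] 1 2 by linarith
      also have "\<dots> = 2 * \<epsilon> * sobolev_norm m (h t)" by simp
      also have "\<dots> \<le> 2 * \<epsilon> * (t * N)" using hn[OF t] \<epsilon> by (intro mult_left_mono) auto
      finally have "t * cmod (L - L') \<le> t * (2 * \<epsilon> * N)" by (simp add: algebra_simps)
      then show ?thesis using t by simp
    qed
    have "cmod (L - L') \<le> e" if "e > 0" for e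
    proof -
      have N: "N \<ge> 0" by (simp add: N_def)
      have "cmod (L - L') \<le> 2 * (e / (2 * (N + 1))) * N"
        using that N by (intro small) simp
      also have "\<dots> \<le> e" using that N by (simp add: field_simps)
      finally show ?thesis .
    qed
    then have "L = L'"
      using field_le_epsilon[of "cmod (L - L')" 0] by simp
    then show "(LINT x|circ. (g x $ i - g' x $ i) * \<psi> x) = 0"
      using L2_integrable_mult[OF mem(1) smooth_L2[OF \<psi>]] L2_integrable_mult[OF mem(2) smooth_L2[OF \<psi>]]
      by (simp add: left_diff_distrib L_def L'_def)
  qed
  then show "AE x in circ. g x $ i = g' x $ i" by eventually_elim simp
qed

lemma gradient_works:
  assumes "has_gradient m F \<phi> g"
  shows "has_gradient m F \<phi> (gradient m F \<phi>)" "(\<lambda>x. gradient m F \<phi> x $ i) \<doteq> (\<lambda>x. g x $ i)"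
proof -
  show *: "has_gradient m F \<phi> (gradient m F \<phi>)"
    unfolding gradient_def by (rule someI[of "has_gradient m F \<phi>", OF assms])
  show "(\<lambda>x. gradient m F \<phi> x $ i) \<doteq> (\<lambda>x. g x $ i)"
    by (rule has_gradient_unique[OF * assms])
qed

section \<open>Order of vanishing in the variation\<close>

text \<open>
  \<open>F h\<close> is of size \<open>O(\<parallel>h\<parallel>\<^sup>j)\<close> in \<open>H\<^sup>m\<close> on the unit ball of \<open>H\<^sup>K\<close>. The notion is stable under
  the operations in the recursion of the hierarchy, so that orders can be counted instead of carrying
  constants. For families that do not depend on \<open>h\<close>, order 0 is membership in \<open>H\<^sup>m\<close>
  (\<open>vanishing_order_const\<close>), so one calculus serves for regularity and for size.
\<close>

definition vanishing_order :: "nat \<Rightarrow> nat \<Rightarrow> nat \<Rightarrow> ((real \<Rightarrow> complex^2) \<Rightarrow> real \<Rightarrow> complex) \<Rightarrow> bool" where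
  "vanishing_order K m j F \<longleftrightarrow> (\<forall>h\<in>sobolev_pair K. F h \<in> sobolev m) \<and>
     (\<exists>C\<ge>0. \<forall>h\<in>sobolev_pair K. sobolev_norm K h \<le> 1 \<longrightarrow> snorm m (F h) \<le> C * sobolev_norm K h ^ j)"

lemma vanishing_orderD: "vanishing_order K m j F \<Longrightarrow> h \<in> sobolev_pair K \<Longrightarrow> F h \<in> sobolev m"
  by (simp add: vanishing_order_def)

lemma vanishing_orderE:
  assumes "vanishing_order K m j F"
  obtains C where "C \<ge> 0" "\<And>h. h \<in> sobolev_pair K \<Longrightarrow> sobolev_norm K h \<le> 1 \<Longrightarrow> snorm m (F h) \<le> C * sobolev_norm K h ^ j"
  using assms unfolding vanishing_order_def by blast

lemma vanishing_orderI:
  assumes "\<And>h. h \<in> sobolev_pair K \<Longrightarrow> F h \<in> sobolev m" "C \<ge> 0"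
    "\<And>h. h \<in> sobolev_pair K \<Longrightarrow> sobolev_norm K h \<le> 1 \<Longrightarrow> snorm m (F h) \<le> C * sobolev_norm K h ^ j"
  shows "vanishing_order K m j F"
  using assms unfolding vanishing_order_def by blast

lemma vanishing_order_const: "vanishing_order K m 0 (\<lambda>h. f) \<longleftrightarrow> f \<in> sobolev m"
proof
  have "(\<lambda>x. 0) \<in> sobolev_pair K" by (simp add: sobolev_pair_iff sobolev_zero)
  then show "vanishing_order K m 0 (\<lambda>h. f) \<Longrightarrow> f \<in> sobolev m" by (rule vanishing_orderD[rotated])
  show "f \<in> sobolev m \<Longrightarrow> vanishing_order K m 0 (\<lambda>h. f)"
    by (rule vanishing_orderI[of _ _ _ "snorm m f"]) auto
qed

lemma vanishing_order_component: "vanishing_order K K 1 (\<lambda>h x. h x $ i)"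
  by (rule vanishing_orderI[of _ _ _ "real (Suc K)"])
    (use snorm_le_sobolev_norm in \<open>auto simp: sobolev_pair_def\<close>)

lemma vanishing_order_regularity:
  assumes F: "vanishing_order K n j F" and "m \<le> n"
  shows "vanishing_order K m j F"
proof -
  from F obtain C where "C \<ge> 0" and C: "\<And>h. h \<in> sobolev_pair K \<Longrightarrow> sobolev_norm K h \<le> 1 \<Longrightarrow>
     snorm n (F h) \<le> C * sobolev_norm K h ^ j" by (rule vanishing_orderE) blast
  show ?thesis
    by (rule vanishing_orderI[OF _ \<open>C \<ge> 0\<close>])
      (blast intro: sobolev_mono[OF \<open>m \<le> n\<close>] vanishing_orderD[OF F], 
       blast intro: order_trans[OF snorm_mono[OF \<open>m \<le> n\<close>] C])
qed

lemma vanishing_order_weaken: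
  assumes F: "vanishing_order K m i F" and "j \<le> i"
  shows "vanishing_order K m j F"
proof -
  from F obtain C where "C \<ge> 0" and C: "\<And>h. h \<in> sobolev_pair K \<Longrightarrow> sobolev_norm K h \<le> 1 \<Longrightarrow>
     snorm m (F h) \<le> C * sobolev_norm K h ^ i" by (rule vanishing_orderE) blast
  show ?thesis
  proof (rule vanishing_orderI[OF vanishing_orderD[OF F] \<open>C \<ge> 0\<close>])
    fix h assume h: "h \<in> sobolev_pair K" "sobolev_norm K h \<le> 1"
    have "C * sobolev_norm K h ^ i \<le> C * sobolev_norm K h ^ j"
      using h \<open>C \<ge> 0\<close> \<open>j \<le> i\<close> by (intro mult_left_mono power_decreasing) auto
    with C[OF h] show "snorm m (F h) \<le> C * sobolev_norm K h ^ j" by linarith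
  qed
qed

lemma vanishing_order_cong:
  assumes F: "vanishing_order K m j F" and eq: "\<And>h. h \<in> sobolev_pair K \<Longrightarrow> F h \<doteq> G h"
    and G: "\<And>h. h \<in> sobolev_pair K \<Longrightarrow> G h \<in> L2_circle"
  shows "vanishing_order K m j G"
proof -
  from F obtain C where "C \<ge> 0" and C: "\<And>h. h \<in> sobolev_pair K \<Longrightarrow> sobolev_norm K h \<le> 1 \<Longrightarrow>
     snorm m (F h) \<le> C * sobolev_norm K h ^ j" by (rule vanishing_orderE) blast
  show ?thesis
  proof (rule vanishing_orderI[OF _ \<open>C \<ge> 0\<close>])
    fix h assume h: "h \<in> sobolev_pair K"
    show "G h \<in> sobolev m" by (rule sobolev_cong[OF vanishing_orderD[OF F h] G[OF h] eq[OF h]])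
    assume "sobolev_norm K h \<le> 1"
    with C[OF h] show "snorm m (G h) \<le> C * sobolev_norm K h ^ j"
      using snorm_cong[OF sobolev_L2[OF vanishing_orderD[OF F h]] G[OF h] eq[OF h]] by simp
  qed
qed

lemma vanishing_order_zero: "vanishing_order K m j (\<lambda>h x. 0)"
  by (rule vanishing_orderI[of _ _ _ 0]) (auto simp: snorm_zero sobolev_zero)

lemma vanishing_order_scale:
  assumes F: "vanishing_order K m j F"
  shows "vanishing_order K m j (\<lambda>h x. c * F h x)"
proof -
  from F obtain C where "C \<ge> 0" and C: "\<And>h. h \<in> sobolev_pair K \<Longrightarrow> sobolev_norm K h \<le> 1 \<Longrightarrow>
     snorm m (F h) \<le> C * sobolev_norm K h ^ j" by (rule vanishing_orderE) blast
  show ?thesis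
  proof (rule vanishing_orderI[of _ _ _ "cmod c * C"])
    fix h assume h: "h \<in> sobolev_pair K"
    show "(\<lambda>x. c * F h x) \<in> sobolev m" by (rule sobolev_scale[OF vanishing_orderD[OF F h]])
    assume "sobolev_norm K h \<le> 1"
    with C[OF h] show "snorm m (\<lambda>x. c * F h x) \<le> cmod c * C * sobolev_norm K h ^ j"
      by (simp add: snorm_scale[OF vanishing_orderD[OF F h]] mult.assoc mult_left_mono)
  qed (use \<open>C \<ge> 0\<close> in simp)
qed

lemma vanishing_order_add:
  assumes F: "vanishing_order K m j F" and G: "vanishing_order K m j G"
  shows "vanishing_order K m j (\<lambda>h x. F h x + G h x)"
proof -
  from F obtain C where "C \<ge> 0" and C: "\<And>h. h \<in> sobolev_pair K \<Longrightarrow> sobolev_norm K h \<le> 1 \<Longrightarrow>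
     snorm m (F h) \<le> C * sobolev_norm K h ^ j" by (rule vanishing_orderE) blast
  from G obtain C' where "C' \<ge> 0" and C': "\<And>h. h \<in> sobolev_pair K \<Longrightarrow> sobolev_norm K h \<le> 1 \<Longrightarrow>
     snorm m (G h) \<le> C' * sobolev_norm K h ^ j" by (rule vanishing_orderE) blast
  show ?thesis
  proof (rule vanishing_orderI[of _ _ _ "C + C'"])
    fix h assume h: "h \<in> sobolev_pair K"
    note Fh = vanishing_orderD[OF F h] and Gh = vanishing_orderD[OF G h]
    show "(\<lambda>x. F h x + G h x) \<in> sobolev m" by (rule sobolev_add[OF Fh Gh])
    assume "sobolev_norm K h \<le> 1"
    with C[OF h] C'[OF h] snorm_add[OF Fh Gh]
    show "snorm m (\<lambda>x. F h x + G h x) \<le> (C + C') * sobolev_norm K h ^ j"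
      by (simp add: distrib_right)
  qed (use \<open>C \<ge> 0\<close> \<open>C' \<ge> 0\<close> in simp)
qed

lemma vanishing_order_sum:
  assumes "finite A" "\<And>i. i \<in> A \<Longrightarrow> vanishing_order K m j (F i)"
  shows "vanishing_order K m j (\<lambda>h x. \<Sum>i\<in>A. F i h x)"
  using assms by induction (auto intro: vanishing_order_zero vanishing_order_add)

lemma vanishing_order_mult:
  assumes F: "vanishing_order K (Suc m) i F" and G: "vanishing_order K m j G"
  shows "vanishing_order K m (i + j) (\<lambda>h x. F h x * G h x)"
proof -
  from F obtain C where "C \<ge> 0" and C: "\<And>h. h \<in> sobolev_pair K \<Longrightarrow> sobolev_norm K h \<le> 1 \<Longrightarrow>
     snorm (Suc m) (F h) \<le> C * sobolev_norm K h ^ i" by (rule vanishing_orderE) blast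
  from G obtain C' where "C' \<ge> 0" and C': "\<And>h. h \<in> sobolev_pair K \<Longrightarrow> sobolev_norm K h \<le> 1 \<Longrightarrow>
     snorm m (G h) \<le> C' * sobolev_norm K h ^ j" by (rule vanishing_orderE) blast
  show ?thesis
  proof (rule vanishing_orderI[of _ _ _ "3 ^ m * (C * C')"])
    fix h assume h: "h \<in> sobolev_pair K"
    note FG = sobolev_mult[OF vanishing_orderD[OF F h] vanishing_orderD[OF G h]]
    show "(\<lambda>x. F h x * G h x) \<in> sobolev m" using FG by blast
    assume n: "sobolev_norm K h \<le> 1"
    have "snorm m (\<lambda>x. F h x * G h x) \<le> 3 ^ m * (snorm (Suc m) (F h) * snorm m (G h))"
      using FG by blast
    also have "\<dots> \<le> 3 ^ m * ((C * sobolev_norm K h ^ i) * (C' * sobolev_norm K h ^ j))"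
      using C[OF h n] C'[OF h n] \<open>C \<ge> 0\<close> by (intro mult_left_mono mult_mono) (auto simp del: snorm.simps)
    finally show "snorm m (\<lambda>x. F h x * G h x) \<le> 3 ^ m * (C * C') * sobolev_norm K h ^ (i + j)"
      by (simp add: power_add algebra_simps)
  qed (use \<open>C \<ge> 0\<close> \<open>C' \<ge> 0\<close> in simp)
qed

lemma vanishing_order_weak_deriv:
  assumes F: "vanishing_order K (Suc m) j F"
  shows "vanishing_order K m j (\<lambda>h. weak_deriv (F h))"
proof -
  from F obtain C where "C \<ge> 0" and C: "\<And>h. h \<in> sobolev_pair K \<Longrightarrow> sobolev_norm K h \<le> 1 \<Longrightarrow>
     snorm (Suc m) (F h) \<le> C * sobolev_norm K h ^ j" by (rule vanishing_orderE) blast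
  show ?thesis
  proof (rule vanishing_orderI[OF _ \<open>C \<ge> 0\<close>])
    fix h assume h: "h \<in> sobolev_pair K"
    show "weak_deriv (F h) \<in> sobolev m" by (rule sobolev_Suc_weak_deriv[OF vanishing_orderD[OF F h]])
    assume "sobolev_norm K h \<le> 1"
    from C[OF h this] show "snorm m (weak_deriv (F h)) \<le> C * sobolev_norm K h ^ j"
      using L2_norm_nonneg[of "F h"] unfolding snorm.simps by linarith
  qed
qed

section \<open>Graded sequences of Sobolev functions\<close>

text \<open>
  Coefficients of the product of the generating series, pointwise in \<open>x\<close>. Sequences of functions are
  used next to \<open>series\<close> because weak derivatives act on the functions, whereas algebraic identities
  belong to the ring of formal power series at a fixed point.
\<close>

definition cauchy_prod :: "(nat \<Rightarrow> real \<Rightarrow> complex) \<Rightarrow> (nat \<Rightarrow> real \<Rightarrow> complex) \<Rightarrow> nat \<Rightarrow> real \<Rightarrow> complex"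
    (infixl "\<star>" 70) where
  "(f \<star> g) n x = (\<Sum>j=0..n. f j x * g (n - j) x)"

definition series :: "(nat \<Rightarrow> real \<Rightarrow> complex) \<Rightarrow> real \<Rightarrow> complex fps" where
  "series f x = Abs_fps (\<lambda>n. f n x)"

lemma series_nth [simp]: "fps_nth (series f x) n = f n x"
  by (simp add: series_def)

lemma series_cauchy_prod: "series (f \<star> g) x = series f x * series g x"
  by (rule fps_ext) (simp add: fps_mult_nth cauchy_prod_def)

lemma cauchy_prod_commute: "f \<star> g = g \<star> f"
proof (intro ext)
  fix n x
  have "fps_nth (series f x * series g x) n = fps_nth (series g x * series f x) n"
    by (simp only: mult.commute)
  then show "(f \<star> g) n x = (g \<star> f) n x" by (simp flip: series_cauchy_prod)
qed

lemma cauchy_prod_inner: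
  assumes "f 0 = (\<lambda>x. 0)" "g 0 = (\<lambda>x. 0)"
  shows "(f \<star> g) n x = (\<Sum>j\<in>{0<..<n}. f j x * g (n - j) x)"
  unfolding cauchy_prod_def
proof (rule sum.mono_neutral_right)
  show "\<forall>j\<in>{0..n} - {0<..<n}. f j x * g (n - j) x = 0"
  proof
    fix j assume "j \<in> {0..n} - {0<..<n}"
    then have "j = 0 \<or> n - j = 0" by auto
    then show "f j x * g (n - j) x = 0" using assms by auto
  qed
qed auto

lemma cauchy_prod_0: "f 0 = (\<lambda>x. 0) \<Longrightarrow> (f \<star> g) 0 = (\<lambda>x. 0)"
  by (simp add: cauchy_prod_def fun_eq_iff)

text \<open>
  As the sequences start at index 1, each product involves only indices below \<open>n\<close>. So both factors
  have at least one derivative more than the asserted \<open>k - n\<close>.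
\<close>

lemma vanishing_order_cauchy_prod:
  assumes n: "n \<le> k" and zero: "\<And>h. F h 0 = (\<lambda>x. 0)" "\<And>h. G h 0 = (\<lambda>x. 0)"
    and F: "\<And>j. 0 < j \<Longrightarrow> j < n \<Longrightarrow> vanishing_order K (k - j) a (\<lambda>h. F h j)"
    and G: "\<And>j. 0 < j \<Longrightarrow> j < n \<Longrightarrow> vanishing_order K (k - j) b (\<lambda>h. G h j)"
  shows "vanishing_order K (k - n) (a + b) (\<lambda>h. (F h \<star> G h) n)"
proof -
  have "vanishing_order K (k - n) (a + b) (\<lambda>h x. F h j x * G h (n - j) x)" if j: "j \<in> {0<..<n}" for j
  proof (rule vanishing_order_mult)
    show "vanishing_order K (Suc (k - n)) a (\<lambda>h. F h j)"
      using F[of j] by (rule vanishing_order_regularity) (use j n in auto)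
    show "vanishing_order K (k - n) b (\<lambda>h. G h (n - j))"
      using G[of "n - j"] by (rule vanishing_order_regularity) (use j n in auto)
  qed
  then have "vanishing_order K (k - n) (a + b) (\<lambda>h x. \<Sum>j\<in>{0<..<n}. F h j x * G h (n - j) x)"
    by (intro vanishing_order_sum) auto
  moreover have "(\<lambda>h x. \<Sum>j\<in>{0<..<n}. F h j x * G h (n - j) x) = (\<lambda>h. (F h \<star> G h) n)"
    by (intro ext cauchy_prod_inner[symmetric] zero)
  ultimately show ?thesis by simp
qed

lemma sobolev_cauchy_prod:
  assumes "n \<le> k" "f 0 = (\<lambda>x. 0)" "g 0 = (\<lambda>x. 0)"
    and "\<And>j. 0 < j \<Longrightarrow> j < n \<Longrightarrow> f j \<in> sobolev (k - j)"
    and "\<And>j. 0 < j \<Longrightarrow> j < n \<Longrightarrow> g j \<in> sobolev (k - j)"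
  shows "(f \<star> g) n \<in> sobolev (k - n)"
  using vanishing_order_cauchy_prod[of n k "\<lambda>h. f" "\<lambda>h. g" 0 0 0] assms
  by (simp add: vanishing_order_const)

text \<open>
  Each step of the recursion costs one derivative; at index \<open>k\<close> the functions are still square
  integrable.
\<close>

definition graded :: "nat \<Rightarrow> (nat \<Rightarrow> real \<Rightarrow> complex) \<Rightarrow> bool" where
  "graded k f \<longleftrightarrow> f 0 = (\<lambda>x. 0) \<and> (\<forall>n. 0 < n \<longrightarrow> n \<le> k \<longrightarrow> f n \<in> sobolev (k - n))"

lemma graded_0: "graded k f \<Longrightarrow> f 0 = (\<lambda>x. 0)"
  by (simp add: graded_def)

lemma graded_sobolev: "graded k f \<Longrightarrow> 0 < n \<Longrightarrow> n \<le> k \<Longrightarrow> f n \<in> sobolev (k - n)"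
  by (simp add: graded_def)

lemma graded_L2: "graded k f \<Longrightarrow> n \<le> k \<Longrightarrow> f n \<in> L2_circle"
  by (cases "n = 0") (auto simp: graded_0 intro: sobolev_L2[OF graded_sobolev])

lemma graded_cauchy_prod: "graded k f \<Longrightarrow> graded k g \<Longrightarrow> graded k (f \<star> g)"
  unfolding graded_def[of k "f \<star> g"]
  by (auto intro!: cauchy_prod_0 sobolev_cauchy_prod simp: graded_0 intro: graded_sobolev)

lemma graded_add: "graded k f \<Longrightarrow> graded k g \<Longrightarrow> graded k (\<lambda>n x. f n x + g n x)"
  by (auto simp: graded_def intro: sobolev_add)

lemma graded_scale: "graded k f \<Longrightarrow> graded k (\<lambda>n x. c n * f n x)"
  by (auto simp: graded_def intro: sobolev_scale)

text \<open>
  The weak derivative of the zero function is chosen only up to null sets; index 0 is set to zero so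
  that the series starts with an exact zero at every point.
\<close>

definition deriv_seq :: "(nat \<Rightarrow> real \<Rightarrow> complex) \<Rightarrow> nat \<Rightarrow> real \<Rightarrow> complex" where
  "deriv_seq f n = (if n = 0 then (\<lambda>x. 0) else weak_deriv (f n))"

lemma deriv_seq_0 [simp]: "deriv_seq f 0 = (\<lambda>x. 0)"
  by (simp add: deriv_seq_def)

lemma graded_deriv_seq:
  assumes f: "graded k f" and n: "n < k"
  shows "has_weak_deriv (f n) (deriv_seq f n)" "deriv_seq f n \<in> sobolev (k - Suc n)"
proof -
  have "has_weak_deriv (f n) (deriv_seq f n) \<and> deriv_seq f n \<in> sobolev (k - Suc n)"
  proof (cases "n = 0")
    case True
    then show ?thesis using graded_0[OF f] has_weak_deriv_scale[of "\<lambda>x. 0" "weak_deriv (\<lambda>x. 0)" 0]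
      sobolev_Suc_weak_deriv(1)[OF sobolev_zero] by (simp add: sobolev_zero)
  next
    case False
    then have "f n \<in> sobolev (Suc (k - Suc n))"
      using graded_sobolev[OF f, of n] n by (simp add: Suc_diff_Suc del: sobolev.simps)
    from sobolev_Suc_weak_deriv[OF this] False show ?thesis by (simp add: deriv_seq_def)
  qed
  then show "has_weak_deriv (f n) (deriv_seq f n)" "deriv_seq f n \<in> sobolev (k - Suc n)" by auto
qed

lemma deriv_seq_cong:
  assumes "f n \<in> L2_circle" "g n \<in> L2_circle" "f n \<doteq> g n"
  shows "deriv_seq f n = deriv_seq g n"
  using weak_deriv_cong[OF assms] by (simp add: deriv_seq_def)

lemma deriv_seq_scale:
  assumes f: "graded k f" and n: "n < k"
  shows "deriv_seq (\<lambda>n x. c n * f n x) n \<doteq> (\<lambda>x. c n * deriv_seq f n x)"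
proof (cases "n = 0")
  case False
  then show ?thesis
    using weak_deriv_eq[OF has_weak_deriv_scale[OF graded_deriv_seq(1)[OF assms]], of "c n"]
    by (simp add: deriv_seq_def)
qed simp

lemma has_weak_deriv_zero: "has_weak_deriv (\<lambda>x. 0) (\<lambda>x. 0)"
  by (rule smooth_has_weak_deriv[OF smooth_const smooth_const]) (auto intro!: derivative_eq_intros)

lemma has_weak_deriv_sum:
  assumes "finite A" "\<And>i. i \<in> A \<Longrightarrow> has_weak_deriv (f i) (f' i)"
  shows "has_weak_deriv (\<lambda>x. \<Sum>i\<in>A. f i x) (\<lambda>x. \<Sum>i\<in>A. f' i x)"
  using assms by induction (auto intro: has_weak_deriv_zero has_weak_deriv_add)

lemma has_weak_deriv_cauchy_prod:
  assumes zero: "f 0 = (\<lambda>x. 0)" "g 0 = (\<lambda>x. 0)" "f' 0 = (\<lambda>x. 0)" "g' 0 = (\<lambda>x. 0)"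
    and f: "\<And>j. 0 < j \<Longrightarrow> j < n \<Longrightarrow> has_weak_deriv (f j) (f' j)"
    and g: "\<And>j. 0 < j \<Longrightarrow> j < n \<Longrightarrow> has_weak_deriv (g j) (g' j)"
  shows "has_weak_deriv ((f \<star> g) n) (\<lambda>x. (f' \<star> g) n x + (f \<star> g') n x)"
proof -
  have "has_weak_deriv (\<lambda>x. \<Sum>j\<in>{0<..<n}. f j x * g (n - j) x)
     (\<lambda>x. \<Sum>j\<in>{0<..<n}. f' j x * g (n - j) x + f j x * g' (n - j) x)"
    by (intro has_weak_deriv_sum has_weak_deriv_mult f g) auto
  moreover have "(\<lambda>x. \<Sum>j\<in>{0<..<n}. f j x * g (n - j) x) = (f \<star> g) n"
    by (intro ext cauchy_prod_inner[symmetric] zero)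
  moreover have "(\<lambda>x. \<Sum>j\<in>{0<..<n}. f' j x * g (n - j) x + f j x * g' (n - j) x) =
      (\<lambda>x. (f' \<star> g) n x + (f \<star> g') n x)"
    by (simp add: cauchy_prod_inner zero sum.distrib)
  ultimately show ?thesis by simp
qed

section \<open>The Riccati equation of the hierarchy\<close>

text \<open>
  Uniform form of the recursion, in which the equation for the first index is no exception.
\<close>

lemma nls_r_Suc:
  "nls_r \<phi> (Suc n) x = of_bool (n = 0) * \<phi> x $ 2 - \<i> * deriv_seq (nls_r \<phi>) n x
     + \<phi> x $ 1 * (nls_r \<phi> \<star> nls_r \<phi>) n x"
proof (cases n)
  case 0 then show ?thesis by (simp add: cauchy_prod_0)
next
  case (Suc m)
  have "{0<..<Suc m} = {1..m}" by auto
  then show ?thesis using Suc by (simp add: deriv_seq_def cauchy_prod_inner)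
qed

text \<open>
  Coefficients of the solution of the adjoint of the linearized Riccati equation.
\<close>

fun nls_w :: "(real \<Rightarrow> complex^2) \<Rightarrow> nat \<Rightarrow> real \<Rightarrow> complex" where
  "nls_w \<phi> 0 = (\<lambda>x. 0)"
| "nls_w \<phi> (Suc 0) = (\<lambda>x. \<phi> x $ 1)"
| "nls_w \<phi> (Suc (Suc n)) = (\<lambda>x. \<i> * weak_deriv (nls_w \<phi> (Suc n)) x +
     2 * \<phi> x $ 1 * (\<Sum>j = 1..n. nls_r \<phi> j x * nls_w \<phi> (Suc n - j) x))"

lemma nls_w_Suc:
  "nls_w \<phi> (Suc n) x = of_bool (n = 0) * \<phi> x $ 1 + \<i> * deriv_seq (nls_w \<phi>) n x
     + 2 * \<phi> x $ 1 * (nls_r \<phi> \<star> nls_w \<phi>) n x"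
proof (cases n)
  case 0 then show ?thesis by (simp add: cauchy_prod_0)
next
  case (Suc m)
  have "{0<..<Suc m} = {1..m}" by auto
  then show ?thesis using Suc by (simp add: deriv_seq_def cauchy_prod_inner)
qed

lemma sobolev_recursion_step:
  assumes u: "u \<in> sobolev (k - 1)" and v: "v \<in> sobolev (k - 1)" and f0: "f 0 = (\<lambda>x. 0)"
    and g0: "g 0 = (\<lambda>x. 0)" and n: "n < k"
    and f: "\<And>j. 0 < j \<Longrightarrow> j \<le> n \<Longrightarrow> f j \<in> sobolev (k - j)"
    and g: "\<And>j. 0 < j \<Longrightarrow> j \<le> n \<Longrightarrow> g j \<in> sobolev (k - j)"
  shows "(\<lambda>x. of_bool (n = 0) * v x + c * deriv_seq f n x + d * (u x * (g \<star> f) n x)) \<in> sobolev (k - Suc n)"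
proof (cases "n = 0")
  case True
  then show ?thesis using v by (simp add: cauchy_prod_0 g0)
next
  case False
  have "(g \<star> f) n \<in> sobolev (k - Suc n)"
    by (rule sobolev_mono[OF _ sobolev_cauchy_prod[of n k]]) (use n f g f0 g0 in auto)
  moreover have "u \<in> sobolev (Suc (k - Suc n))"
    by (rule sobolev_mono[OF _ u]) (use n False in auto)
  ultimately have "(\<lambda>x. u x * (g \<star> f) n x) \<in> sobolev (k - Suc n)"
    using sobolev_mult by blast
  then have "(\<lambda>x. d * (u x * (g \<star> f) n x)) \<in> sobolev (k - Suc n)"
    by (rule sobolev_scale)
  moreover have "deriv_seq f n \<in> sobolev (k - Suc n)"
  proof -
    have "f n \<in> sobolev (Suc (k - Suc n))" using f[of n] n False by (simp add: Suc_diff_Suc del: sobolev.simps)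
    from sobolev_Suc_weak_deriv(2)[OF this] show ?thesis using False by (simp add: deriv_seq_def)
  qed
  ultimately show ?thesis using False by (simp add: sobolev_add sobolev_scale)
qed

lemma graded_nls_r:
  assumes "\<phi> \<in> sobolev_pair (k - 1)"
  shows "graded k (nls_r \<phi>)"
proof -
  have "n \<le> k \<Longrightarrow> 0 < n \<Longrightarrow> nls_r \<phi> n \<in> sobolev (k - n)" for n
  proof (induction n rule: less_induct)
    case (less n)
    then obtain m where m: "n = Suc m" by (cases n) auto
    have "(\<lambda>x. of_bool (m = 0) * \<phi> x $ 2 + (- \<i>) * deriv_seq (nls_r \<phi>) m x
        + 1 * (\<phi> x $ 1 * (nls_r \<phi> \<star> nls_r \<phi>) m x)) \<in> sobolev (k - Suc m)"
      using assms less m by (intro sobolev_recursion_step) (auto simp: sobolev_pair_iff)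
    moreover have "nls_r \<phi> n = (\<lambda>x. of_bool (m = 0) * \<phi> x $ 2 + (- \<i>) * deriv_seq (nls_r \<phi>) m x
        + 1 * (\<phi> x $ 1 * (nls_r \<phi> \<star> nls_r \<phi>) m x))"
      unfolding m by (rule ext, subst nls_r_Suc) simp
    ultimately show ?case using m by (simp only:)
  qed
  then show ?thesis by (simp add: graded_def)
qed

lemma graded_nls_w:
  assumes "\<phi> \<in> sobolev_pair (k - 1)"
  shows "graded k (nls_w \<phi>)"
proof -
  have "n \<le> k \<Longrightarrow> 0 < n \<Longrightarrow> nls_w \<phi> n \<in> sobolev (k - n)" for n
  proof (induction n rule: less_induct)
    case (less n)
    then obtain m where m: "n = Suc m" by (cases n) auto
    have "(\<lambda>x. of_bool (m = 0) * \<phi> x $ 1 + \<i> * deriv_seq (nls_w \<phi>) m x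
        + 2 * (\<phi> x $ 1 * (nls_r \<phi> \<star> nls_w \<phi>) m x)) \<in> sobolev (k - Suc m)"
      using assms less m graded_sobolev[OF graded_nls_r[OF assms]]
      by (intro sobolev_recursion_step) (auto simp: sobolev_pair_iff)
    moreover have "nls_w \<phi> n = (\<lambda>x. of_bool (m = 0) * \<phi> x $ 1 + \<i> * deriv_seq (nls_w \<phi>) m x
        + 2 * (\<phi> x $ 1 * (nls_r \<phi> \<star> nls_w \<phi>) m x))"
      unfolding m by (rule ext, subst nls_w_Suc) simp
    ultimately show ?case using m by (simp only:)
  qed
  then show ?thesis by (simp add: graded_def)
qed

definition nls_a :: "(real \<Rightarrow> complex^2) \<Rightarrow> nat \<Rightarrow> real \<Rightarrow> complex" where
  "nls_a \<phi> = nls_r \<phi> \<star> nls_w \<phi>"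

definition nls_p :: "(real \<Rightarrow> complex^2) \<Rightarrow> nat \<Rightarrow> real \<Rightarrow> complex" where
  "nls_p \<phi> n x = nls_r \<phi> n x + (nls_r \<phi> \<star> (nls_r \<phi> \<star> nls_w \<phi>)) n x"

text \<open>
  The Riccati equation. It holds at every point and to all orders, including those where
  \<open>deriv_seq\<close> is no longer a derivative, because it merely restates the recursion.
\<close>

lemma series_nls_r:
  "series (nls_r \<phi>) x = fps_X * (fps_const (\<phi> x $ 2) - fps_const \<i> * series (deriv_seq (nls_r \<phi>)) x
     + fps_const (\<phi> x $ 1) * (series (nls_r \<phi>) x)\<^sup>2)"
proof (rule fps_ext)
  fix n show "fps_nth (series (nls_r \<phi>) x) n = fps_nth (fps_X * (fps_const (\<phi> x $ 2) -
     fps_const \<i> * series (deriv_seq (nls_r \<phi>)) x + fps_const (\<phi> x $ 1) * (series (nls_r \<phi>) x)\<^sup>2)) n"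
    by (cases n) (simp_all add: nls_r_Suc power2_eq_square flip: series_cauchy_prod)
qed

lemma series_nls_w:
  "series (nls_w \<phi>) x = fps_X * (fps_const (\<phi> x $ 1) + fps_const \<i> * series (deriv_seq (nls_w \<phi>)) x
     + 2 * fps_const (\<phi> x $ 1) * (series (nls_r \<phi>) x * series (nls_w \<phi>) x))"
proof (rule fps_ext)
  have "(2 :: complex fps) = fps_const 2" by (rule numeral_fps_const)
  then show "fps_nth (series (nls_w \<phi>) x) n = fps_nth (fps_X * (fps_const (\<phi> x $ 1) + fps_const \<i> * series (deriv_seq (nls_w \<phi>)) x
     + 2 * fps_const (\<phi> x $ 1) * (series (nls_r \<phi>) x * series (nls_w \<phi>) x))) n" for n
    by (cases n) (simp_all add: nls_w_Suc mult.assoc flip: series_cauchy_prod)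
qed

text \<open>
  Multiply the definition of \<open>p' = r' + 2 r r' w + r\<^sup>2 w'\<close> by \<open>i z\<close> and eliminate \<open>i z r'\<close> and
  \<open>i z w'\<close> by means of the two equations.
\<close>

lemma gradient_series_identity:
  fixes X b a I R R1 W W1 :: "'a :: comm_ring_1"
  assumes R: "R = X * (b - I * R1 + a * R\<^sup>2)" and W: "W = X * (a + I * W1 + 2 * a * (R * W))"
  shows "R + R * (R * W) = X * (b * (1 + 2 * (R * W)) - I * (R1 + (R1 * (R * W) + R * (R1 * W + R * W1))))"
proof -
  have "X * I * R1 = X * b + X * a * R\<^sup>2 - X * (b - I * R1 + a * R\<^sup>2)" by (simp add: algebra_simps)
  then have 1: "X * I * R1 = X * b + X * a * R\<^sup>2 - R" unfolding R[symmetric] .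
  have "X * I * W1 = X * (a + I * W1 + 2 * a * (R * W)) - X * a - 2 * X * a * R * W" by (simp add: algebra_simps)
  then have 2: "X * I * W1 = W - X * a - 2 * X * a * R * W" unfolding W[symmetric] .
  have "X * (b * (1 + 2 * (R * W)) - I * (R1 + (R1 * (R * W) + R * (R1 * W + R * W1)))) =
     X * b * (1 + 2 * R * W) - (X * I * R1) * (1 + 2 * R * W) - R\<^sup>2 * (X * I * W1)"
    by (simp add: algebra_simps power2_eq_square)
  also have "\<dots> = R + R * (R * W)"
    unfolding 1 2 by (simp add: algebra_simps power2_eq_square)
  finally show ?thesis by simp
qed


section \<open>The symmetric system for the gradient\<close>

text \<open>
  The coefficients of \<open>p = z (v (1 + 2 a) - i p')\<close>, \<open>w = z (u (1 + 2 a) + i w')\<close> and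
  \<open>a + a\<^sup>2 = w p\<close> up to order \<open>k\<close>, almost everywhere.
\<close>

definition nls_system ::
  "nat \<Rightarrow> (real \<Rightarrow> complex) \<Rightarrow> (real \<Rightarrow> complex) \<Rightarrow> (nat \<Rightarrow> real \<Rightarrow> complex) \<Rightarrow>
   (nat \<Rightarrow> real \<Rightarrow> complex) \<Rightarrow> (nat \<Rightarrow> real \<Rightarrow> complex) \<Rightarrow> bool" where
  "nls_system k u v p w a \<longleftrightarrow> graded k p \<and> graded k w \<and> a 0 = (\<lambda>x. 0) \<and>
     (\<forall>n<k. p (Suc n) \<doteq> (\<lambda>x. v x * (of_bool (n = 0) + 2 * a n x) - \<i> * deriv_seq p n x)) \<and>
     (\<forall>n<k. w (Suc n) \<doteq> (\<lambda>x. u x * (of_bool (n = 0) + 2 * a n x) + \<i> * deriv_seq w n x)) \<and>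
     (\<forall>n\<le>k. a n \<doteq> (\<lambda>x. (w \<star> p) n x - (a \<star> a) n x))"

text \<open>
  The equation for \<open>p\<close> is \<open>gradient_series_identity\<close>, as soon as the formal derivative of
  \<open>r + r\<^sup>2 w\<close> is recognized as the weak derivative, by the Leibniz rule at indices below \<open>k\<close>. The
  other two equations hold at every point.
\<close>

lemma nls_system_solution:
  assumes \<phi>: "\<phi> \<in> sobolev_pair (k - 1)"
  shows "nls_system k (\<lambda>x. \<phi> x $ 1) (\<lambda>x. \<phi> x $ 2) (nls_p \<phi>) (nls_w \<phi>) (nls_a \<phi>)"
proof -
  let ?r = "nls_r \<phi>" and ?w = "nls_w \<phi>"
  let ?r1 = "deriv_seq ?r" and ?w1 = "deriv_seq ?w"
  note r = graded_nls_r[OF \<phi>] and w = graded_nls_w[OF \<phi>]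
  have a: "graded k (?r \<star> ?w)" by (rule graded_cauchy_prod[OF r w])
  have p: "graded k (nls_p \<phi>)"
    unfolding nls_p_def[abs_def] by (intro graded_add graded_cauchy_prod r w)
  define a1 where "a1 = (\<lambda>n x. (?r1 \<star> ?w) n x + (?r \<star> ?w1) n x)"
  define p1 where "p1 = (\<lambda>n x. ?r1 n x + ((?r1 \<star> (?r \<star> ?w)) n x + (?r \<star> a1) n x))"
  \<comment> \<open>Below index \<open>k\<close> the formal derivatives of the series are the weak derivatives of their coefficients.\<close>
  have da: "has_weak_deriv ((?r \<star> ?w) n) (a1 n)" if "n < k" for n
    unfolding a1_def
    by (rule has_weak_deriv_cauchy_prod) (use r w that in \<open>auto simp: graded_0 intro: graded_deriv_seq\<close>)
  have a1_0: "a1 0 = (\<lambda>x. 0)" by (simp add: a1_def cauchy_prod_def)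
  have dp: "has_weak_deriv (nls_p \<phi> n) (p1 n)" if "n < k" for n
  proof -
    have "has_weak_deriv ((?r \<star> (?r \<star> ?w)) n) (\<lambda>x. (?r1 \<star> (?r \<star> ?w)) n x + (?r \<star> a1) n x)"
      by (rule has_weak_deriv_cauchy_prod)
        (use r w a that a1_0 in \<open>auto simp: graded_0 intro: graded_deriv_seq da\<close>)
    from has_weak_deriv_add[OF graded_deriv_seq(1)[OF r that] this]
    show ?thesis by (simp add: p1_def nls_p_def[abs_def])
  qed
  have s_a1: "series a1 x = series ?r1 x * series ?w x + series ?r x * series ?w1 x" for x
    by (rule fps_ext) (simp add: a1_def flip: series_cauchy_prod)
  have s_p1: "series p1 x = series ?r1 x + (series ?r1 x * (series ?r x * series ?w x) + series ?r x * series a1 x)" for x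
    by (rule fps_ext) (simp add: p1_def flip: series_cauchy_prod)
  have s_p: "series (nls_p \<phi>) x = series ?r x + series ?r x * (series ?r x * series ?w x)" for x
    by (rule fps_ext) (simp add: nls_p_def flip: series_cauchy_prod)
  have s_a: "series (nls_a \<phi>) x = series ?r x * series ?w x" for x
    by (simp add: nls_a_def series_cauchy_prod)
  have two: "(2 :: complex fps) = fps_const 2" by (rule numeral_fps_const)
  have p_eq: "nls_p \<phi> (Suc n) x = \<phi> x $ 2 * (of_bool (n = 0) + 2 * nls_a \<phi> n x) - \<i> * p1 n x" for n x
  proof -
    have "series (nls_p \<phi>) x = fps_X * (fps_const (\<phi> x $ 2) * (1 + fps_const 2 * series (nls_a \<phi>) x) -
        fps_const \<i> * series p1 x)"
      using gradient_series_identity[OF series_nls_r series_nls_w, of \<phi> x]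
      unfolding s_p s_p1 s_a s_a1 two by simp
    then have "fps_nth (series (nls_p \<phi>) x) (Suc n) = fps_nth (fps_X * (fps_const (\<phi> x $ 2) * (1 + fps_const 2 * series (nls_a \<phi>) x) -
        fps_const \<i> * series p1 x)) (Suc n)" by (simp only:)
    then show ?thesis by simp
  qed
  have 1: "nls_p \<phi> (Suc n) \<doteq> (\<lambda>x. \<phi> x $ 2 * (of_bool (n = 0) + 2 * nls_a \<phi> n x) - \<i> * deriv_seq (nls_p \<phi>) n x)"
    if "n < k" for n
    using has_weak_deriv_unique[OF dp[OF that] graded_deriv_seq(1)[OF p that]]
    by eventually_elim (simp add: p_eq)
  have 2: "nls_w \<phi> (Suc n) \<doteq> (\<lambda>x. \<phi> x $ 1 * (of_bool (n = 0) + 2 * nls_a \<phi> n x) + \<i> * deriv_seq ?w n x)" for n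
    by (simp add: nls_w_Suc nls_a_def algebra_simps)
  have "series (nls_a \<phi>) x = series ?w x * series (nls_p \<phi>) x - series (nls_a \<phi>) x * series (nls_a \<phi>) x" for x
    unfolding s_p s_a by (simp add: algebra_simps)
  then have "fps_nth (series (nls_a \<phi>) x) n =
     fps_nth (series ?w x * series (nls_p \<phi>) x - series (nls_a \<phi>) x * series (nls_a \<phi>) x) n" for n x
    by (rule arg_cong)
  then have 3: "nls_a \<phi> n x = (?w \<star> nls_p \<phi>) n x - (nls_a \<phi> \<star> nls_a \<phi>) n x" for n x
    by (simp flip: series_cauchy_prod)
  show ?thesis unfolding nls_system_def
    using p w graded_0[OF a] 1 2 3 by (auto simp flip: nls_a_def)
qed

text \<open>
  Coefficients number \<open>n\<close> of \<open>p\<close> and \<open>w\<close> involve only the index \<open>n - 1\<close>. Those of \<open>w p\<close> and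
  \<open>a\<^sup>2\<close> involve only indices strictly between 0 and \<open>n\<close>.
\<close>

lemma nls_system_unique:
  assumes S: "nls_system k u v p w a" and S': "nls_system k u' v' p' w' a'"
    and u: "u \<doteq> u'" and v: "v \<doteq> v'" and n: "n \<le> k"
  shows "p n \<doteq> p' n \<and> w n \<doteq> w' n \<and> a n \<doteq> a' n"
  using n
proof (induction n rule: less_induct)
  case (less n)
  note g = S[unfolded nls_system_def] and g' = S'[unfolded nls_system_def]
  have gr: "graded k p" "graded k w" "graded k p'" "graded k w'" using g g' by blast+
  have zero: "p 0 = (\<lambda>x. 0)" "w 0 = (\<lambda>x. 0)" "a 0 = (\<lambda>x. 0)" "p' 0 = (\<lambda>x. 0)" "w' 0 = (\<lambda>x. 0)" "a' 0 = (\<lambda>x. 0)"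
    using g g' gr[THEN graded_0] by blast+
  show ?case
  proof (cases n)
    case 0 then show ?thesis by (simp add: zero)
  next
    case (Suc m)
    then have mk: "m < k" "m \<le> k" and IH: "p m \<doteq> p' m" "w m \<doteq> w' m" "a m \<doteq> a' m"
      using less.IH[of m] less.prems by auto
    have dp: "deriv_seq p m = deriv_seq p' m"
      by (rule deriv_seq_cong[of p m p', OF graded_L2[OF gr(1) mk(2)] graded_L2[OF gr(3) mk(2)] IH(1)])
    have dw: "deriv_seq w m = deriv_seq w' m"
      by (rule deriv_seq_cong[of w m w', OF graded_L2[OF gr(2) mk(2)] graded_L2[OF gr(4) mk(2)] IH(2)])
    have p1: "p n \<doteq> (\<lambda>x. v x * (of_bool (m = 0) + 2 * a m x) - \<i> * deriv_seq p m x)"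
      and p2: "p' n \<doteq> (\<lambda>x. v' x * (of_bool (m = 0) + 2 * a' m x) - \<i> * deriv_seq p' m x)"
      and w1: "w n \<doteq> (\<lambda>x. u x * (of_bool (m = 0) + 2 * a m x) + \<i> * deriv_seq w m x)"
      and w2: "w' n \<doteq> (\<lambda>x. u' x * (of_bool (m = 0) + 2 * a' m x) + \<i> * deriv_seq w' m x)"
      unfolding Suc using g g' mk(1) by blast+
    have p: "p n \<doteq> p' n" using p1 p2 v IH(3) by eventually_elim (simp add: dp)
    have w: "w n \<doteq> w' n" using w1 w2 u IH(3) by eventually_elim (simp add: dw)
    have a1: "a n \<doteq> (\<lambda>x. (w \<star> p) n x - (a \<star> a) n x)" and a2: "a' n \<doteq> (\<lambda>x. (w' \<star> p') n x - (a' \<star> a') n x)"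
      using g g' less.prems by blast+
    have "AE x in lborel. \<forall>j\<in>{0<..<n}. p j x = p' j x \<and> w j x = w' j x \<and> a j x = a' j x"
    proof (rule AE_finite_allI)
      fix j assume j: "j \<in> {0<..<n}"
      then have "p j \<doteq> p' j \<and> w j \<doteq> w' j \<and> a j \<doteq> a' j" using less.IH[of j] less.prems by simp
      then show "AE x in lborel. p j x = p' j x \<and> w j x = w' j x \<and> a j x = a' j x" by simp
    qed simp
    then have "a n \<doteq> a' n"
      using a1 a2
    proof eventually_elim
      case (elim x)
      have "(w \<star> p) n x = (w' \<star> p') n x" "(a \<star> a) n x = (a' \<star> a') n x"
        unfolding cauchy_prod_inner[of w p, OF zero(2,1)] cauchy_prod_inner[of w' p', OF zero(5,4)]
          cauchy_prod_inner[of a a, OF zero(3,3)] cauchy_prod_inner[of a' a', OF zero(6,6)]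
        using elim(1) by (auto intro!: sum.cong)
      then show ?case using elim by simp
    qed
    with p w show ?thesis by blast
  qed
qed

lemma cauchy_prod_scale:
  "((\<lambda>n x. c ^ n * f n x) \<star> (\<lambda>n x. c ^ n * g n x)) n x = c ^ n * (f \<star> g) n x"
proof -
  have "c ^ j * f j x * (c ^ (n - j) * g (n - j) x) = c ^ n * (f j x * g (n - j) x)" if "j \<le> n" for j
    using that by (simp add: algebra_simps flip: power_add)
  then show ?thesis unfolding cauchy_prod_def sum_distrib_left by (intro sum.cong) auto
qed

text \<open>
  With \<open>z\<close> replaced by \<open>-z\<close> the derivative terms change sign, so the equation of \<open>-w(-z)\<close> has the
  form of that of \<open>p\<close> with \<open>u\<close> in place of \<open>v\<close>, and conversely.
\<close>

lemma nls_system_swap: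
  assumes S: "nls_system k u v p w a"
  shows "nls_system k v u (\<lambda>n x. - ((- 1) ^ n) * w n x) (\<lambda>n x. - ((- 1) ^ n) * p n x) (\<lambda>n x. (- 1) ^ n * a n x)"
proof -
  note g = S[unfolded nls_system_def]
  have p: "graded k p" and w: "graded k w" using g by auto
  have neg: "((\<lambda>n x. - ((- 1) ^ n) * f n x) \<star> (\<lambda>n x. - ((- 1) ^ n) * g n x)) n x = (- 1) ^ n * (f \<star> g) n x" for f g n and x :: real
    using cauchy_prod_scale[of "- 1" f g n x] by (simp add: cauchy_prod_def)
  have 1: "(\<lambda>x. - ((- 1) ^ Suc n) * w (Suc n) x) \<doteq> (\<lambda>x. u x * (of_bool (n = 0) + 2 * ((- 1) ^ n * a n x)) -
      \<i> * deriv_seq (\<lambda>n x. - ((- 1) ^ n) * w n x) n x)" if "n < k" for n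
  proof -
    have "w (Suc n) \<doteq> (\<lambda>x. u x * (of_bool (n = 0) + 2 * a n x) + \<i> * deriv_seq w n x)" using g that by blast
    then show ?thesis using deriv_seq_scale[OF w that, of "\<lambda>n. - ((- 1) ^ n)"]
    proof eventually_elim
      case (elim x) show ?case unfolding elim by (cases "n = 0") (simp_all add: algebra_simps)
    qed
  qed
  have 2: "(\<lambda>x. - ((- 1) ^ Suc n) * p (Suc n) x) \<doteq> (\<lambda>x. v x * (of_bool (n = 0) + 2 * ((- 1) ^ n * a n x)) +
      \<i> * deriv_seq (\<lambda>n x. - ((- 1) ^ n) * p n x) n x)" if "n < k" for n
  proof -
    have "p (Suc n) \<doteq> (\<lambda>x. v x * (of_bool (n = 0) + 2 * a n x) - \<i> * deriv_seq p n x)" using g that by blast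
    then show ?thesis using deriv_seq_scale[OF p that, of "\<lambda>n. - ((- 1) ^ n)"]
    proof eventually_elim
      case (elim x) show ?case unfolding elim by (cases "n = 0") (simp_all add: algebra_simps)
    qed
  qed
  have 3: "(\<lambda>x. (- 1) ^ n * a n x) \<doteq> (\<lambda>x. ((\<lambda>n x. - ((- 1) ^ n) * p n x) \<star> (\<lambda>n x. - ((- 1) ^ n) * w n x)) n x -
      ((\<lambda>n x. (- 1) ^ n * a n x) \<star> (\<lambda>n x. (- 1) ^ n * a n x)) n x)" if "n \<le> k" for n
  proof -
    have "a n \<doteq> (\<lambda>x. (w \<star> p) n x - (a \<star> a) n x)" using g that by blast
    then show ?thesis unfolding neg cauchy_prod_scale cauchy_prod_commute[of p w]
      by eventually_elim (simp flip: right_diff_distrib)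
  qed
  show ?thesis unfolding nls_system_def
    using 1 2 3 g graded_scale[OF p, of "\<lambda>n. - ((- 1) ^ n)"] graded_scale[OF w, of "\<lambda>n. - ((- 1) ^ n)"] by auto
qed

lemma nls_system_rotate:
  assumes S: "nls_system k u v p w a" and c: "c * c' = 1"
  shows "nls_system k (\<lambda>x. c * u x) (\<lambda>x. c' * v x) (\<lambda>n x. c' * p n x) (\<lambda>n x. c * w n x) a"
proof -
  note g = S[unfolded nls_system_def]
  have p: "graded k p" and w: "graded k w" using g by auto
  have prod: "((\<lambda>n x. c * w n x) \<star> (\<lambda>n x. c' * p n x)) = w \<star> p"
    using c by (intro ext) (auto simp: cauchy_prod_def intro!: sum.cong) 
  have 1: "(\<lambda>x. c' * p (Suc n) x) \<doteq> (\<lambda>x. c' * v x * (of_bool (n = 0) + 2 * a n x) -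
      \<i> * deriv_seq (\<lambda>n x. c' * p n x) n x)" if "n < k" for n
  proof -
    have "p (Suc n) \<doteq> (\<lambda>x. v x * (of_bool (n = 0) + 2 * a n x) - \<i> * deriv_seq p n x)" using g that by blast
    then show ?thesis using deriv_seq_scale[OF p that, of "\<lambda>n. c'"]
    proof eventually_elim
      case (elim x) show ?case unfolding elim by (cases "n = 0") (simp_all add: algebra_simps)
    qed
  qed
  have 2: "(\<lambda>x. c * w (Suc n) x) \<doteq> (\<lambda>x. c * u x * (of_bool (n = 0) + 2 * a n x) +
      \<i> * deriv_seq (\<lambda>n x. c * w n x) n x)" if "n < k" for n
  proof -
    have "w (Suc n) \<doteq> (\<lambda>x. u x * (of_bool (n = 0) + 2 * a n x) + \<i> * deriv_seq w n x)" using g that by blast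
    then show ?thesis using deriv_seq_scale[OF w that, of "\<lambda>n. c"]
    proof eventually_elim
      case (elim x) show ?case unfolding elim by (cases "n = 0") (simp_all add: algebra_simps)
    qed
  qed
  show ?thesis unfolding nls_system_def prod
    using 1 2 g graded_scale[OF p, of "\<lambda>n. c'"] graded_scale[OF w, of "\<lambda>n. c"] by auto
qed

section \<open>Differentiability of the Hamiltonians\<close>

text \<open>
  The equation for the increment \<open>D = T - R\<close> is the linearized Riccati equation with source \<open>e + c R\<^sup>2\<close>
  plus quadratic terms, and \<open>W\<close> solves its adjoint. Pairing the two equations eliminates the linear
  operator, except for the total derivative in the last term.
\<close>

lemma variation_series_identity:
  fixes X b a I R R1 T T1 W W1 :: "'a :: idom"
  assumes R: "R = X * (b - I * R1 + a * R\<^sup>2)" and T: "T = X * ((b + e) - I * T1 + (a + c) * T\<^sup>2)"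
    and W: "W = X * (a + I * W1 + 2 * a * (R * W))" and X: "X \<noteq> 0" and D: "D = T - R"
  shows "a * D = W * e + c * (R * (R * W)) + c * (2 * (W * (R * D)) + W * (D * D)) + a * (W * (D * D))
    - I * (W * (T1 - R1) + W1 * D)"
proof -
  have "X * I * R1 = X * b + X * a * R\<^sup>2 - X * (b - I * R1 + a * R\<^sup>2)" by (simp add: algebra_simps)
  then have 1: "X * I * R1 = X * b + X * a * R\<^sup>2 - R" unfolding R[symmetric] .
  have "X * I * T1 = X * (b + e) + X * (a + c) * T\<^sup>2 - X * ((b + e) - I * T1 + (a + c) * T\<^sup>2)"
    by (simp add: algebra_simps)
  then have 2: "X * I * T1 = X * (b + e) + X * (a + c) * T\<^sup>2 - T" unfolding T[symmetric] .
  have "X * I * W1 = X * (a + I * W1 + 2 * a * (R * W)) - X * a - 2 * X * a * R * W" by (simp add: algebra_simps)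
  then have 3: "X * I * W1 = W - X * a - 2 * X * a * R * W" unfolding W[symmetric] .
  have T': "T = R + D" using D by simp
  have "X * (W * e + c * (R * (R * W)) + c * (2 * (W * (R * D)) + W * (D * D)) + a * (W * (D * D))
      - I * (W * (T1 - R1) + W1 * D)) =
    X * (W * e + c * (R * (R * W)) + c * (2 * (W * (R * D)) + W * (D * D)) + a * (W * (D * D)))
      - W * (X * I * T1 - X * I * R1) - (X * I * W1) * D"
    by (simp add: algebra_simps)
  also have "\<dots> = X * (a * D)"
    unfolding 1 2 3 T' by (simp add: algebra_simps power2_eq_square)
  finally show ?thesis using X by simp
qed

definition nls_d :: "(real \<Rightarrow> complex^2) \<Rightarrow> (real \<Rightarrow> complex^2) \<Rightarrow> nat \<Rightarrow> real \<Rightarrow> complex" where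
  "nls_d \<phi> h n x = nls_r (\<lambda>y. \<phi> y + h y) n x - nls_r \<phi> n x"

lemma nls_d_0: "nls_d \<phi> h 0 = (\<lambda>x. 0)"
  by (simp add: nls_d_def fun_eq_iff)

lemma graded_nls_d:
  assumes "\<phi> \<in> sobolev_pair (k - 1)" "h \<in> sobolev_pair (k - 1)"
  shows "graded k (nls_d \<phi> h)"
  using graded_add[OF graded_nls_r[OF sobolev_pair_add[OF assms]] graded_scale[OF graded_nls_r[OF assms(1)], of "\<lambda>n. - 1"]]
  by (simp add: nls_d_def[abs_def])

lemma nls_d_weak_deriv:
  assumes "\<phi> \<in> sobolev_pair (k - 1)" "h \<in> sobolev_pair (k - 1)" "n < k"
  shows "has_weak_deriv (nls_d \<phi> h n)
    (\<lambda>x. deriv_seq (nls_r (\<lambda>y. \<phi> y + h y)) n x - deriv_seq (nls_r \<phi>) n x)"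
proof -
  have "has_weak_deriv (\<lambda>x. nls_r (\<lambda>y. \<phi> y + h y) n x + (- 1) * nls_r \<phi> n x)
    (\<lambda>x. deriv_seq (nls_r (\<lambda>y. \<phi> y + h y)) n x + (- 1) * deriv_seq (nls_r \<phi>) n x)"
    by (intro has_weak_deriv_add has_weak_deriv_scale graded_deriv_seq(1)[OF _ assms(3)] graded_nls_r
        sobolev_pair_add assms)
  then show ?thesis by (simp add: nls_d_def[abs_def])
qed

lemma nls_d_Suc:
  "nls_d \<phi> h (Suc n) x = of_bool (n = 0) * h x $ 2
     - \<i> * (deriv_seq (nls_r (\<lambda>y. \<phi> y + h y)) n x - deriv_seq (nls_r \<phi>) n x)
     + (h x $ 1 * ((nls_r \<phi> \<star> nls_r \<phi>) n x + 2 * (nls_r \<phi> \<star> nls_d \<phi> h) n x + (nls_d \<phi> h \<star> nls_d \<phi> h) n x)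
     + \<phi> x $ 1 * (2 * (nls_r \<phi> \<star> nls_d \<phi> h) n x + (nls_d \<phi> h \<star> nls_d \<phi> h) n x))"
proof -
  let ?r = "nls_r \<phi>" and ?t = "nls_r (\<lambda>y. \<phi> y + h y)" and ?d = "nls_d \<phi> h"
  have "series ?t x = series ?r x + series ?d x"
    by (rule fps_ext) (simp add: nls_d_def)
  then have "series (?t \<star> ?t) x = series (?r \<star> ?r) x + fps_const 2 * series (?r \<star> ?d) x + series (?d \<star> ?d) x"
    by (simp add: series_cauchy_prod algebra_simps flip: numeral_fps_const)
  then have "fps_nth (series (?t \<star> ?t) x) n =
    fps_nth (series (?r \<star> ?r) x + fps_const 2 * series (?r \<star> ?d) x + series (?d \<star> ?d) x) n"
    by (rule arg_cong)
  then have sq: "(?t \<star> ?t) n x = (?r \<star> ?r) n x + 2 * (?r \<star> ?d) n x + (?d \<star> ?d) n x"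
    by simp
  show ?thesis
    unfolding nls_d_def[of \<phi> h "Suc n"] nls_r_Suc sq by (simp add: algebra_simps)
qed

text \<open>
  Induction along the recursion for the increment: every summand contains a factor \<open>h\<close> or an earlier
  increment.
\<close>

lemma vanishing_order_nls_d:
  assumes \<phi>: "\<phi> \<in> sobolev_pair (k - 1)" and n: "n \<le> k"
  shows "vanishing_order (k - 1) (k - n) 1 (\<lambda>h. nls_d \<phi> h n)"
  using n
proof (induction n rule: less_induct)
  case (less n)
  note r = graded_nls_r[OF \<phi>]
  show ?case
  proof (cases n)
    case 0 then show ?thesis by (simp add: nls_d_0 vanishing_order_zero)
  next
    case (Suc m)
    show ?thesis
    proof (cases "m = 0")
      case True
      have "(\<lambda>h. nls_d \<phi> h n) = (\<lambda>h x. h x $ 2)"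
        by (intro ext) (simp add: Suc True nls_d_Suc nls_d_0 cauchy_prod_0)
      then show ?thesis using vanishing_order_component[of "k - 1" 2] by (simp add: Suc True)
    next
      case False
      let ?K = "k - 1" and ?d = "nls_d \<phi>" and ?r = "nls_r \<phi>"
      have mk: "m < k" "Suc (k - n) = k - m" using Suc less.prems by auto
      have IH: "vanishing_order ?K (k - j) 1 (\<lambda>h. ?d h j)" if "j \<le> m" for j
        using less.IH[of j] that Suc mk by simp
      have const: "vanishing_order ?K (k - j) 0 (\<lambda>h. ?r j)" if "0 < j" "j \<le> m" for j
        using graded_sobolev[OF r, of j] that mk by (simp add: vanishing_order_const)
      have rr: "vanishing_order ?K (k - m) 0 (\<lambda>h. (?r \<star> ?r) m)"
        using vanishing_order_cauchy_prod[of m k "\<lambda>h. ?r" "\<lambda>h. ?r" ?K 0 0] const mk by simp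
      have rd: "vanishing_order ?K (k - m) 1 (\<lambda>h. (?r \<star> ?d h) m)"
        using vanishing_order_cauchy_prod[of m k "\<lambda>h. ?r" ?d ?K 0 1] const IH mk by (simp add: nls_d_0)
      have dd: "vanishing_order ?K (k - m) 1 (\<lambda>h. (?d h \<star> ?d h) m)"
        using vanishing_order_weaken[OF vanishing_order_cauchy_prod[of m k ?d ?d ?K 1 1], of 1] IH mk
        by (simp add: nls_d_0)
      have reg: "vanishing_order ?K (k - n) j F" if "vanishing_order ?K (k - m) j F" for j F
        using that by (rule vanishing_order_regularity) (use mk in linarith)
      have h1: "vanishing_order ?K (Suc (k - n)) 1 (\<lambda>h x. h x $ 1)"
        by (rule vanishing_order_regularity[OF vanishing_order_component]) (use False mk in linarith)
      have f1: "vanishing_order ?K (Suc (k - n)) 0 (\<lambda>h x. \<phi> x $ 1)"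
        unfolding vanishing_order_const
        by (rule sobolev_mono[of _ ?K]) (use \<phi> False mk in \<open>auto simp: sobolev_pair_iff\<close>)
      have d1: "vanishing_order ?K (k - n) 1 (\<lambda>h. weak_deriv (?d h m))"
        using IH[of m] unfolding mk(2)[symmetric] by (intro vanishing_order_weak_deriv) simp
      have H: "vanishing_order ?K (k - n) (1 + 0)
        (\<lambda>h x. h x $ 1 * ((?r \<star> ?r) m x + 2 * (?r \<star> ?d h) m x + (?d h \<star> ?d h) m x))"
        by (intro vanishing_order_mult h1 vanishing_order_add vanishing_order_scale reg rr
            vanishing_order_weaken[OF rd] vanishing_order_weaken[OF dd]) auto
      have \<Phi>: "vanishing_order ?K (k - n) (0 + 1)
        (\<lambda>h x. \<phi> x $ 1 * (2 * (?r \<star> ?d h) m x + (?d h \<star> ?d h) m x))"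
        by (intro vanishing_order_mult f1 vanishing_order_add vanishing_order_scale reg rd dd)
      have "vanishing_order ?K (k - n) 1 (\<lambda>h x. (- \<i>) * weak_deriv (?d h m) x +
        (h x $ 1 * ((?r \<star> ?r) m x + 2 * (?r \<star> ?d h) m x + (?d h \<star> ?d h) m x) +
         \<phi> x $ 1 * (2 * (?r \<star> ?d h) m x + (?d h \<star> ?d h) m x)))"
        using H \<Phi> by (intro vanishing_order_add vanishing_order_scale d1) simp_all
      then show ?thesis
      proof (rule vanishing_order_cong)
        fix h assume h: "h \<in> sobolev_pair (k - 1)"
        show "?d h n \<in> L2_circle"
          by (rule graded_L2[OF graded_nls_d[OF \<phi> h] less.prems])
        show "(\<lambda>x. (- \<i>) * weak_deriv (?d h m) x +
          (h x $ 1 * ((?r \<star> ?r) m x + 2 * (?r \<star> ?d h) m x + (?d h \<star> ?d h) m x) +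
           \<phi> x $ 1 * (2 * (?r \<star> ?d h) m x + (?d h \<star> ?d h) m x))) \<doteq> ?d h n"
          using weak_deriv_eq[OF nls_d_weak_deriv[OF \<phi> h mk(1)]]
        proof eventually_elim
          case (elim x)
          show ?case unfolding Suc nls_d_Suc elim using False by simp
        qed
      qed
    qed
  qed
qed

text \<open>
  Integrate the coefficient of order \<open>k\<close> in \<open>variation_series_identity\<close>; the total derivative
  integrates to zero.
\<close>

lemma nls_S_expansion:
  fixes \<phi> h :: "real \<Rightarrow> complex^2"
  defines "d \<equiv> nls_d \<phi> h" and "r \<equiv> nls_r \<phi>" and "w \<equiv> nls_w \<phi>"
  assumes \<phi>: "\<phi> \<in> sobolev_pair (k - 1)" and h: "h \<in> sobolev_pair (k - 1)"
  shows "nls_S k (\<lambda>x. \<phi> x + h x) - nls_S k \<phi> - circle_integral (\<lambda>x. nls_p \<phi> k x * h x $ 1 + w k x * h x $ 2) =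
    (LINT x|circ. h x $ 1 * (d k x + (2 * (w \<star> (r \<star> d)) k x + (w \<star> (d \<star> d)) k x))) +
    (LINT x|circ. \<phi> x $ 1 * (w \<star> (d \<star> d)) k x)"
proof -
  let ?t = "nls_r (\<lambda>y. \<phi> y + h y)"
  note \<phi>h = sobolev_pair_add[OF \<phi> h]
  have gr: "graded k r" and gt: "graded k ?t" and gw: "graded k w" and gd: "graded k d"
    unfolding r_def w_def d_def using \<phi> h \<phi>h by (auto intro: graded_nls_r graded_nls_w graded_nls_d)
  have gp: "graded k (nls_p \<phi>)"
    unfolding nls_p_def[abs_def] using gr gw unfolding r_def w_def by (intro graded_add graded_cauchy_prod)
  have L2h: "(\<lambda>x. h x $ i) \<in> L2_circle" and L2\<phi>: "(\<lambda>x. \<phi> x $ i) \<in> L2_circle" for i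
    using \<phi> h by (auto simp: sobolev_pair_def intro: sobolev_L2)
  define d1 where "d1 = (\<lambda>n x. deriv_seq ?t n x - deriv_seq r n x)"
  \<comment> \<open>The derivative of the coefficient of order \<open>k\<close> of \<open>w d\<close>. At order \<open>k\<close> only indices up to \<open>k - 1\<close> enter, which have weak derivatives.\<close>
  define G where "G = (\<lambda>x. (deriv_seq w \<star> d) k x + (w \<star> d1) k x)"
  have "has_weak_deriv ((w \<star> d) k) G"
    unfolding G_def
  proof (rule has_weak_deriv_cauchy_prod)
    show "has_weak_deriv (d j) (d1 j)" if "j < k" for j
      unfolding d_def d1_def r_def by (rule nls_d_weak_deriv[OF \<phi> h that])
    show "has_weak_deriv (w j) (deriv_seq w j)" if "j < k" for j
      by (rule graded_deriv_seq(1)[OF gw that])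
  qed (simp_all add: graded_0[OF gw] graded_0[OF gd] d1_def)
  then have G: "G \<in> L2_circle" "(LINT x|circ. G x) = 0"
    by (simp_all add: has_weak_deriv_iff)
  let ?F1 = "\<lambda>x. d k x + (2 * (w \<star> (r \<star> d)) k x + (w \<star> (d \<star> d)) k x)"
  let ?F2 = "(w \<star> (d \<star> d)) k"
  have F2: "?F2 \<in> L2_circle"
    by (intro graded_L2[of k] graded_cauchy_prod gw gd) simp
  have "(w \<star> (r \<star> d)) k \<in> L2_circle"
    by (intro graded_L2[of k] graded_cauchy_prod gw gd gr) simp
  then have F1: "?F1 \<in> L2_circle"
    by (intro L2_add L2_scale F2 graded_L2[OF gd]) simp_all
  have key: "(\<phi> x $ 1 + h x $ 1) * ?t k x - \<phi> x $ 1 * r k x - (nls_p \<phi> k x * h x $ 1 + w k x * h x $ 2) =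
     h x $ 1 * ?F1 x + \<phi> x $ 1 * ?F2 x - \<i> * G x" for x
  proof -
    let ?a = "fps_const (\<phi> x $ 1)" and ?b = "fps_const (\<phi> x $ 2)" and ?c = "fps_const (h x $ 1)"
      and ?e = "fps_const (h x $ 2)" and ?I = "fps_const \<i>"
    have R: "series r x = fps_X * (?b - ?I * series (deriv_seq r) x + ?a * (series r x)\<^sup>2)"
      unfolding r_def by (rule series_nls_r)
    have T: "series ?t x = fps_X * ((?b + ?e) - ?I * series (deriv_seq ?t) x + (?a + ?c) * (series ?t x)\<^sup>2)"
      using series_nls_r[of "\<lambda>y. \<phi> y + h y" x] by simp
    have W: "series w x = fps_X * (?a + ?I * series (deriv_seq w) x + 2 * ?a * (series r x * series w x))"
      unfolding r_def w_def by (rule series_nls_w)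
    have sd: "series d x = series ?t x - series r x"
      by (rule fps_ext) (simp add: d_def r_def nls_d_def)
    have sd1: "series d1 x = series (deriv_seq ?t) x - series (deriv_seq r) x"
      by (rule fps_ext) (simp add: d1_def)
    have "?a * series d x = ?e * series w x + ?c * series (r \<star> (r \<star> w)) x +
       ?c * (fps_const 2 * series (w \<star> (r \<star> d)) x + series (w \<star> (d \<star> d)) x) + ?a * series (w \<star> (d \<star> d)) x
       - ?I * (series (w \<star> d1) x + series (deriv_seq w \<star> d) x)"
      using variation_series_identity[OF R T W fps_X_neq_zero sd] unfolding numeral_fps_const
      by (simp add: series_cauchy_prod sd1 mult.commute[of ?e])
    then have "fps_nth (?a * series d x) k = fps_nth (?e * series w x + ?c * series (r \<star> (r \<star> w)) x +
       ?c * (fps_const 2 * series (w \<star> (r \<star> d)) x + series (w \<star> (d \<star> d)) x) + ?a * series (w \<star> (d \<star> d)) x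
       - ?I * (series (w \<star> d1) x + series (deriv_seq w \<star> d) x)) k"
      by (rule arg_cong)
    then have id: "\<phi> x $ 1 * d k x = h x $ 2 * w k x + h x $ 1 * (r \<star> (r \<star> w)) k x +
       h x $ 1 * (2 * (w \<star> (r \<star> d)) k x + ?F2 x) + \<phi> x $ 1 * ?F2 x - \<i> * G x"
      by (simp add: G_def add.commute)
    have t: "?t k x = r k x + d k x" by (simp add: d_def r_def nls_d_def)
    have p: "nls_p \<phi> k x = r k x + (r \<star> (r \<star> w)) k x" by (simp add: nls_p_def r_def w_def)
    have "(\<phi> x $ 1 + h x $ 1) * ?t k x - \<phi> x $ 1 * r k x - (nls_p \<phi> k x * h x $ 1 + w k x * h x $ 2) =
       \<phi> x $ 1 * d k x + h x $ 1 * d k x - h x $ 1 * (r \<star> (r \<star> w)) k x - h x $ 2 * w k x"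
      unfolding t p by (simp add: algebra_simps)
    also have "\<dots> = h x $ 1 * ?F1 x + \<phi> x $ 1 * ?F2 x - \<i> * G x"
      unfolding id by (simp add: algebra_simps)
    finally show ?thesis .
  qed
  have L: "?t k \<in> L2_circle" "r k \<in> L2_circle" "nls_p \<phi> k \<in> L2_circle" "w k \<in> L2_circle"
    using gt gr gp gw by (auto intro: graded_L2)
  have i1: "integrable circ (\<lambda>x. (\<phi> x $ 1 + h x $ 1) * ?t k x)"
    by (intro L2_integrable_mult L2_add L2\<phi> L2h L)
  have i2: "integrable circ (\<lambda>x. \<phi> x $ 1 * r k x)"
    by (intro L2_integrable_mult L2\<phi> L)
  have i3: "integrable circ (\<lambda>x. nls_p \<phi> k x * h x $ 1 + w k x * h x $ 2)"
    by (intro Bochner_Integration.integrable_add L2_integrable_mult L2h L)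
  have i4: "integrable circ (\<lambda>x. h x $ 1 * ?F1 x)" by (intro L2_integrable_mult L2h F1)
  have i5: "integrable circ (\<lambda>x. \<phi> x $ 1 * ?F2 x)" by (intro L2_integrable_mult L2\<phi> F2)
  have "nls_S k (\<lambda>x. \<phi> x + h x) - nls_S k \<phi> - circle_integral (\<lambda>x. nls_p \<phi> k x * h x $ 1 + w k x * h x $ 2) =
    (LINT x|circ. (\<phi> x $ 1 + h x $ 1) * ?t k x - \<phi> x $ 1 * r k x - (nls_p \<phi> k x * h x $ 1 + w k x * h x $ 2))"
    unfolding Bochner_Integration.integral_diff[OF Bochner_Integration.integrable_diff[OF i1 i2] i3]
      Bochner_Integration.integral_diff[OF i1 i2]
    by (simp add: nls_S_def circle_integral_eq r_def)
  also have "\<dots> = (LINT x|circ. h x $ 1 * ?F1 x + \<phi> x $ 1 * ?F2 x - \<i> * G x)"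
    by (simp only: key)
  also have "\<dots> = (LINT x|circ. h x $ 1 * ?F1 x) + (LINT x|circ. \<phi> x $ 1 * ?F2 x) - \<i> * (LINT x|circ. G x)"
    using i4 i5 L2_integrable[OF G(1)] by (subst Bochner_Integration.integral_diff) simp_all
  finally show ?thesis using G(2) by simp
qed

text \<open>
  Both integrals in the expansion are of second order in \<open>h\<close>. In the first one, the factor \<open>h\<close> is
  paired with a function of first order; the second has two factors \<open>d\<close>.
\<close>

theorem nls_S_has_gradient:
  assumes \<phi>: "\<phi> \<in> sobolev_pair (k - 1)"
  shows "has_gradient (k - 1) (nls_S k) \<phi> (\<lambda>x. vector [nls_p \<phi> k x, nls_w \<phi> k x])"
proof -
  let ?K = "k - 1" and ?d = "nls_d \<phi>" and ?r = "nls_r \<phi>" and ?w = "nls_w \<phi>"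
  note gr = graded_nls_r[OF \<phi>] and gw = graded_nls_w[OF \<phi>]
  have gp: "graded k (nls_p \<phi>)"
    unfolding nls_p_def[abs_def] using gr gw by (intro graded_add graded_cauchy_prod)
  have mem: "(\<lambda>x. vector [nls_p \<phi> k x, nls_w \<phi> k x] :: complex^2) \<in> sobolev_pair 0"
    using graded_L2[OF gp] graded_L2[OF gw] by (simp add: sobolev_pair_iff)
  have vr: "vanishing_order ?K (k - j) 0 (\<lambda>h. ?r j)" and vw: "vanishing_order ?K (k - j) 0 (\<lambda>h. ?w j)"
    if "0 < j" "j < k" for j
    using graded_sobolev[OF gr, of j] graded_sobolev[OF gw, of j] that by (simp_all add: vanishing_order_const)
  have vd: "vanishing_order ?K (k - j) 1 (\<lambda>h. ?d h j)" if "j \<le> k" for j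
    by (rule vanishing_order_nls_d[OF \<phi> that])
  have rd: "vanishing_order ?K (k - j) (0 + 1) (\<lambda>h. (?r \<star> ?d h) j)" if "j \<le> k" for j
    using that by (intro vanishing_order_cauchy_prod vr vd) (auto simp: nls_d_0)
  have dd: "vanishing_order ?K (k - j) (1 + 1) (\<lambda>h. (?d h \<star> ?d h) j)" if "j \<le> k" for j
    using that by (intro vanishing_order_cauchy_prod vd) (auto simp: nls_d_0)
  have wrd: "vanishing_order ?K (k - k) (0 + (0 + 1)) (\<lambda>h. (?w \<star> (?r \<star> ?d h)) k)"
    by (intro vanishing_order_cauchy_prod vw rd) (auto intro: cauchy_prod_0)
  have wdd: "vanishing_order ?K (k - k) (0 + (1 + 1)) (\<lambda>h. (?w \<star> (?d h \<star> ?d h)) k)"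
    by (intro vanishing_order_cauchy_prod vw dd) (auto intro: cauchy_prod_0 nls_d_0)
  have v1: "vanishing_order ?K 0 1 (\<lambda>h x. ?d h k x + (2 * (?w \<star> (?r \<star> ?d h)) k x + (?w \<star> (?d h \<star> ?d h)) k x))"
    using vd[of k] wrd vanishing_order_weaken[OF wdd, of 1]
    by (intro vanishing_order_add vanishing_order_scale) simp_all
  obtain C1 where C1: "C1 \<ge> 0" "\<And>h. h \<in> sobolev_pair ?K \<Longrightarrow> sobolev_norm ?K h \<le> 1 \<Longrightarrow>
    snorm 0 (\<lambda>x. ?d h k x + (2 * (?w \<star> (?r \<star> ?d h)) k x + (?w \<star> (?d h \<star> ?d h)) k x)) \<le> C1 * sobolev_norm ?K h ^ 1"
    using v1 by (rule vanishing_orderE) blast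
  obtain C2 where C2: "C2 \<ge> 0" "\<And>h. h \<in> sobolev_pair ?K \<Longrightarrow> sobolev_norm ?K h \<le> 1 \<Longrightarrow>
    snorm (k - k) ((?w \<star> (?d h \<star> ?d h)) k) \<le> C2 * sobolev_norm ?K h ^ (0 + (1 + 1))"
    using wdd by (rule vanishing_orderE) blast
  define B where "B = real (Suc ?K) * C1 + L2_norm (\<lambda>x. \<phi> x $ 1) * C2"
  have B: "B \<ge> 0" using C1 C2 by (simp add: B_def)
  have bound: "cmod (nls_S k (\<lambda>x. \<phi> x + h x) - nls_S k \<phi> -
      circle_integral (\<lambda>x. nls_p \<phi> k x * h x $ 1 + ?w k x * h x $ 2)) \<le> B * (sobolev_norm ?K h)\<^sup>2"
    if h: "h \<in> sobolev_pair ?K" and small: "sobolev_norm ?K h \<le> 1" for h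
  proof -
    let ?N = "sobolev_norm ?K h"
    let ?F1 = "\<lambda>x. ?d h k x + (2 * (?w \<star> (?r \<star> ?d h)) k x + (?w \<star> (?d h \<star> ?d h)) k x)"
    let ?F2 = "(?w \<star> (?d h \<star> ?d h)) k"
    have L2h: "(\<lambda>x. h x $ 1) \<in> L2_circle" and L2\<phi>: "(\<lambda>x. \<phi> x $ 1) \<in> L2_circle"
      using \<phi> h by (auto simp: sobolev_pair_def intro: sobolev_L2)
    have F1: "?F1 \<in> L2_circle" and F2: "?F2 \<in> L2_circle"
      using vanishing_orderD[OF v1 h] vanishing_orderD[OF wdd h] by (auto intro: sobolev_L2)
    have "L2_norm (\<lambda>x. h x $ 1) \<le> snorm ?K (\<lambda>x. h x $ 1)"
      using snorm_mono[of 0 ?K] by simp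
    also have "\<dots> \<le> real (Suc ?K) * ?N" by (rule snorm_le_sobolev_norm)
    finally have n1: "L2_norm (\<lambda>x. h x $ 1) \<le> real (Suc ?K) * ?N" .
    have n2: "L2_norm ?F1 \<le> C1 * ?N" using C1(2)[OF h small] by simp
    have n3: "L2_norm ?F2 \<le> C2 * ?N\<^sup>2" using C2(2)[OF h small] by (simp add: power2_eq_square)
    have "cmod ((LINT x|circ. h x $ 1 * ?F1 x) + (LINT x|circ. \<phi> x $ 1 * ?F2 x)) \<le>
      cmod (LINT x|circ. h x $ 1 * ?F1 x) + cmod (LINT x|circ. \<phi> x $ 1 * ?F2 x)"
      by (rule norm_triangle_ineq)
    also have "\<dots> \<le> L2_norm (\<lambda>x. h x $ 1) * L2_norm ?F1 + L2_norm (\<lambda>x. \<phi> x $ 1) * L2_norm ?F2"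
      by (intro add_mono L2_norm_Cauchy_Schwarz L2h L2\<phi> F1 F2)
    also have "\<dots> \<le> (real (Suc ?K) * ?N) * (C1 * ?N) + L2_norm (\<lambda>x. \<phi> x $ 1) * (C2 * ?N\<^sup>2)"
      using n1 n2 n3 by (intro add_mono mult_mono) simp_all
    also have "\<dots> = B * ?N\<^sup>2"
      by (simp add: B_def power2_eq_square algebra_simps)
    finally show ?thesis unfolding nls_S_expansion[OF \<phi> h] .
  qed
  have "\<exists>\<delta>>0. \<forall>h\<in>sobolev_pair ?K. sobolev_norm ?K h < \<delta> \<longrightarrow>
    cmod (nls_S k (\<lambda>x. \<phi> x + h x) - nls_S k \<phi> -
      circle_integral (\<lambda>x. nls_p \<phi> k x * h x $ 1 + ?w k x * h x $ 2)) \<le> \<epsilon> * sobolev_norm ?K h" if "\<epsilon> > 0" for \<epsilon>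
  proof (intro exI conjI ballI impI)
    \<comment> \<open>The remainder is at most \<open>B \<parallel>h\<parallel>\<^sup>2\<close> when \<open>\<parallel>h\<parallel> \<le> 1\<close>.\<close>
    show "min 1 (\<epsilon> / (B + 1)) > 0" using that B by simp
    fix h assume h: "h \<in> sobolev_pair ?K" and small: "sobolev_norm ?K h < min 1 (\<epsilon> / (B + 1))"
    have "B * sobolev_norm ?K h \<le> (B + 1) * sobolev_norm ?K h" by (intro mult_right_mono) simp_all
    also have "\<dots> \<le> \<epsilon>" using small B by (simp add: field_simps)
    finally have "B * sobolev_norm ?K h * sobolev_norm ?K h \<le> \<epsilon> * sobolev_norm ?K h"
      by (intro mult_right_mono) simp_all
    then show "cmod (nls_S k (\<lambda>x. \<phi> x + h x) - nls_S k \<phi> -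
      circle_integral (\<lambda>x. nls_p \<phi> k x * h x $ 1 + ?w k x * h x $ 2)) \<le> \<epsilon> * sobolev_norm ?K h"
      using bound[OF h] small by (simp add: power2_eq_square mult.assoc)
  qed
  then show ?thesis using mem by (simp add: has_gradient_def)
qed

section \<open>Symmetries\<close>

lemma P_mat_component [simp]: "(P_mat *v v) $ 1 = v $ 2" "(P_mat *v v) $ 2 = v $ 1"
  by (simp_all add: P_mat_def matrix_vector_mult_def sum_2)

lemma R_mat_component [simp]: "(R_mat \<alpha> *v v) $ 1 = exp (\<i> * of_real \<alpha>) * v $ 1"
    "(R_mat \<alpha> *v v) $ 2 = exp (- \<i> * of_real \<alpha>) * v $ 2"
  by (simp_all add: R_mat_def matrix_vector_mult_def sum_2)

lemma J_mat_component [simp]: "(J_mat *v v) $ 1 = v $ 2" "(J_mat *v v) $ 2 = - v $ 1"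
  by (simp_all add: J_mat_def matrix_vector_mult_def sum_2)

lemma exp_phase: "exp (\<i> * of_real \<alpha>) * exp (- \<i> * of_real \<alpha>) = 1" "exp (- \<i> * of_real \<alpha>) * exp (\<i> * of_real \<alpha>) = 1"
  by (simp_all add: exp_minus)

lemma P_mat_sobolev_pair: "\<phi> \<in> sobolev_pair m \<Longrightarrow> (\<lambda>y. P_mat *v \<phi> y) \<in> sobolev_pair m"
  by (simp add: sobolev_pair_iff)

lemma R_mat_sobolev_pair: "\<phi> \<in> sobolev_pair m \<Longrightarrow> (\<lambda>y. R_mat \<alpha> *v \<phi> y) \<in> sobolev_pair m"
  by (simp add: sobolev_pair_iff sobolev_scale)

lemma grad_S_works:
  assumes "\<phi> \<in> sobolev_pair (k - 1)"
  shows "has_gradient (k - 1) (nls_S k) \<phi> (grad_S k \<phi>)"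
    "(\<lambda>x. grad_S k \<phi> x $ 1) \<doteq> nls_p \<phi> k" "(\<lambda>x. grad_S k \<phi> x $ 2) \<doteq> nls_w \<phi> k"
  using gradient_works[OF nls_S_has_gradient[OF assms]] gradient_works(2)[OF nls_S_has_gradient[OF assms], of 1]
    gradient_works(2)[OF nls_S_has_gradient[OF assms], of 2] by simp_all

lemma nls_gradient_swap:
  assumes "\<phi> \<in> sobolev_pair (k - 1)" "n \<le> k"
  shows "nls_p (\<lambda>y. P_mat *v \<phi> y) n \<doteq> (\<lambda>x. - ((- 1) ^ n) * nls_w \<phi> n x)"
    "nls_w (\<lambda>y. P_mat *v \<phi> y) n \<doteq> (\<lambda>x. - ((- 1) ^ n) * nls_p \<phi> n x)"
  using nls_system_unique[OF nls_system_solution[OF P_mat_sobolev_pair[OF assms(1)]]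
      nls_system_swap[OF nls_system_solution[OF assms(1)]] _ _ assms(2)] by simp_all

lemma nls_gradient_rotate:
  assumes "\<phi> \<in> sobolev_pair (k - 1)" "n \<le> k"
  shows "nls_p (\<lambda>y. R_mat \<alpha> *v \<phi> y) n \<doteq> (\<lambda>x. exp (- \<i> * of_real \<alpha>) * nls_p \<phi> n x)"
    "nls_w (\<lambda>y. R_mat \<alpha> *v \<phi> y) n \<doteq> (\<lambda>x. exp (\<i> * of_real \<alpha>) * nls_w \<phi> n x)"
  using nls_system_unique[OF nls_system_solution[OF R_mat_sobolev_pair[OF assms(1)]]
      nls_system_rotate[OF nls_system_solution[OF assms(1)] exp_phase(1)] _ _ assms(2)] by simp_all

lemma grad_S_P:
  assumes \<phi>: "\<phi> \<in> sobolev_pair (k - 1)" and k: "k \<ge> 1"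
  shows "AE x in lborel. grad_S k (\<lambda>y. P_mat *v \<phi> y) x = (-1) ^ (k - 1) *s (P_mat *v grad_S k \<phi> x)"
proof -
  have sign: "- ((- 1) ^ k) = (- 1 :: complex) ^ (k - 1)" using k by (cases k) auto
  show ?thesis
    using grad_S_works(2,3)[OF \<phi>] grad_S_works(2,3)[OF P_mat_sobolev_pair[OF \<phi>]]
      nls_gradient_swap[OF \<phi> order_refl]
    by eventually_elim (simp add: vec_eq_iff forall_2 sign)
qed

lemma grad_S_R:
  assumes \<phi>: "\<phi> \<in> sobolev_pair (k - 1)"
  shows "AE x in lborel. R_mat \<alpha> *v grad_S k (\<lambda>y. R_mat \<alpha> *v \<phi> y) x = grad_S k \<phi> x"
  using grad_S_works(2,3)[OF \<phi>] grad_S_works(2,3)[OF R_mat_sobolev_pair[OF \<phi>, of \<alpha>]]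
    nls_gradient_rotate[OF \<phi> order_refl, of \<alpha>]
proof eventually_elim
  case (elim x)
  then show ?case using exp_phase[of \<alpha>] by (simp add: vec_eq_iff forall_2 flip: mult.assoc)
qed

text \<open>
  Under the symmetry of \<open>\<phi>\<close>, the swapped and the rotated solution solve the same system. The swap
  multiplies \<open>a\<close> by \<open>(-1)\<^sup>n\<close> and the rotation leaves it unchanged.
\<close>

lemma nls_a_odd:
  assumes \<phi>: "\<phi> \<in> sobolev_pair (k - 1)" and sym: "AE x in lborel. P_mat *v \<phi> x = R_mat \<alpha> *v \<phi> x"
    and n: "n \<le> k" "odd n"
  shows "nls_a \<phi> n \<doteq> (\<lambda>x. 0)"
proof -
  have comp: "(P_mat *v \<phi> x) $ i = (R_mat \<alpha> *v \<phi> x) $ i" if "P_mat *v \<phi> x = R_mat \<alpha> *v \<phi> x" for x i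
    using that by simp
  have 1: "(\<lambda>x. \<phi> x $ 2) \<doteq> (\<lambda>x. exp (\<i> * of_real \<alpha>) * \<phi> x $ 1)"
    using sym by eventually_elim (drule comp[where i = 1], simp)
  have 2: "(\<lambda>x. \<phi> x $ 1) \<doteq> (\<lambda>x. exp (- \<i> * of_real \<alpha>) * \<phi> x $ 2)"
    using sym by eventually_elim (drule comp[where i = 2], simp)
  have "(\<lambda>x. (- 1) ^ n * nls_a \<phi> n x) \<doteq> nls_a \<phi> n"
    using nls_system_unique[OF nls_system_swap[OF nls_system_solution[OF \<phi>]]
      nls_system_rotate[OF nls_system_solution[OF \<phi>] exp_phase(1)] 1 2 n(1)] by simp
  then show ?thesis
  proof eventually_elim
    case (elim x)
    then show ?case using n(2) by (simp add: minus_equation_iff eq_neg_iff_add_eq_0)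
  qed
qed

theorem theorem1p2:
  "(\<forall>k\<ge>1. \<forall>\<phi>\<in>sobolev_pair (k - 1). \<forall>\<alpha>::real.
      has_gradient (k - 1) (nls_S k) \<phi> (grad_S k \<phi>) \<and>
      (AE x in lborel. grad_S k \<phi> x =
         (-1) ^ (k - 1) *s (P_mat *v grad_S k (\<lambda>y. P_mat *v \<phi> y) x)) \<and>
      (AE x in lborel. grad_S k \<phi> x =
         R_mat \<alpha> *v grad_S k (\<lambda>y. R_mat \<alpha> *v \<phi> y) x) \<and>
      (AE x in lborel. X_S k (\<lambda>y. R_mat \<alpha> *v \<phi> y) x = R_mat \<alpha> *v X_S k \<phi> x) \<and>
      (AE x in lborel. X_S k (\<lambda>y. P_mat *v \<phi> y) x =
         (-1) ^ k *s (P_mat *v X_S k \<phi> x)))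
   \<and>
   (\<forall>m\<ge>1. \<forall>\<phi>\<in>sobolev_pair (2 * m - 1). \<forall>\<alpha>::real.
      (AE x in lborel. P_mat *v \<phi> x = R_mat \<alpha> *v \<phi> x) \<longrightarrow>
        (\<lambda>y. P_mat *v grad_S (2 * m - 1) \<phi> y) \<in> sobolev_pair 1 \<and>
        (AE x in lborel. (- \<i>) *s (J_mat *v grad_S (2 * m) \<phi> x) =
           weak_deriv_pair (\<lambda>y. P_mat *v grad_S (2 * m - 1) \<phi> y) x))"
proof (intro conjI allI ballI impI)
  fix k :: nat and \<phi> :: "real \<Rightarrow> complex^2" and \<alpha> :: real
  assume k: "1 \<le> k" and \<phi>: "\<phi> \<in> sobolev_pair (k - 1)"
  have sign: "(- 1) ^ k = - ((- 1 :: complex) ^ (k - 1))" using k by (cases k) auto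
  show "has_gradient (k - 1) (nls_S k) \<phi> (grad_S k \<phi>)"
    by (rule grad_S_works(1)[OF \<phi>])
  have P: "AE x in lborel. grad_S k (\<lambda>y. P_mat *v \<phi> y) x = (-1) ^ (k - 1) *s (P_mat *v grad_S k \<phi> x)"
    by (rule grad_S_P[OF \<phi> k])
  have R: "AE x in lborel. R_mat \<alpha> *v grad_S k (\<lambda>y. R_mat \<alpha> *v \<phi> y) x = grad_S k \<phi> x"
    by (rule grad_S_R[OF \<phi>])
  show "AE x in lborel. grad_S k \<phi> x = (-1) ^ (k - 1) *s (P_mat *v grad_S k (\<lambda>y. P_mat *v \<phi> y) x)"
    using P by eventually_elim (simp add: vec_eq_iff forall_2 flip: mult.assoc power_add)
  show "AE x in lborel. grad_S k \<phi> x = R_mat \<alpha> *v grad_S k (\<lambda>y. R_mat \<alpha> *v \<phi> y) x"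
    using R by eventually_elim simp
  show "AE x in lborel. X_S k (\<lambda>y. R_mat \<alpha> *v \<phi> y) x = R_mat \<alpha> *v X_S k \<phi> x"
    using R
  proof eventually_elim
    case (elim x)
    show ?case
      unfolding ham_field_def elim[symmetric] using exp_phase[of \<alpha>]
      by (simp add: vec_eq_iff forall_2) (simp add: algebra_simps flip: mult.assoc)?
  qed
  show "AE x in lborel. X_S k (\<lambda>y. P_mat *v \<phi> y) x = (-1) ^ k *s (P_mat *v X_S k \<phi> x)"
    using P by eventually_elim (simp add: ham_field_def vec_eq_iff forall_2 sign)
next
  fix m :: nat and \<phi> :: "real \<Rightarrow> complex^2" and \<alpha> :: real
  assume m: "1 \<le> m" and \<phi>: "\<phi> \<in> sobolev_pair (2 * m - 1)"
    and sym: "AE x in lborel. P_mat *v \<phi> x = R_mat \<alpha> *v \<phi> x"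
  define l where "l = 2 * m - 1"
  have l: "2 * m = Suc l" "odd l" "0 < l" using m by (auto simp: l_def)
  have \<phi>1: "\<phi> \<in> sobolev_pair (Suc l - 1)" using \<phi> by (simp add: l_def)
  have \<phi>0: "\<phi> \<in> sobolev_pair (l - 1)"
    using \<phi> sobolev_mono[of "l - 1" l] by (simp add: sobolev_pair_def l_def)
  note S = nls_system_solution[OF \<phi>1, unfolded nls_system_def]
  have gp: "graded (Suc l) (nls_p \<phi>)" and gw: "graded (Suc l) (nls_w \<phi>)" using S by blast+
  note grad0 = grad_S_works[OF \<phi>0] and grad1 = grad_S_works[OF \<phi>1]
  have a: "nls_a \<phi> l \<doteq> (\<lambda>x. 0)" using nls_a_odd[OF \<phi>1 sym] l by simp
  have L2: "(\<lambda>x. grad_S l \<phi> x $ i) \<in> L2_circle" for i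
    using grad0(1) by (simp add: has_gradient_def sobolev_pair_def)
  have p1: "nls_p \<phi> l \<in> sobolev 1" and w1: "nls_w \<phi> l \<in> sobolev 1"
    using graded_sobolev[OF gp, of l] graded_sobolev[OF gw, of l] l by simp_all
  have D1: "weak_deriv (\<lambda>x. grad_S l \<phi> x $ 1) = weak_deriv (nls_p \<phi> l)"
    by (rule weak_deriv_cong[OF L2 sobolev_L2[OF p1] grad0(2)])
  have D2: "weak_deriv (\<lambda>x. grad_S l \<phi> x $ 2) = weak_deriv (nls_w \<phi> l)"
    by (rule weak_deriv_cong[OF L2 sobolev_L2[OF w1] grad0(3)])
  show "(\<lambda>y. P_mat *v grad_S (2 * m - 1) \<phi> y) \<in> sobolev_pair 1"
    using sobolev_cong[OF p1 L2 ae_sym[OF grad0(2)]] sobolev_cong[OF w1 L2 ae_sym[OF grad0(3)]]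
    unfolding l_def[symmetric] by (simp add: sobolev_pair_iff del: sobolev.simps)
  have p: "nls_p \<phi> (Suc l) \<doteq> (\<lambda>x. \<phi> x $ 2 * (of_bool (l = 0) + 2 * nls_a \<phi> l x) - \<i> * deriv_seq (nls_p \<phi>) l x)"
    and w: "nls_w \<phi> (Suc l) \<doteq> (\<lambda>x. \<phi> x $ 1 * (of_bool (l = 0) + 2 * nls_a \<phi> l x) + \<i> * deriv_seq (nls_w \<phi>) l x)"
    using S by blast+
  have "AE x in lborel. (- \<i>) *s (J_mat *v grad_S (Suc l) \<phi> x) = weak_deriv_pair (\<lambda>y. P_mat *v grad_S l \<phi> y) x"
    using p w a grad1(2,3)
  proof eventually_elim
    case (elim x)
    have "grad_S (Suc l) \<phi> x $ 1 = - \<i> * weak_deriv (nls_p \<phi> l) x"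
      "grad_S (Suc l) \<phi> x $ 2 = \<i> * weak_deriv (nls_w \<phi> l) x"
      using elim l by (simp_all add: deriv_seq_def)
    then show ?case
      by (simp add: vec_eq_iff forall_2 weak_deriv_pair_def D1[simplified] D2[simplified])
  qed
  then show "AE x in lborel. (- \<i>) *s (J_mat *v grad_S (2 * m) \<phi> x) =
      weak_deriv_pair (\<lambda>y. P_mat *v grad_S (2 * m - 1) \<phi> y) x"
    unfolding l_def[symmetric] by (simp add: l(1))
qed

end
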